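(* Let $\tau=\frac12+ib$ with $b>b_1$ and $p\in(0,\frac12)$. Then $G_p(z)$ has a unique pair of nontrivial critical points $\pm a$ satisfying $a=\pm\bar a$ in $E_\tau$. Furthermore, for fixed $\tau$, these $\pm a=\pm a(p)$ are non-degenerate critical points of $G_p$ except for at most finitely many $p\in(0,\frac12)$.
   Context: For $\operatorname{Im}\tau>0$ let $\Lambda_\tau=\mathbb{Z}+\mathbb{Z}\tau$, $E_\tau=\mathbb{C}/\Lambda_\tau$, $E_\tau[2]=\{0,\tfrac12,\tfrac\tau2,\tfrac{1+\tau}2\}+\Lambda_\tau$. $G(z)=G(z;\tau)$ is the Green function on $E_\tau$: $-\Delta G=\delta_0-\frac1{|E_\tau|}$, $\int_{E_\tau}G=0$. For $p\in E_\tau$, $G_p(z)=\frac12(G(z-p)+G(z+p))$. A critical point $a$ is called trivial if $a\in E_\tau[2]$ (i.e. $a=-a$ in $E_\tau$) and nontrivial otherwise; since $G_p$ is even, nontrivial critical points come in pairs $\pm a$. A critical point is degenerate if the Hessian determinant $\det D^2G_p$ vanishes there. "$a=\pm\bar a$ in $E_\tau$" means $a\equiv\bar a$ or $a\equiv-\bar a$ mod $\Lambda_\tau$ (for $\tau=\frac12+ib$ complex conjugation preserves $\Lambda_\tau$). The constant $b_1$: by Lin–Wang there are $0<b_0<\frac12<b_1<\frac{\sqrt3}2$ such that for $\tau=\frac12+ib$, $b>0$, $G(z;\tau)$ has exactly $5$ critical points if and only if $b\in(0,b_0)\cup(b_1,+\infty)$ (otherwise exactly $3$). *)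

theory Defs
  imports "HOL-Analysis.Analysis"
begin

text \<open>Points of the torus are represented by complex numbers; equality of points
  is congruence modulo the lattice.\<close>

definition lattice :: "complex \<Rightarrow> complex set" where
  "lattice \<tau> = {of_int m + of_int n * \<tau> | m n. True}"

definition torus_rel :: "complex \<Rightarrow> (complex \<times> complex) set" where
  "torus_rel \<tau> = {(z, w). z - w \<in> lattice \<tau>}"

definition two_torsion :: "complex \<Rightarrow> complex set" where
  "two_torsion \<tau> = {t + \<omega> | t \<omega>. t \<in> {0, 1 / 2, \<tau> / 2, (1 + \<tau>) / 2} \<and> \<omega> \<in> lattice \<tau>}"

definition fund_domain :: "complex \<Rightarrow> complex set" where
  "fund_domain \<tau> = {of_real s + of_real t * \<tau> | s t. 0 \<le> s \<and> s < 1 \<and> 0 \<le> t \<and> t < 1}"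

definition periodic :: "complex \<Rightarrow> (complex \<Rightarrow> real) \<Rightarrow> bool" where
  "periodic \<tau> f \<longleftrightarrow> (\<forall>z. \<forall>\<omega>\<in>lattice \<tau>. f (z + \<omega>) = f z)"

definition dir_deriv :: "complex \<Rightarrow> (complex \<Rightarrow> real) \<Rightarrow> complex \<Rightarrow> real" where
  "dir_deriv v f z = frechet_derivative f (at z) v"

definition laplacian :: "(complex \<Rightarrow> real) \<Rightarrow> complex \<Rightarrow> real" where
  "laplacian f z = dir_deriv 1 (dir_deriv 1 f) z + dir_deriv \<i> (dir_deriv \<i> f) z"

text \<open>\<open>C\<^sup>\<infinity>\<close> in the real sense: all iterated directional derivatives are
  (totally) differentiable everywhere.\<close>

definition smooth :: "(complex \<Rightarrow> real) \<Rightarrow> bool" where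
  "smooth f \<longleftrightarrow> (\<forall>vs z. foldr dir_deriv vs f differentiable (at z))"

text \<open>The equation \<open>- \<Delta>G = \<delta>\<^sub>0 - 1 / |E|\<close> holds on the torus in the sense
  of distributions, tested against smooth periodic functions. Continuity off the
  lattice selects the representative that is defined pointwise.\<close>

definition is_green_function :: "complex \<Rightarrow> (complex \<Rightarrow> real) \<Rightarrow> bool" where
  "is_green_function \<tau> G \<longleftrightarrow>
     periodic \<tau> G \<and>
     continuous_on (- lattice \<tau>) G \<and>
     set_integrable lborel (fund_domain \<tau>) G \<and>
     (\<forall>\<phi>. smooth \<phi> \<and> periodic \<tau> \<phi> \<longrightarrow>
        (LINT z:fund_domain \<tau>|lborel. G z * (- laplacian \<phi> z)) =
        \<phi> 0 - (1 / measure lborel (fund_domain \<tau>)) * (LINT z:fund_domain \<tau>|lborel. \<phi> z)) \<and>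
     (LINT z:fund_domain \<tau>|lborel. G z) = 0"

text \<open>For \<open>Im \<tau> > 0\<close> the Green function is unique except for its (irrelevant)
  finite value at lattice points, where \<open>G \<longrightarrow> +\<infinity>\<close>; the choice operator
  only picks that value.\<close>

definition green :: "complex \<Rightarrow> complex \<Rightarrow> real" where
  "green \<tau> = (SOME G. is_green_function \<tau> G)"

definition green_pair :: "complex \<Rightarrow> complex \<Rightarrow> complex \<Rightarrow> real" where
  "green_pair \<tau> p z = (green \<tau> (z - p) + green \<tau> (z + p)) / 2"

text \<open>The logarithmic singularities of the Green functions are never critical points
  in this sense, because the function is not even continuous there.\<close>

definition critical_point :: "(complex \<Rightarrow> real) \<Rightarrow> complex \<Rightarrow> bool" where
  "critical_point f z \<longleftrightarrow> (f has_derivative (\<lambda>h. 0)) (at z)"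

definition hessian :: "(complex \<Rightarrow> real) \<Rightarrow> complex \<Rightarrow> real ^ 2 ^ 2" where
  "hessian f z =
     vector [vector [dir_deriv 1 (dir_deriv 1 f) z, dir_deriv 1 (dir_deriv \<i> f) z],
             vector [dir_deriv \<i> (dir_deriv 1 f) z, dir_deriv \<i> (dir_deriv \<i> f) z]]"

definition degenerate :: "(complex \<Rightarrow> real) \<Rightarrow> complex \<Rightarrow> bool" where
  "degenerate f z \<longleftrightarrow> det (hessian f z) = 0"

definition nontrivial_critical_point :: "complex \<Rightarrow> complex \<Rightarrow> complex \<Rightarrow> bool" where
  "nontrivial_critical_point \<tau> p a \<longleftrightarrow>
     critical_point (green_pair \<tau> p) a \<and> a \<notin> two_torsion \<tau>"

definition conj_symmetric :: "complex \<Rightarrow> complex \<Rightarrow> bool" where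
  "conj_symmetric \<tau> a \<longleftrightarrow> (a, cnj a) \<in> torus_rel \<tau> \<or> (a, - cnj a) \<in> torus_rel \<tau>"

definition green_critical_points :: "complex \<Rightarrow> complex set set" where
  "green_critical_points \<tau> = {z. critical_point (green \<tau>) z} // torus_rel \<tau>"

text \<open>The defining property of the two constants of Lin and Wang, which determines
  them uniquely.\<close>

definition lin_wang_constants :: "real \<Rightarrow> real \<Rightarrow> bool" where
  "lin_wang_constants b0 b1 \<longleftrightarrow>
     0 < b0 \<and> b0 < 1 / 2 \<and> 1 / 2 < b1 \<and> b1 < sqrt 3 / 2 \<and>
     (\<forall>b>0. if b \<in> {0<..<b0} \<union> {b1<..}
            then card (green_critical_points (Complex (1 / 2) b)) = 5
            else card (green_critical_points (Complex (1 / 2) b)) = 3)"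

end

theory Submission
  imports Defs "HOL-Complex_Analysis.Complex_Analysis" "HOL-Real_Asymp.Real_Asymp"
begin

text \<open>The Green function is \<open>- ln \<bar>\<theta>\<bar> / (2 \<pi>)\<close> plus a quadratic term in \<open>Im z\<close>, so its critical points are
  the zeros of the quasi-periodic zeta function corrected to be doubly periodic (Hecke's form \<open>Z\<close>), and
  those of \<open>G\<^sub>p\<close> solve \<open>Z (z - p) + Z (z + p) = 0\<close>. By symmetry, a fifth critical point of \<open>G\<close> must lie on
  the real or the imaginary axis, which for \<open>b > b\<^sub>1\<close> forces \<open>Re (wp (1/2)) > 2 \<pi> / b\<close>, where
  \<open>wp = \<wp> + \<eta>\<^sub>1\<close>. A solution \<open>a = \<plusminus> cnj a\<close> may be moved to one of the two axes. On the real axis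
  \<open>Re Z\<close> decreases strictly between its poles, so there are no solutions. On the imaginary axis the equation
  reads \<open>Im Z (p + i y) = 0\<close>. It has a unique solution \<open>y (p)\<close> in \<open>(0, b)\<close>, because \<open>Im Z\<close> changes
  sign and \<open>Re wp\<close> is quasiconvex on the segment, so that every zero is a strict upcrossing. With
  \<open>R = Re (wp (p + i y (p)))\<close>, the Hessian determinant is \<open>R / (2 \<pi>) * (1 / b - R / (2 \<pi>))\<close>. The second
  factor is positive by the strict upcrossing. The first one is real-analytic along the curve
  \<open>p + i y (p)\<close>, up to and including the end points \<open>p = 0, 1/2\<close>, and nonzero at \<open>p = 1/4\<close>, where the
  curve passes through \<open>\<tau> / 2\<close>; hence it vanishes only finitely often.\<close>

subsection \<open>Theta product\<close>

text \<open>\<open>green\<close> is a choice among the solutions of a distributional equation, so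
  nothing can be read off it directly. Much of the work goes into showing that the theta formula is
  one solution (Green's identity on strips whose edges approach the pole) and that every solution
  agrees with it off the lattice (all Fourier moments of the difference vanish). Only then do
  critical points become zeros of \<open>hecke\<close> and of sums of its translates. The constant
  \<open>b1\<close> enters through the count 5 alone, which is turned into the analytic inequality
  \<open>Re (wp (1/2)) > 2 * pi / b\<close>; everything afterwards works from that inequality. The
  quasiconvexity rests on an identity: \<open>wp (z + p) + wp (z - p)\<close> is a quadratic
  polynomial in \<open>1 / (wp p - wp z)\<close>. For real \<open>p\<close> its leading coefficient
  is nonnegative up to a positive factor, and along the imaginary axis the variable is real and
  increasing. Finiteness is treated on the closed interval \<open>{0..1/2}\<close>, because
  compactness is what turns infinitely many degenerate parameters into an accumulation point where
  analyticity applies.\<close>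

definition ee :: "complex \<Rightarrow> complex" where
  "ee z = exp (2 * complex_of_real pi * \<i> * z)"

lemma ee_add: "ee (z + w) = ee z * ee w"
  by (simp add: ee_def exp_add distrib_left)

lemma ee_minus: "ee (- z) = inverse (ee z)"
  by (simp add: ee_def exp_minus)

lemma ee_nonzero [simp]: "ee z \<noteq> 0"
  by (simp add: ee_def)

lemma ee_of_int [simp]: "ee (of_int n) = 1"
  by (simp add: ee_def exp_eq_1)

lemma ee_1 [simp]: "ee 1 = 1"
  using ee_of_int[of 1] by simp

lemma ee_eq_1_iff: "ee z = 1 \<longleftrightarrow> z \<in> \<int>"
proof
  assume "ee z = 1"
  then obtain n :: int where "Re (2 * complex_of_real pi * \<i> * z) = 0"
     "Im (2 * complex_of_real pi * \<i> * z) = of_int (2 * n) * pi"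
    unfolding ee_def exp_eq_1 by blast
  then have "z = of_int n"
    by (auto simp: complex_eq_iff)
  then show "z \<in> \<int>" by simp
next
  assume "z \<in> \<int>"
  then show "ee z = 1" by (auto elim: Ints_cases)
qed

lemma norm_ee: "norm (ee z) = exp (- 2 * pi * Im z)"
  by (simp add: ee_def norm_exp_eq_Re)

lemma cnj_ee: "cnj (ee z) = ee (- cnj z)"
  by (simp add: ee_def exp_cnj)

lemma ee_power: "ee (of_nat n * z) = ee z ^ n"
  by (simp add: ee_def exp_of_nat_mult [symmetric] algebra_simps)

lemma holomorphic_on_ee [holomorphic_intros]:
  "f holomorphic_on A \<Longrightarrow> (\<lambda>z. ee (f z)) holomorphic_on A"
  unfolding ee_def by (intro holomorphic_intros)

text \<open>Writes the sine through \<open>ee\<close>, so that its factor \<open>1 - ee z\<close>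
  can be absorbed when the product telescopes under \<open>z + tau\<close>.\<close>

lemma sin_pi_eq_ee: "sin (of_real pi * z) = \<i> / 2 * exp (- of_real pi * \<i> * z) * (1 - ee z)"
proof -
  have "exp (- of_real pi * \<i> * z) * ee z = exp (\<i> * (of_real pi * z))"
    unfolding ee_def by (simp add: algebra_simps flip: exp_add)
  moreover have "exp (- of_real pi * \<i> * z) = exp (- (\<i> * (of_real pi * z)))"
    by (simp add: algebra_simps)
  ultimately show ?thesis
    unfolding sin_exp_eq by (simp add: field_simps)
qed

section \<open>The rhombic lattice and its theta function\<close>

locale rhombic_torus =
  fixes b :: real
  assumes b_pos: "b > 0"
begin

definition tau :: complex where "tau = Complex (1 / 2) b"

lemma Re_tau [simp]: "Re tau = 1 / 2" and Im_tau [simp]: "Im tau = b"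
  by (simp_all add: tau_def)

text \<open>Source of all reflection symmetry below: because \<open>2 * Re tau = 1\<close>,
  conjugation maps the lattice to itself.\<close>

lemma cnj_tau: "cnj tau = 1 - tau"
  by (simp add: complex_eq_iff)

abbreviation "\<Lambda> \<equiv> lattice tau"

lemma lattice_iff: "z \<in> \<Lambda> \<longleftrightarrow> (\<exists>m n. z = of_int m + of_int n * tau)"
  by (auto simp: lattice_def)

lemma lattice_add: "z \<in> \<Lambda> \<Longrightarrow> w \<in> \<Lambda> \<Longrightarrow> z + w \<in> \<Lambda>"
proof -
  assume "z \<in> \<Lambda>" "w \<in> \<Lambda>"
  then obtain m n m' n' where "z = of_int m + of_int n * tau" "w = of_int m' + of_int n' * tau"
    by (auto simp: lattice_iff)
  then have "z + w = of_int (m + m') + of_int (n + n') * tau"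
    by (simp add: algebra_simps)
  then show ?thesis
    unfolding lattice_iff by blast
qed

lemma lattice_minus: "z \<in> \<Lambda> \<Longrightarrow> - z \<in> \<Lambda>"
proof -
  assume "z \<in> \<Lambda>"
  then obtain m n where "z = of_int m + of_int n * tau"
    by (auto simp: lattice_iff)
  then have "- z = of_int (- m) + of_int (- n) * tau"
    by (simp add: algebra_simps)
  then show ?thesis
    unfolding lattice_iff by blast
qed

lemma lattice_minus_iff [simp]: "- z \<in> \<Lambda> \<longleftrightarrow> z \<in> \<Lambda>"
  using lattice_minus[of z] lattice_minus[of "- z"] by auto

lemma lattice_diff: "z \<in> \<Lambda> \<Longrightarrow> w \<in> \<Lambda> \<Longrightarrow> z - w \<in> \<Lambda>"
  using lattice_add[of z "- w"] by simp

lemma lattice_of_int [simp]: "of_int m \<in> \<Lambda>"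
  unfolding lattice_iff by (rule exI[of _ m], rule exI[of _ 0]) simp

lemma lattice_0 [simp]: "0 \<in> \<Lambda>" and lattice_1 [simp]: "1 \<in> \<Lambda>"
  using lattice_of_int[of 0] lattice_of_int[of 1] by auto

lemma lattice_tau [simp]: "tau \<in> \<Lambda>"
  unfolding lattice_iff by (rule exI[of _ 0], rule exI[of _ 1]) simp

lemma lattice_cnj: "z \<in> \<Lambda> \<Longrightarrow> cnj z \<in> \<Lambda>"
proof -
  assume "z \<in> \<Lambda>"
  then obtain m n where "z = of_int m + of_int n * tau"
    by (auto simp: lattice_iff)
  then have "cnj z = of_int (m + n) + of_int (- n) * tau"
    by (simp add: cnj_tau algebra_simps)
  then show ?thesis
    unfolding lattice_iff by blast
qed

lemma lattice_cnj_iff [simp]: "cnj z \<in> \<Lambda> \<longleftrightarrow> z \<in> \<Lambda>"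
  using lattice_cnj[of z] lattice_cnj[of "cnj z"] by auto

lemma lattice_shift: "w \<in> \<Lambda> \<Longrightarrow> z + w \<in> \<Lambda> \<longleftrightarrow> z \<in> \<Lambda>"
  using lattice_add[of z w] lattice_diff[of "z + w" w] by auto

text \<open>Turns lattice membership into a statement about integers; an odd \<open>n\<close>
  carries the half-integral shift of the real part.\<close>

lemma lattice_coords: "z \<in> \<Lambda> \<longleftrightarrow> (\<exists>m n :: int. Re z = of_int m + of_int n / 2 \<and> Im z = of_int n * b)"
  unfolding lattice_iff by (simp add: complex_eq_iff)

text \<open>Jacobi product for the odd theta function, up to a constant factor.\<close>

definition eta_factor :: "nat \<Rightarrow> complex \<Rightarrow> complex" where
  "eta_factor k z = (1 - ee (of_nat (Suc k) * tau + z)) * (1 - ee (of_nat (Suc k) * tau - z))"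

definition eta :: "complex \<Rightarrow> complex" where
  "eta z = (\<Prod>k. eta_factor k z)"

definition theta :: "complex \<Rightarrow> complex" where
  "theta z = sin (of_real pi * z) * eta z"

lemma eta_factor_holomorphic [holomorphic_intros]: "eta_factor k holomorphic_on A"
  unfolding eta_factor_def by (intro holomorphic_intros)

lemma norm_ee_tau: "norm (ee tau) < 1"
  using b_pos by (simp add: norm_ee)

text \<open>The geometric factor comes from the \<open>k + 1\<close> copies of \<open>tau\<close>,
  the constant from the growth of \<open>ee\<close> on the disc. Uniformity in \<open>z\<close>
  gives one Weierstrass majorant for the whole disc.\<close>

lemma eta_factor_bound:
  assumes "norm z \<le> R"
  shows "norm (eta_factor k z - 1) \<le> (2 * exp (2 * pi * R) + (exp (2 * pi * R))\<^sup>2) * norm (ee tau) ^ k"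
proof -
  define q where "q = norm (ee tau)"
  have q: "0 \<le> q" "q \<le> 1" using norm_ee_tau by (auto simp: q_def)
  have *: "norm (ee w) \<le> exp (2 * pi * R)" if "norm w = norm z" for w
  proof -
    have "\<bar>Im w\<bar> \<le> R" using abs_Im_le_cmod[of w] that assms by linarith
    then have "- Im w \<le> R" by linarith
    from mult_left_mono[OF this, of "2 * pi"] show ?thesis by (simp add: norm_ee)
  qed
  define A where "A = ee (of_nat (Suc k) * tau + z)"
  define B where "B = ee (of_nat (Suc k) * tau - z)"
  have qq: "q ^ Suc k \<le> q ^ k" using q by (simp add: mult_left_le_one_le)
  have A: "norm A \<le> exp (2 * pi * R) * q ^ k"
  proof -
    have "norm A = norm (ee z) * q ^ Suc k"
      unfolding A_def ee_add ee_power norm_mult norm_power q_def by simp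
    also have "\<dots> \<le> exp (2 * pi * R) * q ^ k"
      using *[of z] qq q by (intro mult_mono) auto
    finally show ?thesis .
  qed
  have B: "norm B \<le> exp (2 * pi * R) * q ^ k"
  proof -
    have "norm B = norm (ee (- z)) * q ^ Suc k"
      unfolding B_def diff_conv_add_uminus ee_add ee_power norm_mult norm_power q_def by simp
    also have "\<dots> \<le> exp (2 * pi * R) * q ^ k"
      using *[of "- z"] qq q by (intro mult_mono) auto
    finally show ?thesis .
  qed
  have "eta_factor k z - 1 = - A - B + A * B"
    by (simp add: eta_factor_def A_def B_def algebra_simps)
  then have "norm (eta_factor k z - 1) \<le> norm A + norm B + norm A * norm B"
    by (metis (no_types, lifting) norm_triangle_le norm_minus_cancel norm_mult norm_triangle_ineq4 add_mono order_refl)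
  also have "\<dots> \<le> exp (2 * pi * R) * q ^ k + exp (2 * pi * R) * q ^ k + (exp (2 * pi * R) * q ^ k) * (exp (2 * pi * R) * 1)"
  proof (intro add_mono mult_mono A B)
    have "exp (2 * pi * R) * q ^ k \<le> exp (2 * pi * R) * 1"
      using q by (intro mult_left_mono) (auto simp: power_le_one)
    then show "norm B \<le> exp (2 * pi * R) * 1" using B by linarith
  qed (use q in auto)
  also have "\<dots> = (2 * exp (2 * pi * R) + (exp (2 * pi * R))\<^sup>2) * q ^ k"
    by (simp add: algebra_simps power2_eq_square)
  finally show ?thesis unfolding q_def .
qed

lemma summable_norm_ee_tau: "summable (\<lambda>k. C * norm (ee tau) ^ k)"
  using norm_ee_tau by (intro summable_mult summable_geometric) simp

lemma eta_convergent: "convergent_prod (\<lambda>k. eta_factor k z)"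
proof (intro abs_convergent_prod_imp_convergent_prod summable_imp_abs_convergent_prod)
  show "summable (\<lambda>k. norm (eta_factor k z - 1))"
    by (rule summable_comparison_test'[OF summable_norm_ee_tau])
       (use eta_factor_bound[of z "norm z"] in auto)
qed

lemma eta_has_prod: "(\<lambda>k. eta_factor k z) has_prod eta z"
  unfolding eta_def using eta_convergent by blast

lemma eta_LIMSEQ: "(\<lambda>N. \<Prod>k<N. eta_factor k z) \<longlonglongrightarrow> eta z"
  using convergent_prod_LIMSEQ[OF eta_convergent, of z]
  unfolding eta_def lessThan_Suc_atMost[symmetric] by (rule LIMSEQ_imp_Suc)

text \<open>Locally uniform convergence makes \<open>eta\<close> entire and later allows logarithmic
  derivatives to be taken factor by factor.\<close>

lemma eta_uniform_limit_cball:
  "uniform_limit (cball 0 R) (\<lambda>N z. \<Prod>k<N. eta_factor k z) eta sequentially"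
proof -
  have "uniformly_convergent_on (cball 0 R) (\<lambda>N z. \<Prod>k<N. eta_factor k z)"
  proof (rule uniformly_convergent_on_prod')
    show "continuous_on (cball 0 R) (eta_factor k)" for k
      by (intro holomorphic_on_imp_continuous_on holomorphic_intros)
    show "uniformly_convergent_on (cball 0 R) (\<lambda>N z. \<Sum>k<N. norm (eta_factor k z - 1))"
    proof (rule Weierstrass_m_test')
      show "summable (\<lambda>k. (2 * exp (2 * pi * R) + (exp (2 * pi * R))\<^sup>2) * norm (ee tau) ^ k)"
        by (rule summable_norm_ee_tau)
    qed (use eta_factor_bound in auto)
  qed auto
  then obtain g where g: "uniform_limit (cball 0 R) (\<lambda>N z. \<Prod>k<N. eta_factor k z) g sequentially"
    by (auto simp: uniformly_convergent_on_def)
  also have "?this \<longleftrightarrow> ?thesis"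
  proof (rule uniform_limit_cong')
    fix z assume "z \<in> cball (0 :: complex) R"
    from tendsto_uniform_limitI[OF g this] eta_LIMSEQ[of z] show "g z = eta z"
      by (rule LIMSEQ_unique)
  qed auto
  finally show ?thesis .
qed

lemma eta_holomorphic [holomorphic_intros]: "eta holomorphic_on A"
proof (rule holomorphic_on_subset)
  show "eta holomorphic_on UNIV"
  proof (rule holomorphic_uniform_sequence)
    fix z :: complex
    have "uniform_limit (cball z 1) (\<lambda>N z. \<Prod>k<N. eta_factor k z) eta sequentially"
      by (rule uniform_limit_on_subset[OF eta_uniform_limit_cball[of "norm z + 1"]])
         (simp add: cball_subset_cball_iff)
    then show "\<exists>d>0. cball z d \<subseteq> UNIV \<and>
        uniform_limit (cball z d) (\<lambda>N z. \<Prod>k<N. eta_factor k z) eta sequentially"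
      by (intro exI[of _ 1]) auto
  qed (auto intro!: holomorphic_intros)
qed auto

lemma theta_holomorphic [holomorphic_intros]: "theta holomorphic_on A"
  unfolding theta_def[abs_def] by (intro holomorphic_intros)

lemma sin_pi_eq_0_iff: "sin (of_real pi * z) = 0 \<longleftrightarrow> z \<in> (\<int> :: complex set)"
  by (auto simp: sin_pi_eq_ee ee_eq_1_iff[symmetric])

text \<open>The sine contributes the row \<open>n = 0\<close>, the factor with index
  \<open>k\<close> the rows \<open>n = k + 1\<close> and \<open>n = - (k + 1)\<close>; a convergent
  product vanishes only if one of its factors does.\<close>

lemma theta_eq_0_iff: "theta z = 0 \<longleftrightarrow> z \<in> \<Lambda>"
proof
  assume "theta z = 0"
  then consider "z \<in> \<int>" | k where "eta_factor k z = 0"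
    unfolding theta_def using sin_pi_eq_0_iff has_prod_eq_0_iff[OF eta_has_prod, of z] by auto
  then show "z \<in> \<Lambda>"
  proof cases
    case 1
    then show ?thesis by (auto elim!: Ints_cases)
  next
    case (2 k)
    then consider "of_nat (Suc k) * tau + z \<in> \<int>" | "of_nat (Suc k) * tau - z \<in> \<int>"
      unfolding eta_factor_def by (auto simp flip: ee_eq_1_iff)
    then show ?thesis
    proof cases
      case 1
      then obtain m where "of_nat (Suc k) * tau + z = of_int m" by (auto elim!: Ints_cases)
      then have "z = of_int m + of_int (- int (Suc k)) * tau" by (simp add: algebra_simps)
      then show ?thesis unfolding lattice_iff by blast
    next
      case 2
      then obtain m where "of_nat (Suc k) * tau - z = of_int m" by (auto elim!: Ints_cases)
      then have "z = of_int (- m) + of_int (int (Suc k)) * tau" by (simp add: algebra_simps)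
      then show ?thesis unfolding lattice_iff by blast
    qed
  qed
next
  assume "z \<in> \<Lambda>"
  then obtain m n where z: "z = of_int m + of_int n * tau" by (auto simp: lattice_iff)
  show "theta z = 0"
  proof (cases "n = 0")
    case True
    then show ?thesis using sin_pi_eq_0_iff[of z] z by (simp add: theta_def)
  next
    case False
    \<comment> \<open>Factors are counted from 0, so the rows \<open>n\<close> and
      \<open>- n\<close> belong to the index \<open>\<bar>n\<bar> - 1\<close>.\<close>
    define k where "k = nat \<bar>n\<bar> - 1"
    have k: "of_nat (Suc k) = complex_of_int \<bar>n\<bar>" using False by (simp add: k_def)
    have "eta_factor k z = 0"
    proof (cases "n > 0")
      case True
      then have "of_nat (Suc k) * tau - z = of_int (- m)" unfolding k z by simp
      then show ?thesis unfolding eta_factor_def by (metis ee_of_int diff_self mult_zero_right)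
    next
      case False
      then have "of_nat (Suc k) * tau + z = of_int m" unfolding k z by simp
      then show ?thesis unfolding eta_factor_def by (metis ee_of_int diff_self mult_zero_left)
    qed
    then have "eta z = 0" using has_prod_eq_0_iff[OF eta_has_prod, of z] by (auto simp: image_iff)
    then show ?thesis by (simp add: theta_def)
  qed
qed

lemma eta_0_nonzero: "eta 0 \<noteq> 0"
proof
  assume "eta 0 = 0"
  then obtain k where "eta_factor k 0 = 0"
    using has_prod_eq_0_iff[OF eta_has_prod, of 0] by auto
  then have "of_nat (Suc k) * tau \<in> \<int>"
    by (simp add: eta_factor_def ee_eq_1_iff[symmetric])
  then obtain n where "of_nat (Suc k) * tau = of_int n" by (auto elim!: Ints_cases)
  then have "Im (of_nat (Suc k) * tau) = Im (of_int n)" by (rule arg_cong)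
  then show False using b_pos by simp
qed

lemma eta_uminus: "eta (- z) = eta z"
  unfolding eta_def eta_factor_def by (simp add: mult.commute)

lemma theta_uminus: "theta (- z) = - theta z"
  by (simp add: theta_def eta_uminus)

text \<open>Conjugation replaces \<open>tau\<close> by \<open>1 - tau\<close>, and the integer drops
  out of \<open>ee\<close>; the two halves of each factor are merely swapped.\<close>

lemma cnj_eta: "cnj (eta z) = eta (cnj z)"
proof -
  have *: "cnj (eta_factor k z) = eta_factor k (cnj z)" for k
  proof -
    have 1: "cnj (ee (of_nat (Suc k) * tau + z)) = ee (of_nat (Suc k) * tau - cnj z)"
    proof -
      have "cnj (ee (of_nat (Suc k) * tau + z)) = ee (of_int (- int (Suc k)) + (of_nat (Suc k) * tau - cnj z))"
        unfolding cnj_ee by (simp add: cnj_tau algebra_simps)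
      then show ?thesis by (simp only: ee_add[of "of_int _"] ee_of_int mult_1)
    qed
    have 2: "cnj (ee (of_nat (Suc k) * tau - z)) = ee (of_nat (Suc k) * tau + cnj z)"
    proof -
      have "cnj (ee (of_nat (Suc k) * tau - z)) = ee (of_int (- int (Suc k)) + (of_nat (Suc k) * tau + cnj z))"
        unfolding cnj_ee by (simp add: cnj_tau algebra_simps)
      then show ?thesis by (simp only: ee_add[of "of_int _"] ee_of_int mult_1)
    qed
    show ?thesis
      unfolding eta_factor_def complex_cnj_mult complex_cnj_diff complex_cnj_one 1 2 by (rule mult.commute)
  qed
  have "(\<lambda>N. cnj (\<Prod>k<N. eta_factor k z)) \<longlonglongrightarrow> cnj (eta z)"
    using eta_LIMSEQ by (rule tendsto_cnj)
  then have "(\<lambda>N. \<Prod>k<N. eta_factor k (cnj z)) \<longlonglongrightarrow> cnj (eta z)"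
    by (simp add: *)
  then show ?thesis using eta_LIMSEQ LIMSEQ_unique by blast
qed

lemma cnj_theta: "cnj (theta z) = theta (cnj z)"
proof -
  have "cnj (sin (of_real pi * z)) = sin (of_real pi * cnj z)"
    by (simp add: cnj_sin)
  then show ?thesis by (simp add: theta_def cnj_eta)
qed

lemma eta_plus_1: "eta (z + 1) = eta z"
proof -
  have "eta_factor k (z + 1) = eta_factor k z" for k
  proof -
    have "ee (of_nat (Suc k) * tau + (z + 1)) = ee (of_nat (Suc k) * tau + z)"
      using ee_add[of "of_nat (Suc k) * tau + z" 1] by (simp add: add.assoc)
    moreover have "ee (of_nat (Suc k) * tau - (z + 1)) = ee (of_nat (Suc k) * tau - z)"
      using ee_add[of "of_nat (Suc k) * tau - (z + 1)" 1] by (simp add: algebra_simps)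
    ultimately show ?thesis by (simp add: eta_factor_def)
  qed
  then show ?thesis by (simp add: eta_def)
qed

lemma theta_plus_1: "theta (z + 1) = - theta z"
proof -
  have "sin (of_real pi * (z + 1)) = - sin (of_real pi * z)"
    by (simp add: distrib_left sin_add)
  then show ?thesis by (simp add: theta_def eta_plus_1)
qed

text \<open>Shifting by \<open>tau\<close> moves each half of a factor by one index, so the product
  telescopes. The relation is kept multiplied out because \<open>1 - ee (tau + z)\<close> may
  vanish.\<close>

lemma eta_plus_tau: "eta (z + tau) * (1 - ee (tau + z)) = eta z * (1 - ee (- z))"
proof -
  \<comment> \<open>Finite version, exact for every \<open>N\<close>; the boundary factors that
    involve \<open>N\<close> tend to 1.\<close>
  have id: "(\<Prod>k<N. eta_factor k (z + tau)) * (1 - ee (tau + z)) * (1 - ee (of_nat N * tau - z))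
     = (\<Prod>k<N. eta_factor k z) * (1 - ee (of_nat (Suc N) * tau + z)) * (1 - ee (- z))" for N
  proof (induction N)
    case 0
    then show ?case by simp
  next
    case (Suc N)
    have f1: "eta_factor N (z + tau) = (1 - ee (of_nat (Suc (Suc N)) * tau + z)) * (1 - ee (of_nat N * tau - z))"
      unfolding eta_factor_def by (simp add: algebra_simps)
    have f2: "eta_factor N z = (1 - ee (of_nat (Suc N) * tau + z)) * (1 - ee (of_nat (Suc N) * tau - z))"
      unfolding eta_factor_def ..
    have "(\<Prod>k<Suc N. eta_factor k (z + tau)) * (1 - ee (tau + z)) * (1 - ee (of_nat (Suc N) * tau - z))
      = ((\<Prod>k<N. eta_factor k (z + tau)) * (1 - ee (tau + z)) * (1 - ee (of_nat N * tau - z)))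
         * (1 - ee (of_nat (Suc (Suc N)) * tau + z)) * (1 - ee (of_nat (Suc N) * tau - z))"
      unfolding prod.lessThan_Suc f1 by (simp only: mult_ac)
    also have "\<dots> = (\<Prod>k<Suc N. eta_factor k z) * (1 - ee (of_nat (Suc (Suc N)) * tau + z)) * (1 - ee (- z))"
      unfolding prod.lessThan_Suc f2 Suc.IH by (simp only: mult_ac)
    finally show ?case .
  qed
  have lim: "(\<lambda>N. ee (of_nat N * tau + w)) \<longlonglongrightarrow> 0" for w
  proof -
    have "(\<lambda>N. ee tau ^ N * ee w) \<longlonglongrightarrow> 0 * ee w"
      by (intro tendsto_intros LIMSEQ_power_zero norm_ee_tau)
    then show ?thesis by (simp add: ee_add ee_power)
  qed
  have "(\<lambda>N. (\<Prod>k<N. eta_factor k (z + tau)) * (1 - ee (tau + z)) * (1 - ee (of_nat N * tau - z)))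
      \<longlonglongrightarrow> eta (z + tau) * (1 - ee (tau + z)) * (1 - 0)"
    using lim[of "- z"] by (intro tendsto_intros eta_LIMSEQ) simp
  moreover have "(\<lambda>N. (\<Prod>k<N. eta_factor k z) * (1 - ee (of_nat (Suc N) * tau + z)) * (1 - ee (- z)))
      \<longlonglongrightarrow> eta z * (1 - 0) * (1 - ee (- z))"
    by (intro tendsto_intros eta_LIMSEQ) (rule filterlim_compose[OF lim filterlim_Suc])
  ultimately show ?thesis
    unfolding id using LIMSEQ_unique by fastforce
qed

lemma theta_plus_tau:
  "theta (z + tau) = - exp (- of_real pi * \<i> * tau) * ee (- z) * theta z"
proof -
  have e: "exp (- of_real pi * \<i> * (z + tau)) = exp (- of_real pi * \<i> * tau) * exp (- of_real pi * \<i> * z)"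
    by (simp add: algebra_simps flip: exp_add)
  have "theta (z + tau) = \<i> / 2 * exp (- of_real pi * \<i> * (z + tau)) * (eta (z + tau) * (1 - ee (tau + z)))"
    unfolding theta_def sin_pi_eq_ee by (simp add: ac_simps)
  also have "\<dots> = \<i> / 2 * exp (- of_real pi * \<i> * (z + tau)) * (eta z * (1 - ee (- z)))"
    by (simp only: eta_plus_tau)
  also have "1 - ee (- z) = - ee (- z) * (1 - ee z)"
    by (simp add: ee_minus field_simps)
  also have "\<i> / 2 * exp (- of_real pi * \<i> * (z + tau)) * (eta z * (- ee (- z) * (1 - ee z)))
      = - exp (- of_real pi * \<i> * tau) * ee (- z) * theta z"
    unfolding theta_def sin_pi_eq_ee e by (simp add: ac_simps)
  finally show ?thesis .
qed

text \<open>The sine has a simple zero at 0 and \<open>eta 0\<close> is nonzero. This permits the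
  normalisation by \<open>deriv theta 0\<close> in all pole computations.\<close>

lemma deriv_theta_0: "deriv theta 0 \<noteq> 0"
proof -
  have "(eta has_field_derivative deriv eta 0) (at 0)"
    using eta_holomorphic[of UNIV] by (intro holomorphic_derivI) auto
  then have "(theta has_field_derivative of_real pi * eta 0) (at 0)"
    unfolding theta_def by (auto intro!: derivative_eq_intros)
  then show ?thesis using eta_0_nonzero by (simp add: DERIV_imp_deriv)
qed

lemma theta_DERIV: "(theta has_field_derivative deriv theta z) (at z)"
  using theta_holomorphic[of UNIV] by (intro holomorphic_derivI) auto

lemma continuous_on_theta [continuous_intros]:
  "continuous_on A f \<Longrightarrow> continuous_on A (\<lambda>z. theta (f z))"
  using continuous_on_compose2[OF holomorphic_on_imp_continuous_on[OF theta_holomorphic[of UNIV]]] by auto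

lemma closed_lattice: "closed \<Lambda>"
proof -
  have "closed (theta -` {0})"
    using theta_DERIV by (intro continuous_closed_vimage) (auto intro: DERIV_isCont)
  moreover have "theta -` {0} = \<Lambda>" by (auto simp: theta_eq_0_iff)
  ultimately show ?thesis by simp
qed

lemma open_off_lattice: "open (- \<Lambda>)"
  using closed_lattice by auto

end

subsection \<open>Zeta function and elliptic functions\<close>

text \<open>A second logarithmic derivative is a rational expression in the function and its first
  two derivatives, and by Weierstrass these converge along with the partial products.\<close>

lemma sums_deriv_logderiv_prodinf:
  fixes f :: "nat \<Rightarrow> complex \<Rightarrow> complex"
  assumes lim: "uniform_limit A (\<lambda>n x. \<Prod>k<n. f k x) P sequentially"
    and holo: "\<And>k. f k holomorphic_on A"
    and nz: "\<And>k. f k z \<noteq> 0" "P z \<noteq> 0"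
    and A: "open A" "z \<in> A"
  shows "(\<lambda>k. deriv (\<lambda>w. deriv (f k) w / f k w) z) sums deriv (\<lambda>w. deriv P w / P w) z"
proof -
  define T where "T = (\<lambda>n x. \<Prod>k<n. f k x)"
  have T_holo: "T n holomorphic_on A" for n
    unfolding T_def by (intro holomorphic_intros holo)
  have P_holo: "P holomorphic_on A"
  proof (rule holomorphic_uniform_sequence[OF A(1)])
    show "T n holomorphic_on A" for n by (rule T_holo)
    show "\<exists>d>0. cball x d \<subseteq> A \<and> uniform_limit (cball x d) T P sequentially" if "x \<in> A" for x
    proof -
      obtain d where "d > 0" "cball x d \<subseteq> A"
        using A(1)[unfolded open_contains_cball, rule_format, OF \<open>x \<in> A\<close>] by auto
      then show ?thesis
        by (intro exI[of _ d] conjI uniform_limit_on_subset[OF lim[folded T_def]])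
    qed
  qed
  have quot: "deriv (\<lambda>w. deriv F w / F w) z = (deriv (deriv F) z * F z - (deriv F z)\<^sup>2) / (F z)\<^sup>2"
    if "F holomorphic_on A" "F z \<noteq> 0" for F
  proof -
    have "(F has_field_derivative deriv F z) (at z)"
      using that A by (intro holomorphic_derivI)
    moreover have "(deriv F has_field_derivative deriv (deriv F) z) (at z)"
      using that A by (intro holomorphic_derivI holomorphic_deriv)
    ultimately show ?thesis
      using that(2) by (intro DERIV_imp_deriv) (auto intro!: derivative_eq_intros simp: power2_eq_square)
  qed
  have sum: "(\<Sum>k<n. deriv (\<lambda>w. deriv (f k) w / f k w) z) = deriv (\<lambda>w. deriv (T n) w / T n w) z" for n
  proof -
    \<comment> \<open>Neighbourhood on which the first \<open>n\<close> factors stay nonzero, so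
      that the logarithmic derivative of the partial product is a finite sum there.\<close>
    define B where "B = A \<inter> (\<Inter>k\<in>{..<n}. {x \<in> A. f k x \<noteq> 0})"
    have "open {x \<in> A. f k x \<noteq> 0}" for k
      using continuous_open_preimage[OF holomorphic_on_imp_continuous_on[OF holo[of k]] A(1), of "- {0}"]
      by (auto simp: vimage_def Int_def)
    then have B: "open B" "z \<in> B" "B \<subseteq> A"
      using A nz by (auto simp: B_def)
    have "deriv (T n) w / T n w = (\<Sum>k<n. deriv (f k) w / f k w)" if w: "w \<in> B" for w
    proof -
      have nzw: "f k w \<noteq> 0" if "k < n" for k using w that by (auto simp: B_def)
      have d: "(f k has_field_derivative deriv (f k) w) (at w)" for k
        using w B(3) A by (intro holomorphic_derivI[OF holo[of k]]) auto
      have "(T n has_field_derivative T n w * (\<Sum>k<n. deriv (f k) w / f k w)) (at w)"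
        unfolding T_def by (rule has_field_derivative_prod') (use d nzw in auto)
      then have "deriv (T n) w = T n w * (\<Sum>k<n. deriv (f k) w / f k w)"
        by (rule DERIV_imp_deriv)
      moreover have "T n w \<noteq> 0" using nzw by (simp add: T_def)
      ultimately show ?thesis by simp
    qed
    then have "deriv (\<lambda>w. deriv (T n) w / T n w) z = deriv (\<lambda>w. \<Sum>k<n. deriv (f k) w / f k w) z"
      using B by (intro deriv_cong_ev eventually_nhds_in_open[THEN eventually_mono]) auto
    also have "\<dots> = (\<Sum>k<n. deriv (\<lambda>w. deriv (f k) w / f k w) z)"
    proof (rule deriv_sum)
      fix k
      have "(\<lambda>w. deriv (f k) w / f k w) holomorphic_on {x \<in> A. f k x \<noteq> 0}"
        by (intro holomorphic_intros holomorphic_on_subset[OF holo] holomorphic_on_subset[OF holomorphic_deriv[OF holo A(1)]]) auto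
      then show "(\<lambda>w. deriv (f k) w / f k w) field_differentiable at z"
        using \<open>open {x \<in> A. f k x \<noteq> 0}\<close> A nz(1)[of k]
        by (auto simp: holomorphic_on_open field_differentiable_def)
    qed
    finally show ?thesis ..
  qed
  have ev: "\<forall>\<^sub>F n in sequentially. T n holomorphic_on A"
    using T_holo by simp
  have lim': "(\<lambda>n. (deriv ^^ m) (T n) z) \<longlonglongrightarrow> (deriv ^^ m) P z" for m
    using higher_deriv_complex_uniform_limit[OF lim[folded T_def] ev sequentially_bot A] .
  have l0: "(\<lambda>n. T n z) \<longlonglongrightarrow> P z" and l1: "(\<lambda>n. deriv (T n) z) \<longlonglongrightarrow> deriv P z"
    and l2: "(\<lambda>n. deriv (deriv (T n)) z) \<longlonglongrightarrow> deriv (deriv P) z"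
    using lim'[of 0] lim'[of 1] lim'[of 2] by (simp_all add: numeral_2_eq_2)
  have "(\<lambda>n. (deriv (deriv (T n)) z * T n z - (deriv (T n) z)\<^sup>2) / (T n z)\<^sup>2)
     \<longlonglongrightarrow> (deriv (deriv P) z * P z - (deriv P z)\<^sup>2) / (P z)\<^sup>2"
    using nz by (intro tendsto_intros l0 l1 l2) auto
  moreover have "T n z \<noteq> 0" for n using nz by (simp add: T_def)
  ultimately show ?thesis
    unfolding sums_def sum by (simp add: quot T_holo P_holo nz)
qed

lemma DERIV_reflect:
  fixes f :: "'a :: real_normed_field \<Rightarrow> 'a"
  assumes "(f has_field_derivative d) (at (- z))"
  shows "((\<lambda>x. f (- x)) has_field_derivative - d) (at z)"
  using DERIV_chain2[of f d uminus z "-1" UNIV, OF assms DERIV_minus[OF DERIV_ident]] by simp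

text \<open>An even function has derivative 0 at the origin, so once it vanishes there the factor
  \<open>z\<close> can be taken out twice. For even elliptic functions this removes poles two orders
  at a time.\<close>

lemma even_holomorphic_factor:
  assumes "D holomorphic_on ball 0 r" "r > 0" "D 0 = 0" "\<And>z. z \<in> ball 0 r \<Longrightarrow> D (- z) = D z"
  obtains C where "C holomorphic_on ball 0 r" "\<And>z. z \<in> ball 0 r \<Longrightarrow> D z = z\<^sup>2 * C z"
proof -
  define B where "B = (\<lambda>z. if z = 0 then deriv D 0 else D z / z)"
  have B: "B holomorphic_on ball 0 r"
    using pole_lemma_open[OF assms(1) open_ball, of 0] assms(3) by (simp add: B_def[abs_def] cong: if_cong)
  have "(D has_field_derivative deriv D 0) (at 0)"
    using assms by (intro holomorphic_derivI) auto
  moreover have "(D has_field_derivative - deriv D 0) (at 0)"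
  proof -
    have "(D has_field_derivative deriv D 0) (at (- 0))" using calculation by simp
    then have "((\<lambda>z. D (- z)) has_field_derivative - deriv D 0) (at 0)"
      by (rule DERIV_reflect)
    then show ?thesis
      by (rule has_field_derivative_transform_within_open[where S = "ball 0 r"]) (use assms in auto)
  qed
  ultimately have "deriv D 0 = - deriv D 0" by (rule DERIV_unique)
  then have B0: "B 0 = 0" by (simp add: B_def)
  define C where "C = (\<lambda>z. if z = 0 then deriv B 0 else B z / z)"
  have "C holomorphic_on ball 0 r"
    using pole_lemma_open[OF B open_ball, of 0] B0 by (simp add: C_def[abs_def] cong: if_cong)
  moreover have "D z = z\<^sup>2 * C z" for z
    using assms(3) by (auto simp: C_def B_def power2_eq_square)
  ultimately show ?thesis using that by blast
qed

section \<open>Quasi-periodicity and parity of theta, its derivatives, zeta and wp\<close>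

context rhombic_torus
begin

lemma deriv_theta_plus_1: "deriv theta (z + 1) = - deriv theta z"
proof -
  have "((\<lambda>w. theta (w + 1)) has_field_derivative deriv theta (z + 1)) (at z)"
    using theta_DERIV[of "z + 1"] by (simp add: DERIV_shift)
  then have "((\<lambda>w. - theta w) has_field_derivative deriv theta (z + 1)) (at z)"
    by (simp add: theta_plus_1)
  moreover have "((\<lambda>w. - theta w) has_field_derivative - deriv theta z) (at z)"
    by (intro derivative_intros theta_DERIV)
  ultimately show ?thesis by (rule DERIV_unique)
qed

lemma deriv_theta_holomorphic [holomorphic_intros]: "deriv theta holomorphic_on A"
  using holomorphic_deriv[OF theta_holomorphic[of UNIV] open_UNIV] holomorphic_on_subset by blast

lemma deriv2_theta_holomorphic [holomorphic_intros]: "deriv (deriv theta) holomorphic_on A"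
  using holomorphic_deriv[OF deriv_theta_holomorphic[of UNIV] open_UNIV] holomorphic_on_subset by blast

lemma deriv_theta_DERIV: "(deriv theta has_field_derivative deriv (deriv theta) z) (at z)"
  using deriv_theta_holomorphic[of UNIV] by (intro holomorphic_derivI) auto

lemma deriv2_theta_plus_1: "deriv (deriv theta) (z + 1) = - deriv (deriv theta) z"
proof -
  have "((\<lambda>w. deriv theta (w + 1)) has_field_derivative deriv (deriv theta) (z + 1)) (at z)"
    using deriv_theta_DERIV[of "z + 1"] by (simp add: DERIV_shift)
  then have "((\<lambda>w. - deriv theta w) has_field_derivative deriv (deriv theta) (z + 1)) (at z)"
    by (simp add: deriv_theta_plus_1)
  moreover have "((\<lambda>w. - deriv theta w) has_field_derivative - deriv (deriv theta) z) (at z)"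
    by (intro derivative_intros deriv_theta_DERIV)
  ultimately show ?thesis by (rule DERIV_unique)
qed

text \<open>The factor of automorphy of \<open>theta\<close> under translation by
  \<open>tau\<close>.\<close>

definition tau_mult :: "complex \<Rightarrow> complex" where
  "tau_mult z = - exp (- of_real pi * \<i> * tau) * ee (- z)"

lemma tau_mult_nonzero: "tau_mult z \<noteq> 0"
  by (simp add: tau_mult_def)

text \<open>\<open>tau_mult\<close> is the exponential of an affine function, so opposite shifts
  cancel. This is what makes quotients built from \<open>theta (z + w) * theta (z - w)\<close>
  elliptic.\<close>

lemma tau_mult_split: "tau_mult (z + w) * tau_mult (z - w) = (tau_mult z)\<^sup>2"
proof -
  have "ee (- (z + w)) * ee (- (z - w)) = (ee (- z))\<^sup>2"
    unfolding ee_add[symmetric] power2_eq_square by simp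
  then show ?thesis by (simp add: tau_mult_def power2_eq_square mult_ac)
qed

lemma tau_mult_DERIV:
  "(tau_mult has_field_derivative - (2 * of_real pi * \<i>) * tau_mult z) (at z)"
  unfolding tau_mult_def[abs_def] ee_def by (auto intro!: derivative_eq_intros)

lemma theta_plus_tau': "theta (z + tau) = tau_mult z * theta z"
  by (simp add: theta_plus_tau tau_mult_def)

lemma deriv_theta_plus_tau:
  "deriv theta (z + tau) = tau_mult z * (deriv theta z - 2 * of_real pi * \<i> * theta z)"
proof -
  have "((\<lambda>w. theta (w + tau)) has_field_derivative deriv theta (z + tau)) (at z)"
    using theta_DERIV[of "z + tau"] by (simp add: DERIV_shift)
  then have "((\<lambda>w. tau_mult w * theta w) has_field_derivative deriv theta (z + tau)) (at z)"
    by (simp add: theta_plus_tau')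
  moreover have "((\<lambda>w. tau_mult w * theta w) has_field_derivative
      tau_mult z * (deriv theta z - 2 * of_real pi * \<i> * theta z)) (at z)"
    by (rule derivative_eq_intros theta_DERIV tau_mult_DERIV refl)+ (simp add: algebra_simps)
  ultimately show ?thesis by (rule DERIV_unique)
qed

lemma deriv2_theta_plus_tau:
  "deriv (deriv theta) (z + tau) = tau_mult z * (deriv (deriv theta) z
     - 2 * (2 * of_real pi * \<i>) * deriv theta z + (2 * of_real pi * \<i>)\<^sup>2 * theta z)"
proof -
  have "((\<lambda>w. deriv theta (w + tau)) has_field_derivative deriv (deriv theta) (z + tau)) (at z)"
    using deriv_theta_DERIV[of "z + tau"] by (simp add: DERIV_shift)
  then have "((\<lambda>w. tau_mult w * (deriv theta w - 2 * of_real pi * \<i> * theta w))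
      has_field_derivative deriv (deriv theta) (z + tau)) (at z)"
    by (simp add: deriv_theta_plus_tau)
  moreover have "((\<lambda>w. tau_mult w * (deriv theta w - 2 * of_real pi * \<i> * theta w)) has_field_derivative
      tau_mult z * (deriv (deriv theta) z
     - 2 * (2 * of_real pi * \<i>) * deriv theta z + (2 * of_real pi * \<i>)\<^sup>2 * theta z)) (at z)"
    by (rule derivative_eq_intros theta_DERIV deriv_theta_DERIV tau_mult_DERIV refl)+
       (simp add: algebra_simps power2_eq_square)
  ultimately show ?thesis by (rule DERIV_unique)
qed

lemma deriv_theta_uminus: "deriv theta (- z) = deriv theta z"
proof -
  have "((\<lambda>w. theta (- w)) has_field_derivative - deriv theta (- z)) (at z)"
    using theta_DERIV[of "- z"] by (rule DERIV_reflect)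
  then have "((\<lambda>w. - theta w) has_field_derivative - deriv theta (- z)) (at z)"
    by (simp add: theta_uminus)
  moreover have "((\<lambda>w. - theta w) has_field_derivative - deriv theta z) (at z)"
    by (intro derivative_intros theta_DERIV)
  ultimately show ?thesis using DERIV_unique by fastforce
qed

lemma deriv2_theta_uminus: "deriv (deriv theta) (- z) = - deriv (deriv theta) z"
proof -
  have "((\<lambda>w. deriv theta (- w)) has_field_derivative - deriv (deriv theta) (- z)) (at z)"
    using deriv_theta_DERIV[of "- z"] by (rule DERIV_reflect)
  then have "(deriv theta has_field_derivative - deriv (deriv theta) (- z)) (at z)"
    by (simp add: deriv_theta_uminus)
  then show ?thesis using DERIV_unique deriv_theta_DERIV by (metis minus_minus)
qed

lemma cnj_deriv_theta: "cnj (deriv theta z) = deriv theta (cnj z)"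
proof -
  have "(cnj \<circ> theta \<circ> cnj has_field_derivative cnj (deriv theta z)) (at (cnj z))"
    using has_field_derivative_cnj_cnj[of theta "deriv theta z" "cnj z"] theta_DERIV[of z] by simp
  moreover have "cnj \<circ> theta \<circ> cnj = theta"
    by (auto simp: cnj_theta)
  ultimately show ?thesis using theta_DERIV DERIV_unique by metis
qed

lemma cnj_deriv2_theta: "cnj (deriv (deriv theta) z) = deriv (deriv theta) (cnj z)"
proof -
  have "(cnj \<circ> deriv theta \<circ> cnj has_field_derivative cnj (deriv (deriv theta) z)) (at (cnj z))"
    using has_field_derivative_cnj_cnj[of "deriv theta" "deriv (deriv theta) z" "cnj z"] deriv_theta_DERIV[of z] by simp
  moreover have "cnj \<circ> deriv theta \<circ> cnj = deriv theta"
    by (auto simp: cnj_deriv_theta)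
  ultimately show ?thesis using deriv_theta_DERIV DERIV_unique by metis
qed

text \<open>Up to linear and constant terms these are the Weierstrass functions:
  \<open>zeta\<close> is \<open>\<zeta>(z) - \<eta>\<^sub>1 z\<close> and \<open>wp\<close> is \<open>\<wp> + \<eta>\<^sub>1\<close>.\<close>

definition zeta :: "complex \<Rightarrow> complex" where
  "zeta z = deriv theta z / theta z"

definition wp_num :: "complex \<Rightarrow> complex" where
  "wp_num z = (deriv theta z)\<^sup>2 - deriv (deriv theta) z * theta z"

definition wp :: "complex \<Rightarrow> complex" where
  "wp z = wp_num z / (theta z)\<^sup>2"

lemma zeta_DERIV: "z \<notin> \<Lambda> \<Longrightarrow> (zeta has_field_derivative - wp z) (at z)"
  unfolding zeta_def[abs_def] wp_def wp_num_def
  by (rule derivative_eq_intros theta_DERIV deriv_theta_DERIV refl | simp add: theta_eq_0_iff)+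
     (simp add: power2_eq_square field_simps theta_eq_0_iff)

lemma zeta_holomorphic: "zeta holomorphic_on - \<Lambda>"
  unfolding zeta_def[abs_def] by (intro holomorphic_intros) (auto simp: theta_eq_0_iff)

lemma wp_num_holomorphic [holomorphic_intros]: "wp_num holomorphic_on A"
  unfolding wp_num_def[abs_def] by (intro holomorphic_intros)

lemma wp_holomorphic: "wp holomorphic_on - \<Lambda>"
  unfolding wp_def[abs_def] by (intro holomorphic_intros) (auto simp: theta_eq_0_iff)

lemma zeta_plus_1: "zeta (z + 1) = zeta z"
  by (simp add: zeta_def deriv_theta_plus_1 theta_plus_1)

lemma zeta_plus_tau: "z \<notin> \<Lambda> \<Longrightarrow> zeta (z + tau) = zeta z - 2 * of_real pi * \<i>"
  using tau_mult_nonzero[of z]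
  by (simp add: zeta_def deriv_theta_plus_tau theta_plus_tau' field_simps theta_eq_0_iff)

lemma zeta_uminus: "zeta (- z) = - zeta z"
  by (simp add: zeta_def deriv_theta_uminus theta_uminus)

lemma cnj_zeta: "cnj (zeta z) = zeta (cnj z)"
  by (simp add: zeta_def cnj_theta cnj_deriv_theta)

lemma wp_num_plus_1: "wp_num (z + 1) = wp_num z"
  by (simp add: wp_num_def deriv_theta_plus_1 deriv2_theta_plus_1 theta_plus_1)

lemma wp_num_plus_tau: "wp_num (z + tau) = (tau_mult z)\<^sup>2 * wp_num z"
  unfolding wp_num_def deriv_theta_plus_tau deriv2_theta_plus_tau theta_plus_tau'
  by (simp add: power2_eq_square algebra_simps)

lemma wp_num_uminus: "wp_num (- z) = wp_num z"
  by (simp add: wp_num_def deriv_theta_uminus deriv2_theta_uminus theta_uminus)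

lemma wp_plus_1: "wp (z + 1) = wp z"
  by (simp add: wp_def wp_num_plus_1 theta_plus_1)

text \<open>At lattice points both sides are 0 by the convention for division, so \<open>wp\<close>
  has its periods everywhere, in contrast to \<open>zeta\<close>, whose additive jump would be
  violated there.\<close>

lemma wp_plus_tau: "wp (z + tau) = wp z"
  using tau_mult_nonzero[of z] by (simp add: wp_def wp_num_plus_tau theta_plus_tau' field_simps)

lemma wp_uminus: "wp (- z) = wp z"
  by (simp add: wp_def wp_num_uminus theta_uminus)

lemma cnj_wp: "cnj (wp z) = wp (cnj z)"
  by (simp add: wp_def wp_num_def cnj_theta cnj_deriv_theta cnj_deriv2_theta)

lemma period_int:
  fixes f :: "complex \<Rightarrow> 'a"
  assumes "\<And>z. f (z + c) = f z"
  shows "f (z + of_int n * c) = f z"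
proof (induction n rule: int_induct[where k = 0])
  case base
  then show ?case by simp
next
  case (step1 i)
  then show ?case using assms[of "z + of_int i * c"] by (simp add: algebra_simps)
next
  case (step2 i)
  have "f (z + of_int (i - 1) * c + c) = f (z + of_int (i - 1) * c)" by (rule assms)
  then show ?case using step2 by (simp add: algebra_simps)
qed

lemma period_lattice:
  fixes f :: "complex \<Rightarrow> 'a"
  assumes "\<And>z. f (z + 1) = f z" "\<And>z. f (z + tau) = f z" "w \<in> \<Lambda>"
  shows "f (z + w) = f z"
proof -
  obtain m n where w: "w = of_int m + of_int n * tau" using assms(3) by (auto simp: lattice_iff)
  have "f (z + w) = f ((z + of_int m * 1) + of_int n * tau)" by (simp add: w add.assoc)
  also have "\<dots> = f (z + of_int m * 1)" by (rule period_int) (rule assms)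
  also have "\<dots> = f z" by (rule period_int) (rule assms)
  finally show ?thesis .
qed

lemma wp_lattice: "w \<in> \<Lambda> \<Longrightarrow> wp (z + w) = wp z"
  using period_lattice[of wp] wp_plus_1 wp_plus_tau by blast

section \<open>Behaviour at the pole and Liouville arguments\<close>

definition rad :: real where "rad = min (1 / 2) b"

lemma rad_pos: "rad > 0" using b_pos by (simp add: rad_def)

lemma ball_rad_lattice: "z \<in> ball 0 rad \<Longrightarrow> z \<in> \<Lambda> \<longleftrightarrow> z = 0"
proof
  assume z: "z \<in> ball 0 rad" "z \<in> \<Lambda>"
  then obtain m n :: int where mn: "Re z = of_int m + of_int n / 2" "Im z = of_int n * b"
    unfolding lattice_coords by blast
  have "\<bar>Im z\<bar> < b" "\<bar>Re z\<bar> < 1 / 2"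
    using z abs_Im_le_cmod[of z] abs_Re_le_cmod[of z] by (auto simp: rad_def)
  then have "\<bar>real_of_int n\<bar> * b < 1 * b" using mn b_pos by (simp add: abs_mult)
  then have "n = 0" using b_pos by (subst (asm) mult_less_cancel_right_pos) auto
  moreover have "m = 0" using mn \<open>\<bar>Re z\<bar> < 1/2\<close> \<open>n = 0\<close> by simp
  ultimately show "z = 0" using mn by (simp add: complex_eq_iff)
qed auto

definition theta_quot :: "complex \<Rightarrow> complex" where
  "theta_quot z = (if z = 0 then deriv theta 0 else theta z / z)"

lemma theta_0 [simp]: "theta 0 = 0" by (simp add: theta_eq_0_iff)

lemma theta_eq_quot: "theta z = z * theta_quot z"
  by (auto simp: theta_quot_def)

lemma theta_quot_holomorphic [holomorphic_intros]: "theta_quot holomorphic_on A"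
proof -
  have "theta_quot holomorphic_on UNIV"
    using pole_lemma_open[OF theta_holomorphic open_UNIV, of 0] by (simp add: theta_quot_def[abs_def] cong: if_cong)
  then show ?thesis by (rule holomorphic_on_subset) auto
qed

lemma theta_quot_eq_0_iff: "theta_quot z = 0 \<longleftrightarrow> z \<in> \<Lambda> - {0}"
  using deriv_theta_0 by (auto simp: theta_quot_def theta_eq_0_iff)

lemma theta_quot_nonzero: "z \<in> ball 0 rad \<Longrightarrow> theta_quot z \<noteq> 0"
  using ball_rad_lattice by (auto simp: theta_quot_eq_0_iff)

lemma theta_quot_0: "theta_quot 0 = deriv theta 0"
  by (simp add: theta_quot_def)

lemma wp_num_0: "wp_num 0 = (deriv theta 0)\<^sup>2"
  by (simp add: wp_num_def)

text \<open>The function \<open>z\<^sup>2 * wp z\<close> with its singularity at 0 removed; its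
  value 1 there is the normalisation of the double pole.\<close>

definition wp_reg :: "complex \<Rightarrow> complex" where
  "wp_reg z = wp_num z / (theta_quot z)\<^sup>2"

lemma wp_reg_holomorphic: "wp_reg holomorphic_on ball 0 rad"
  unfolding wp_reg_def[abs_def] by (intro holomorphic_intros) (use theta_quot_nonzero in auto)

lemma wp_reg_0: "wp_reg 0 = 1"
  using deriv_theta_0 by (simp add: wp_reg_def wp_num_0 theta_quot_0)

lemma wp_eq_reg: "wp z = wp_reg z / z\<^sup>2"
  by (simp add: wp_def wp_reg_def theta_eq_quot power_mult_distrib)

definition even_elliptic :: "(complex \<Rightarrow> complex) \<Rightarrow> bool" where
  "even_elliptic f \<longleftrightarrow> f holomorphic_on - \<Lambda> \<and>
     (\<forall>z. f (z + 1) = f z) \<and> (\<forall>z. f (z + tau) = f z) \<and> (\<forall>z. f (- z) = f z)"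

lemma central_representative:
  obtains w s t where "w \<in> \<Lambda>" "z - w = of_real s + of_real t * tau" "\<bar>s\<bar> \<le> 1 / 2" "\<bar>t\<bar> \<le> 1 / 2"
proof -
  define t0 where "t0 = Im z / b"
  define s0 where "s0 = Re z - t0 / 2"
  have z: "z = of_real s0 + of_real t0 * tau"
    using b_pos by (simp add: complex_eq_iff s0_def t0_def)
  define w where "w = of_int (round s0) + of_int (round t0) * tau"
  have "w \<in> \<Lambda>" unfolding lattice_iff w_def by blast
  moreover have "z - w = of_real (s0 - of_int (round s0)) + of_real (t0 - of_int (round t0)) * tau"
    by (simp add: z w_def algebra_simps)
  moreover have "\<bar>s0 - of_int (round s0)\<bar> \<le> 1 / 2" "\<bar>t0 - of_int (round t0)\<bar> \<le> 1 / 2"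
    using of_int_round_abs_le[of s0] of_int_round_abs_le[of t0] by (simp_all add: abs_minus_commute)
  ultimately show ?thesis using that by blast
qed

text \<open>Liouville's theorem: with the singularity filled in at every lattice point, the function
  is entire and takes all its values on one compact parallelogram.\<close>

lemma elliptic_regular_constant:
  assumes f: "f holomorphic_on - \<Lambda>" "\<And>z. f (z + 1) = f z" "\<And>z. f (z + tau) = f z"
    and g: "g holomorphic_on ball 0 r" "r > 0" "\<And>z. z \<in> ball 0 r - {0} \<Longrightarrow> f z = g z"
  shows "\<exists>c. \<forall>z. z \<notin> \<Lambda> \<longrightarrow> f z = c"
proof -
  define F where "F = (\<lambda>z. if z \<in> \<Lambda> then g 0 else f z)"
  define \<rho> where "\<rho> = min r rad"
  have \<rho>: "\<rho> > 0" using g rad_pos by (simp add: \<rho>_def)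
  have Fg: "F z = g z" if "z \<in> ball 0 \<rho>" for z
    using that g(3)[of z] ball_rad_lattice[of z] by (auto simp: F_def \<rho>_def)
  have F_per: "F (z + w) = F z" if "w \<in> \<Lambda>" for z w
    using that period_lattice[of f, OF f(2,3) that] lattice_shift[OF that, of z] by (simp add: F_def)
  have "F field_differentiable at z" for z
  proof (cases "z \<in> \<Lambda>")
    case False
    have "f field_differentiable at z"
      using f(1) open_off_lattice False by (auto simp: holomorphic_on_open field_differentiable_def)
    then show ?thesis
      unfolding field_differentiable_def
      using has_field_derivative_transform_within_open[of f _ z "- \<Lambda>" F] open_off_lattice False
      by (auto simp: F_def)
  next
    case True
    have "g field_differentiable at 0"
      using g by (auto simp: holomorphic_on_open field_differentiable_def)
    then obtain d where "(g has_field_derivative d) (at 0)"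
      by (auto simp: field_differentiable_def)
    then have "(F has_field_derivative d) (at 0)"
      by (rule has_field_derivative_transform_within_open[of _ _ _ "ball 0 \<rho>"]) (use \<rho> Fg in auto)
    then have "((\<lambda>x. F (x + - z)) has_field_derivative d) (at z)"
      using DERIV_shift[of F d z "- z"] by simp
    moreover have "(\<lambda>x. F (x + - z)) = F"
      using F_per[of "- z"] True by (auto simp: lattice_minus)
    ultimately show ?thesis by (auto simp: field_differentiable_def)
  qed
  then have holo: "F holomorphic_on UNIV"
    by (simp add: holomorphic_on_def)
  define K where "K = (\<lambda>(s, t). of_real s + of_real t * tau) ` ({-1/2..1/2::real} \<times> {-1/2..1/2::real})"
  have "compact K"
    unfolding K_def by (intro compact_continuous_image compact_Times compact_Icc)
      (auto intro!: continuous_intros simp: case_prod_beta)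
  then have "bounded (F ` K)"
    using holo by (intro compact_imp_bounded compact_continuous_image holomorphic_on_imp_continuous_on)
      (auto intro: holomorphic_on_subset)
  moreover have "range F \<subseteq> F ` K"
  proof safe
    fix z
    obtain w s t where w: "w \<in> \<Lambda>" "z - w = of_real s + of_real t * tau" "\<bar>s\<bar> \<le> 1 / 2" "\<bar>t\<bar> \<le> 1 / 2"
      by (rule central_representative)
    have "z - w \<in> K"
      unfolding K_def image_iff using w by (intro bexI[of _ "(s, t)"]) auto
    moreover have "F (z - w) = F z" using F_per[OF w(1), of "z - w"] by simp
    ultimately show "F z \<in> F ` K" by (metis imageI)
  qed
  ultimately have "bounded (range F)" by (rule bounded_subset)
  then have "F constant_on UNIV" using Liouville_theorem holo by blast
  then obtain c where "\<And>z. F z = c" by (auto simp: constant_on_def)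
  then show ?thesis by (metis F_def)
qed

text \<open>Subtracting \<open>A 0 * wp z\<close> cancels the double pole, and evenness excludes a
  remaining simple one.\<close>

lemma even_elliptic_pole2:
  assumes f: "even_elliptic f" and A: "A holomorphic_on ball 0 rad"
    and fA: "\<And>z. z \<in> ball 0 rad - {0} \<Longrightarrow> f z = A z / z\<^sup>2"
  shows "\<exists>m. \<forall>z. z \<notin> \<Lambda> \<longrightarrow> f z = A 0 * wp z + m"
proof -
  define D where "D = (\<lambda>z. A z - A 0 * wp_reg z)"
  have D: "D holomorphic_on ball 0 rad"
    unfolding D_def by (intro holomorphic_intros A wp_reg_holomorphic)
  have Df: "D z / z\<^sup>2 = f z - A 0 * wp z" if "z \<in> ball 0 rad - {0}" for z
    using that by (simp add: D_def fA wp_eq_reg diff_divide_distrib)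
  have even: "D (- z) = D z" if "z \<in> ball 0 rad" for z
  proof (cases "z = 0")
    case False
    have "D (- z) / z\<^sup>2 = D z / z\<^sup>2"
      using Df[of z] Df[of "- z"] that False f by (simp add: wp_uminus even_elliptic_def)
    then show ?thesis using False by simp
  qed auto
  obtain C where C: "C holomorphic_on ball 0 rad" "\<And>z. z \<in> ball 0 rad \<Longrightarrow> D z = z\<^sup>2 * C z"
    using even_holomorphic_factor[OF D rad_pos _ even] by (auto simp: D_def wp_reg_0)
  have "\<exists>c. \<forall>z. z \<notin> \<Lambda> \<longrightarrow> f z - A 0 * wp z = c"
  proof (rule elliptic_regular_constant)
    show "f z - A 0 * wp z = C z" if "z \<in> ball 0 rad - {0}" for z
      using that Df[of z] C(2)[of z] by simp
    show "(\<lambda>z. f z - A 0 * wp z) holomorphic_on - \<Lambda>"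
      using f wp_holomorphic by (intro holomorphic_intros) (auto simp: even_elliptic_def)
  qed (use f C rad_pos in \<open>auto simp: even_elliptic_def wp_plus_1 wp_plus_tau\<close>)
  then obtain c where "\<forall>z. z \<notin> \<Lambda> \<longrightarrow> f z - A 0 * wp z = c" by blast
  then show ?thesis by (intro exI[of _ c]) (auto simp: algebra_simps)
qed

text \<open>The same reduction two orders higher: after \<open>A 0 * (wp z)\<^sup>2\<close> is
  removed, evenness leaves at most a double pole.\<close>

lemma even_elliptic_pole4:
  assumes f: "even_elliptic f" and A: "A holomorphic_on ball 0 rad"
    and fA: "\<And>z. z \<in> ball 0 rad - {0} \<Longrightarrow> f z = A z / z ^ 4"
  shows "\<exists>k m. \<forall>z. z \<notin> \<Lambda> \<longrightarrow> f z = A 0 * (wp z)\<^sup>2 + k * wp z + m"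
proof -
  define D where "D = (\<lambda>z. A z - A 0 * (wp_reg z)\<^sup>2)"
  define g where "g = (\<lambda>z. f z - A 0 * (wp z)\<^sup>2)"
  have D: "D holomorphic_on ball 0 rad"
    unfolding D_def by (intro holomorphic_intros A wp_reg_holomorphic)
  have Df: "D z / z ^ 4 = g z" if "z \<in> ball 0 rad - {0}" for z
    using that by (simp add: D_def g_def fA wp_eq_reg diff_divide_distrib power_divide)
  have g: "even_elliptic g"
    using f wp_holomorphic unfolding even_elliptic_def g_def
    by (auto simp: wp_plus_1 wp_plus_tau wp_uminus intro!: holomorphic_intros)
  have even: "D (- z) = D z" if "z \<in> ball 0 rad" for z
  proof (cases "z = 0")
    case False
    have "D (- z) / z ^ 4 = D z / z ^ 4"
      using Df[of z] Df[of "- z"] that False g by (simp add: even_elliptic_def)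
    then show ?thesis using False by simp
  qed auto
  obtain C where C: "C holomorphic_on ball 0 rad" "\<And>z. z \<in> ball 0 rad \<Longrightarrow> D z = z\<^sup>2 * C z"
    using even_holomorphic_factor[OF D rad_pos _ even] by (auto simp: D_def wp_reg_0)
  have "g z = C z / z\<^sup>2" if "z \<in> ball 0 rad - {0}" for z
    using that Df[of z] C(2)[of z] by (simp add: power2_eq_square power4_eq_xxxx)
  then obtain m where m: "\<And>z. z \<notin> \<Lambda> \<Longrightarrow> g z = C 0 * wp z + m"
    using even_elliptic_pole2[OF g C(1)] by blast
  have "f z = A 0 * (wp z)\<^sup>2 + C 0 * wp z + m" if "z \<notin> \<Lambda>" for z
  proof -
    have "f z = g z + A 0 * (wp z)\<^sup>2" by (simp add: g_def)
    also have "\<dots> = A 0 * (wp z)\<^sup>2 + C 0 * wp z + m" by (simp only: m[OF that]) (simp add: ac_simps)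
    finally show ?thesis .
  qed
  then show ?thesis by blast
qed

section \<open>Sigma-quotient and addition identities\<close>

definition wp_scale :: "complex \<Rightarrow> complex" where
  "wp_scale w = - (theta w)\<^sup>2 / (deriv theta 0)\<^sup>2"

text \<open>Theta form of the classical sigma quotient for \<open>\<wp>(z) - \<wp>(w)\<close>. The
  left side is even elliptic in \<open>z\<close> with a double pole, hence affine in
  \<open>wp z\<close>; its zero at \<open>z = w\<close> fixes the constant.\<close>

lemma wp_diff:
  assumes "w \<notin> \<Lambda>" "z \<notin> \<Lambda>"
  shows "theta (z + w) * theta (z - w) / (theta z)\<^sup>2 = wp_scale w * (wp z - wp w)"
proof -
  define f where "f = (\<lambda>z. theta (z + w) * theta (z - w) / (theta z)\<^sup>2)"
  define A where "A = (\<lambda>z. theta (z + w) * theta (z - w) / (theta_quot z)\<^sup>2)"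
  have hol: "(\<lambda>z. theta (z + w)) holomorphic_on S" "(\<lambda>z. theta (z - w)) holomorphic_on S" for S
    by (rule holomorphic_on_compose_gen[OF _ theta_holomorphic[of UNIV], unfolded o_def];
        auto intro!: holomorphic_intros)+
  have ell: "even_elliptic f"
    unfolding even_elliptic_def
  proof (intro conjI allI)
    show "f holomorphic_on - \<Lambda>" unfolding f_def
      by (intro holomorphic_intros hol) (auto simp: theta_eq_0_iff)
    show "f (z + 1) = f z" for z
      using theta_plus_1[of "z + w"] theta_plus_1[of "z - w"] theta_plus_1[of z]
      by (simp add: f_def algebra_simps)
    show "f (z + tau) = f z" for z
    proof -
      have "theta (z + tau + w) * theta (z + tau - w) = (tau_mult z)\<^sup>2 * (theta (z + w) * theta (z - w))"
        using theta_plus_tau'[of "z + w"] theta_plus_tau'[of "z - w"] tau_mult_split[of z w]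
        by (simp add: algebra_simps)
      then show ?thesis
        using tau_mult_nonzero[of z] by (simp add: f_def theta_plus_tau' power_mult_distrib)
    qed
    show "f (- z) = f z" for z
      using theta_uminus[of "z + w"] theta_uminus[of "z - w"] by (simp add: f_def theta_uminus)
  qed
  have A: "A holomorphic_on ball 0 rad"
    unfolding A_def by (intro holomorphic_intros hol) (use theta_quot_nonzero in auto)
  have "f z = A z / z\<^sup>2" for z
    by (simp add: f_def A_def theta_eq_quot[of z] power_mult_distrib)
  then obtain m where m: "\<And>z. z \<notin> \<Lambda> \<Longrightarrow> f z = A 0 * wp z + m"
    using even_elliptic_pole2[OF ell A] by blast
  have A0: "A 0 = wp_scale w"
    by (simp add: A_def wp_scale_def theta_uminus theta_quot_0 power2_eq_square)
  have "f w = 0" by (simp add: f_def)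
  then have "m = - wp_scale w * wp w" using m[OF assms(1)] A0 by (simp add: algebra_simps eq_neg_iff_add_eq_0)
  then show ?thesis
    using m[OF assms(2)] by (simp add: A0 f_def algebra_simps)
qed

lemma wp_scale_nonzero: "w \<notin> \<Lambda> \<Longrightarrow> wp_scale w \<noteq> 0"
  using deriv_theta_0 by (simp add: wp_scale_def theta_eq_0_iff)

text \<open>Reads off the zeros of the theta quotient. That \<open>wp\<close> takes each value only
  at \<open>z\<close> and \<open>- z\<close> is the source of monotonicity on both axes.\<close>

lemma wp_eq_iff:
  assumes "w \<notin> \<Lambda>" "z \<notin> \<Lambda>"
  shows "wp z = wp w \<longleftrightarrow> z + w \<in> \<Lambda> \<or> z - w \<in> \<Lambda>"
proof -
  have "wp z = wp w \<longleftrightarrow> theta (z + w) * theta (z - w) / (theta z)\<^sup>2 = 0"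
    unfolding wp_diff[OF assms] using wp_scale_nonzero[OF assms(1)] by simp
  also have "\<dots> \<longleftrightarrow> z + w \<in> \<Lambda> \<or> z - w \<in> \<Lambda>"
    using assms by (simp add: theta_eq_0_iff)
  finally show ?thesis .
qed

text \<open>Multiplication by \<open>(wp z - wp p)\<^sup>2\<close> clears the double poles at
  \<open>p\<close> and \<open>- p\<close> and leaves an even elliptic function with poles of order
  at most four on the lattice. Only the constant coefficient is made explicit, since its sign
  decides convexity.\<close>

lemma wp_sum_quadratic:
  assumes p: "p \<notin> \<Lambda>"
  obtains \<alpha> \<beta> where "\<And>z. z \<notin> \<Lambda> \<Longrightarrow> z + p \<notin> \<Lambda> \<Longrightarrow> z - p \<notin> \<Lambda> \<Longrightarrow>
    (wp_scale p)\<^sup>2 * (wp z - wp p)\<^sup>2 * (wp (z + p) + wp (z - p)) =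
    \<alpha> * (wp z - wp p)\<^sup>2 + \<beta> * (wp z - wp p) + (theta (2 * p))\<^sup>2 * (deriv theta 0)\<^sup>2 / theta p ^ 4"
proof -
  \<comment> \<open>Numerator that results from inserting \<open>wp_diff\<close> and the definition
    of \<open>wp\<close>; the denominators \<open>theta (z + p)\<close> and
    \<open>theta (z - p)\<close> have cancelled.\<close>
  define h where "h = (\<lambda>z. (theta (z - p))\<^sup>2 * wp_num (z + p) + (theta (z + p))\<^sup>2 * wp_num (z - p))"
  define f where "f = (\<lambda>z. h z / theta z ^ 4)"
  define A where "A = (\<lambda>z. h z / theta_quot z ^ 4)"
  have hol: "(\<lambda>z. theta (z + p)) holomorphic_on S" "(\<lambda>z. theta (z - p)) holomorphic_on S"
    "(\<lambda>z. wp_num (z + p)) holomorphic_on S" "(\<lambda>z. wp_num (z - p)) holomorphic_on S" for S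
    by (rule holomorphic_on_compose_gen[OF _ theta_holomorphic[of UNIV], unfolded o_def]
             holomorphic_on_compose_gen[OF _ wp_num_holomorphic[of UNIV], unfolded o_def];
        auto intro!: holomorphic_intros)+
  have h_hol: "h holomorphic_on S" for S
    unfolding h_def by (intro holomorphic_intros hol)
  have ell: "even_elliptic f"
    unfolding even_elliptic_def
  proof (intro conjI allI)
    show "f holomorphic_on - \<Lambda>" unfolding f_def
      by (intro holomorphic_intros h_hol) (auto simp: theta_eq_0_iff)
    show "f (z + 1) = f z" for z
      using theta_plus_1[of "z + p"] theta_plus_1[of "z - p"] theta_plus_1[of z]
        wp_num_plus_1[of "z + p"] wp_num_plus_1[of "z - p"]
      by (simp add: f_def h_def algebra_simps)
    show "f (z + tau) = f z" for z
    proof -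
      have e: "z + tau + p = (z + p) + tau" "z + tau - p = (z - p) + tau" by simp_all
      have "h (z + tau) = (tau_mult (z + p) * tau_mult (z - p))\<^sup>2 * h z"
        unfolding h_def e theta_plus_tau' wp_num_plus_tau
        by (simp add: power2_eq_square algebra_simps)
      also have "\<dots> = tau_mult z ^ 4 * h z"
        unfolding tau_mult_split by (simp add: power2_eq_square power4_eq_xxxx)
      finally show ?thesis
        using tau_mult_nonzero[of z] by (simp add: f_def theta_plus_tau' power_mult_distrib)
    qed
    show "f (- z) = f z" for z
    proof -
      have e: "- z + p = - (z - p)" "- z - p = - (z + p)" by simp_all
      have "h (- z) = h z"
        unfolding h_def e theta_uminus wp_num_uminus by simp
      then show ?thesis by (simp add: f_def theta_uminus)
    qed
  qed
  have A: "A holomorphic_on ball 0 rad"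
    unfolding A_def by (intro holomorphic_intros h_hol) (use theta_quot_nonzero in auto)
  have "f z = A z / z ^ 4" for z
    by (simp add: f_def A_def theta_eq_quot[of z] power_mult_distrib)
  then obtain k m where km: "\<And>z. z \<notin> \<Lambda> \<Longrightarrow> f z = A 0 * (wp z)\<^sup>2 + k * wp z + m"
    using even_elliptic_pole4[OF ell A] by blast
  define \<alpha> where "\<alpha> = A 0"
  define \<beta> where "\<beta> = 2 * A 0 * wp p + k"
  \<comment> \<open>At \<open>z = p\<close> the first summand of \<open>h\<close> vanishes, and the
    second contains \<open>wp_num 0 = (deriv theta 0)\<^sup>2\<close>.\<close>
  have fp: "f p = (theta (2 * p))\<^sup>2 * (deriv theta 0)\<^sup>2 / theta p ^ 4"
    unfolding f_def h_def by (simp add: wp_num_0)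
  have f_eq: "f z = \<alpha> * (wp z - wp p)\<^sup>2 + \<beta> * (wp z - wp p) + f p" if "z \<notin> \<Lambda>" for z
    unfolding km[OF that] km[OF p] \<alpha>_def \<beta>_def by (simp add: power2_eq_square algebra_simps)
  have alg: "(a * c / t)\<^sup>2 * (N / a\<^sup>2 + M / c\<^sup>2) = (c\<^sup>2 * N + a\<^sup>2 * M) / t\<^sup>2"
    if "a \<noteq> 0" "c \<noteq> 0" for a c t N M :: complex
    using that by (simp add: power_mult_distrib power_divide add_frac_eq)
  show ?thesis
  proof (rule that[of \<alpha> \<beta>])
    fix z assume z: "z \<notin> \<Lambda>" "z + p \<notin> \<Lambda>" "z - p \<notin> \<Lambda>"
    have "(wp_scale p)\<^sup>2 * (wp z - wp p)\<^sup>2 = (theta (z + p) * theta (z - p) / (theta z)\<^sup>2)\<^sup>2"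
      unfolding wp_diff[OF p z(1)] by (simp add: power_mult_distrib)
    then have "(wp_scale p)\<^sup>2 * (wp z - wp p)\<^sup>2 * (wp (z + p) + wp (z - p)) =
      (theta (z + p) * theta (z - p) / (theta z)\<^sup>2)\<^sup>2 *
      (wp_num (z + p) / (theta (z + p))\<^sup>2 + wp_num (z - p) / (theta (z - p))\<^sup>2)"
      by (simp only: wp_def[of "z + p"] wp_def[of "z - p"])
    also have "\<dots> = h z / ((theta z)\<^sup>2)\<^sup>2"
      unfolding h_def by (rule alg) (simp_all add: z theta_eq_0_iff)
    also have "\<dots> = f z" by (simp add: f_def flip: power_mult)
    finally have "(wp_scale p)\<^sup>2 * (wp z - wp p)\<^sup>2 * (wp (z + p) + wp (z - p)) = f z" .
    then show "(wp_scale p)\<^sup>2 * (wp z - wp p)\<^sup>2 * (wp (z + p) + wp (z - p)) =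
      \<alpha> * (wp z - wp p)\<^sup>2 + \<beta> * (wp z - wp p) + (theta (2 * p))\<^sup>2 * (deriv theta 0)\<^sup>2 / theta p ^ 4"
      using f_eq[OF z(1)] fp by simp
  qed
qed

end

subsection \<open>Special values\<close>

lemma DERIV_vertical:
  assumes "(f has_field_derivative D) (at (Complex x y))"
  shows "((\<lambda>t. Im (f (Complex x t))) has_real_derivative Re D) (at y)"
    and "((\<lambda>t. Re (f (Complex x t))) has_real_derivative - Im D) (at y)"
proof -
  have 1: "((\<lambda>t. Complex x t) has_derivative (\<lambda>h. Complex 0 h)) (at y)"
    unfolding Complex_eq by (auto intro!: derivative_eq_intros)
  have 2: "((\<lambda>t. f (Complex x t)) has_derivative (\<lambda>h. D * Complex 0 h)) (at y)"
    using has_derivative_compose[OF 1, of f "\<lambda>h. D * h"] assms by (simp add: has_field_derivative_def)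
  show "((\<lambda>t. Im (f (Complex x t))) has_real_derivative Re D) (at y)"
    using has_derivative_Im[OF 2] by (simp add: has_field_derivative_def mult_commute_abs)
  show "((\<lambda>t. Re (f (Complex x t))) has_real_derivative - Im D) (at y)"
    proof -
    have "(\<lambda>h. Re (D * Complex 0 h)) = (*) (- Im D)" by auto
    then show ?thesis using has_derivative_Re[OF 2] by (simp only: has_field_derivative_def)
  qed
qed

lemma DERIV_horizontal:
  assumes "(f has_field_derivative D) (at (Complex x y))"
  shows "((\<lambda>t. Re (f (Complex t y))) has_real_derivative Re D) (at x)"
    and "((\<lambda>t. Im (f (Complex t y))) has_real_derivative Im D) (at x)"
proof -
  have 1: "((\<lambda>t. Complex t y) has_derivative (\<lambda>h. Complex h 0)) (at x)"
    unfolding Complex_eq by (auto intro!: derivative_eq_intros)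
  have 2: "((\<lambda>t. f (Complex t y)) has_derivative (\<lambda>h. D * Complex h 0)) (at x)"
    using has_derivative_compose[OF 1, of f "\<lambda>h. D * h"] assms by (simp add: has_field_derivative_def)
  show "((\<lambda>t. Re (f (Complex t y))) has_real_derivative Re D) (at x)"
    using has_derivative_Re[OF 2] by (simp add: has_field_derivative_def)
  show "((\<lambda>t. Im (f (Complex t y))) has_real_derivative Im D) (at x)"
    using has_derivative_Im[OF 2] by (simp add: has_field_derivative_def)
qed

text \<open>A continuous injective function on an interval is strictly monotone; divergence to minus
  infinity at 0 selects the increasing case. The left end is open because \<open>wp\<close> has its
  pole there.\<close>

lemma inj_on_half_open_imp_strict_mono:
  fixes f :: "real \<Rightarrow> real"
  assumes cont: "continuous_on {0<..c} f" and inj: "inj_on f {0<..c}"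
    and low: "\<And>M. \<exists>\<delta>>0. \<forall>y\<in>{0<..<\<delta>}. f y < M"
    and y: "0 < y1" "y1 < y2" "y2 \<le> c"
  shows "f y1 < f y2"
proof (rule ccontr)
  assume "\<not> f y1 < f y2"
  obtain \<delta> where \<delta>: "\<delta> > 0" "\<And>y. y \<in> {0<..<\<delta>} \<Longrightarrow> f y < f y2" using low by blast
  define y0 where "y0 = min (\<delta> / 2) (y1 / 2)"
  have y0: "0 < y0" "y0 < y1" "f y0 < f y2" using \<delta> y by (auto simp: y0_def)
  have "\<exists>x. y0 \<le> x \<and> x \<le> y1 \<and> f x = f y2"
    using y0 y \<open>\<not> f y1 < f y2\<close>
    by (intro IVT' continuous_on_subset[OF cont]) auto
  then obtain x where x: "y0 \<le> x" "x \<le> y1" "f x = f y2" by blast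
  then have "x = y2" using inj_onD[OF inj, of x y2] y y0 by auto
  then show False using x y by simp
qed

text \<open>A finite subcover turns a sign known near each boundary point into one collar width for
  the whole edge.\<close>

lemma compact_edge_uniform:
  fixes K :: "real set"
  assumes "compact K"
    and loc: "\<And>x0. x0 \<in> K \<Longrightarrow> \<exists>e>0. \<forall>x\<in>K. \<forall>y. \<bar>x - x0\<bar> < e \<longrightarrow> 0 < y \<longrightarrow> y < e \<longrightarrow> Q x y"
  shows "\<exists>\<delta>>0::real. \<forall>x\<in>K. \<forall>y. 0 < y \<longrightarrow> y < \<delta> \<longrightarrow> Q x y"
proof -
  obtain e where e: "\<And>x0. x0 \<in> K \<Longrightarrow> e x0 > (0::real)"
    "\<And>x0 x y. x0 \<in> K \<Longrightarrow> x \<in> K \<Longrightarrow> \<bar>x - x0\<bar> < e x0 \<Longrightarrow> 0 < y \<Longrightarrow> y < e x0 \<Longrightarrow> Q x y"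
    using loc by metis
  have "K \<subseteq> (\<Union>x0\<in>K. ball x0 (e x0))" using e(1) by force
  then obtain C where C: "C \<subseteq> K" "finite C" "K \<subseteq> (\<Union>x0\<in>C. ball x0 (e x0))"
    using compactE_image[OF assms(1), of K "\<lambda>x0. ball x0 (e x0)"] by auto
  define \<delta> where "\<delta> = Min (insert 1 (e ` C))"
  have "\<delta> > 0" using C e(1) by (auto simp: \<delta>_def)
  moreover have "Q x y" if xK: "x \<in> K" and y: "0 < y" "y < \<delta>" for x y
  proof -
    obtain x0 where x0: "x0 \<in> C" "x \<in> ball x0 (e x0)" using C(3) xK by blast
    have "\<delta> \<le> e x0" using x0 C by (simp add: \<delta>_def)
    then show ?thesis using e(2)[of x0 x y] x0 C xK y by (auto simp: dist_real_def)
  qed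
  ultimately show ?thesis by blast
qed

text \<open>The Koebe function. \<open>koebe (ee z)\<close> is
  \<open>- 1 / (4 * (sin (pi * z))\<^sup>2)\<close>, that is, up to a constant, the sum of the
  double poles along one row of the lattice.\<close>

definition koebe :: "complex \<Rightarrow> complex" where
  "koebe w = w / (1 - w)\<^sup>2"

context rhombic_torus
begin

text \<open>The second logarithmic derivative of the theta product: the sine yields row 0, each
  factor yields a pair of opposite rows, where \<open>koebe (1 / w) = koebe w\<close> allows
  \<open>ee (n * tau - z)\<close> to stand for row \<open>- n\<close>.\<close>

lemma wp_koebe_sums:
  assumes z: "z \<notin> \<Lambda>"
  shows "(\<lambda>k. koebe (ee (of_nat (Suc k) * tau + z)) + koebe (ee (of_nat (Suc k) * tau - z)))
    sums (- wp z / (4 * (of_real pi)\<^sup>2) - koebe (ee z))"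
proof -
  have nz: "theta z \<noteq> 0" using z by (simp add: theta_eq_0_iff)
  then have eta_nz: "eta z \<noteq> 0" and sin_nz: "sin (of_real pi * z) \<noteq> 0"
    by (auto simp: theta_def)
  have f_nz: "eta_factor k z \<noteq> 0" for k
    using has_prod_eq_0_iff[OF eta_has_prod, of z] eta_nz by (auto simp: image_iff)
  define S where "S = deriv (\<lambda>w. deriv eta w / eta w) z"
  have "uniform_limit (ball 0 (norm z + 1)) (\<lambda>N z. \<Prod>k<N. eta_factor k z) eta sequentially"
    by (rule uniform_limit_on_subset[OF eta_uniform_limit_cball]) (rule ball_subset_cball)
  then have sums: "(\<lambda>k. deriv (\<lambda>w. deriv (eta_factor k) w / eta_factor k w) z) sums S"
    unfolding S_def using eta_nz f_nz
    by (intro sums_deriv_logderiv_prodinf eta_factor_holomorphic) auto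
  have kterm: "deriv (\<lambda>w. deriv (eta_factor k) w / eta_factor k w) z = 4 * (of_real pi)\<^sup>2 *
      (koebe (ee (of_nat (Suc k) * tau + z)) + koebe (ee (of_nat (Suc k) * tau - z)))" for k
  proof -
    define a where "a = of_nat (Suc k) * tau"
    define c where "c = 2 * complex_of_real pi * \<i>"
    have c2: "c\<^sup>2 = - 4 * (of_real pi)\<^sup>2" by (simp add: c_def power_mult_distrib)
    have e1: "((\<lambda>w. ee (a + w)) has_field_derivative c * ee (a + w)) (at w)" for w
      unfolding ee_def c_def by (auto intro!: derivative_eq_intros)
    have e2: "((\<lambda>w. ee (a - w)) has_field_derivative - c * ee (a - w)) (at w)" for w
      unfolding ee_def c_def by (auto intro!: derivative_eq_intros)
    define B where "B = {w. eta_factor k w \<noteq> 0}"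
    have B: "open B" "z \<in> B"
      unfolding B_def using f_nz
      by (auto intro!: open_Collect_neq holomorphic_on_imp_continuous_on eta_factor_holomorphic continuous_on_const)
    have "deriv (eta_factor k) w / eta_factor k w =
        - c * ee (a + w) / (1 - ee (a + w)) + c * ee (a - w) / (1 - ee (a - w))"
      if w: "w \<in> B" for w
    proof -
      have nz: "1 - ee (a + w) \<noteq> 0" "1 - ee (a - w) \<noteq> 0"
        using w by (auto simp: B_def eta_factor_def a_def)
      have "(eta_factor k has_field_derivative
         (- c * ee (a + w)) * (1 - ee (a - w)) + (c * ee (a - w)) * (1 - ee (a + w))) (at w)"
        unfolding eta_factor_def[abs_def] a_def[symmetric]
        by (rule derivative_eq_intros e1 e2 refl)+ (simp add: algebra_simps)
      then have "deriv (eta_factor k) w =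
         (- c * ee (a + w)) * (1 - ee (a - w)) + (c * ee (a - w)) * (1 - ee (a + w))"
        by (rule DERIV_imp_deriv)
      then show ?thesis
        using nz unfolding eta_factor_def a_def[symmetric] by (simp add: divide_simps)
    qed
    then have "deriv (\<lambda>w. deriv (eta_factor k) w / eta_factor k w) z =
        deriv (\<lambda>w. - c * ee (a + w) / (1 - ee (a + w)) + c * ee (a - w) / (1 - ee (a - w))) z"
      using B by (intro deriv_cong_ev eventually_nhds_in_open[THEN eventually_mono]) auto
    also have "\<dots> = - c\<^sup>2 * (koebe (ee (a + z)) + koebe (ee (a - z)))"
    proof (rule DERIV_imp_deriv)
      have nz: "1 - ee (a + z) \<noteq> 0" "1 - ee (a - z) \<noteq> 0"
        using B by (auto simp: B_def eta_factor_def a_def)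
      have d: "(\<lambda>w. - c * u w / (1 - u w)) = (\<lambda>w. c - c / (1 - u w))" if "\<And>w. u w \<noteq> 1" for u :: "complex \<Rightarrow> complex"
        using that by (auto simp: field_simps)
      have q1: "((\<lambda>w. - c * ee (a + w) / (1 - ee (a + w))) has_field_derivative
          - c\<^sup>2 * koebe (ee (a + z))) (at z)"
        by (rule derivative_eq_intros e1 refl | rule nz)+
           (use nz in \<open>simp add: koebe_def divide_simps power2_eq_square, algebra\<close>)
      have q2: "((\<lambda>w. c * ee (a - w) / (1 - ee (a - w))) has_field_derivative
          - c\<^sup>2 * koebe (ee (a - z))) (at z)"
        by (rule derivative_eq_intros e2 refl | rule nz)+
           (use nz in \<open>simp add: koebe_def divide_simps power2_eq_square, algebra\<close>)
      show "((\<lambda>w. - c * ee (a + w) / (1 - ee (a + w)) + c * ee (a - w) / (1 - ee (a - w)))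
         has_field_derivative - c\<^sup>2 * (koebe (ee (a + z)) + koebe (ee (a - z)))) (at z)"
        using DERIV_add[OF q1 q2] by (simp add: algebra_simps)
    qed
    finally show ?thesis by (simp add: c2 a_def)
  qed
  have "- wp z = - (of_real pi)\<^sup>2 / (sin (of_real pi * z))\<^sup>2 + S"
  proof -
    have eq: "zeta w = of_real pi * cos (of_real pi * w) / sin (of_real pi * w) + deriv eta w / eta w"
      if "w \<notin> \<Lambda>" for w
    proof -
      have nzw: "sin (of_real pi * w) \<noteq> 0" "eta w \<noteq> 0"
        using that theta_eq_0_iff[of w] by (auto simp: theta_def)
      have "(eta has_field_derivative deriv eta w) (at w)"
        using eta_holomorphic[of UNIV] by (intro holomorphic_derivI) auto
      then have "(theta has_field_derivative of_real pi * cos (of_real pi * w) * eta w +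
          sin (of_real pi * w) * deriv eta w) (at w)"
        unfolding theta_def[abs_def] by (auto intro!: derivative_eq_intros)
      then have "deriv theta w = of_real pi * cos (of_real pi * w) * eta w +
          sin (of_real pi * w) * deriv eta w" by (rule DERIV_imp_deriv)
      then show ?thesis using nzw by (simp add: zeta_def theta_def divide_simps)
    qed
    have 1: "((\<lambda>w. of_real pi * cos (of_real pi * w) / sin (of_real pi * w)) has_field_derivative
        - (of_real pi)\<^sup>2 / (sin (of_real pi * z))\<^sup>2) (at z)"
    proof -
      have sc: "(cos (of_real pi * z))\<^sup>2 = 1 - (sin (of_real pi * z))\<^sup>2"
        using sin_cos_squared_add[of "of_real pi * z"] by (simp add: algebra_simps)
      show ?thesis
        by (rule derivative_eq_intros refl | rule sin_nz)+
           (use sin_nz sc in \<open>simp add: divide_simps power2_eq_square, algebra\<close>)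
    qed
    have 2: "((\<lambda>w. deriv eta w / eta w) has_field_derivative S) (at z)"
    proof -
      have "(eta has_field_derivative deriv eta z) (at z)"
        using eta_holomorphic[of UNIV] by (intro holomorphic_derivI) auto
      moreover have "(deriv eta has_field_derivative deriv (deriv eta) z) (at z)"
        using eta_holomorphic[of UNIV] by (intro holomorphic_derivI holomorphic_deriv) auto
      ultimately have "(\<lambda>w. deriv eta w / eta w) field_differentiable at z"
        using eta_nz by (intro field_differentiable_divide) (auto simp: field_differentiable_def)
      then show ?thesis unfolding S_def by (simp add: DERIV_deriv_iff_field_differentiable)
    qed
    have "(zeta has_field_derivative - (of_real pi)\<^sup>2 / (sin (of_real pi * z))\<^sup>2 + S) (at z)"
      by (rule has_field_derivative_transform_within_open[OF DERIV_add[OF 1 2] open_off_lattice])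
         (use z eq in auto)
    then show ?thesis using zeta_DERIV[OF z] DERIV_unique by blast
  qed
  moreover have "- (of_real pi)\<^sup>2 / (sin (of_real pi * z))\<^sup>2 = 4 * (of_real pi)\<^sup>2 * koebe (ee z)"
  proof -
    have h: "(exp (- of_real pi * \<i> * z))\<^sup>2 = inverse (ee z)"
      by (simp add: ee_def algebra_simps flip: exp_double exp_minus)
    have "(sin (of_real pi * z))\<^sup>2 = - 1 / 4 * inverse (ee z) * (1 - ee z)\<^sup>2"
      unfolding sin_pi_eq_ee by (simp only: power_mult_distrib h power_divide) simp
    moreover have "1 - ee z \<noteq> 0" using sin_nz by (auto simp: sin_pi_eq_ee)
    moreover have "- P / s = 4 * P * (e / d\<^sup>2)" if "s = - 1 / 4 * inverse e * d\<^sup>2" "e \<noteq> 0" "d \<noteq> 0"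
      for P s e d :: complex
      unfolding that(1) using that(2,3) by (simp add: field_simps)
    ultimately show ?thesis by (simp only: koebe_def ee_nonzero not_False_eq_True)
  qed
  ultimately have "- wp z = 4 * (of_real pi)\<^sup>2 * koebe (ee z) + S" by simp
  then have "S = - wp z - 4 * (of_real pi)\<^sup>2 * koebe (ee z)" by (metis add_diff_cancel_left')
  then have S: "S / (4 * (of_real pi)\<^sup>2) = - wp z / (4 * (of_real pi)\<^sup>2) - koebe (ee z)"
    by (simp add: diff_divide_distrib)
  have "(\<lambda>k. 4 * (of_real pi)\<^sup>2 *
      (koebe (ee (of_nat (Suc k) * tau + z)) + koebe (ee (of_nat (Suc k) * tau - z))) / (4 * (of_real pi)\<^sup>2))
     sums (S / (4 * (of_real pi)\<^sup>2))"
    using sums unfolding kterm by (rule sums_divide)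
  then show ?thesis unfolding S by simp
qed

lemma Re_koebe_imaginary: "Re (koebe (\<i> * of_real s)) = - 2 * s\<^sup>2 / (1 + s\<^sup>2)\<^sup>2"
proof -
  have "(1 - \<i> * of_real s) * (1 + \<i> * of_real s) = complex_of_real (1 + s\<^sup>2)"
    by (simp add: power2_eq_square algebra_simps)
  then have q: "(1 - \<i> * of_real s)\<^sup>2 * (1 + \<i> * of_real s)\<^sup>2 = complex_of_real ((1 + s\<^sup>2)\<^sup>2)"
    by (metis of_real_power power_mult_distrib)
  have nz: "1 - \<i> * of_real s \<noteq> 0" "1 + \<i> * of_real s \<noteq> 0"
    by (auto simp: complex_eq_iff)
  have "koebe (\<i> * of_real s) = \<i> * of_real s * (1 + \<i> * of_real s)\<^sup>2 / complex_of_real ((1 + s\<^sup>2)\<^sup>2)"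
    unfolding koebe_def q[symmetric] using nz by simp
  also have "Re \<dots> = Re (\<i> * of_real s * (1 + \<i> * of_real s)\<^sup>2) / (1 + s\<^sup>2)\<^sup>2"
    by (simp only: Re_divide_of_real)
  also have "Re (\<i> * of_real s * (1 + \<i> * of_real s)\<^sup>2) = - 2 * s\<^sup>2"
    by (simp add: power2_eq_square)
  finally show ?thesis .
qed

text \<open>Since \<open>Re tau = 1/2\<close>, \<open>ee (tau / 2)\<close> is \<open>\<i>\<close>
  times a positive number; its odd powers are purely imaginary, where \<open>koebe\<close> has
  negative real part.\<close>

lemma Re_koebe_ee_odd: "odd (n :: int) \<Longrightarrow> Re (koebe (ee (of_int n * (tau / 2)))) < 0"
proof -
  assume n: "odd n"
  obtain m where m: "n = 2 * m + 1" using n by (auto elim: oddE)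
  define s where "s = (if even m then exp (- pi * b * n) else - exp (- pi * b * n))"
  have "2 * of_real pi * \<i> * (of_int n * (tau / 2)) = of_real (- pi * b * n) + \<i> * of_real (pi * n / 2)"
    by (simp add: complex_eq_iff)
  then have "ee (of_int n * (tau / 2)) = of_real (exp (- pi * b * n)) * cis (pi * n / 2)"
    unfolding ee_def by (simp only: exp_add exp_of_real cis_conv_exp)
  also have "cis (pi * n / 2) = cis (pi * of_int m) * \<i>"
  proof -
    have "pi * n / 2 = pi * of_int m + pi / 2" by (simp add: m field_simps)
    then show ?thesis by (simp only: cis_mult[symmetric] cis_pi_half)
  qed
  also have "cis (pi * of_int m) = (if even m then 1 else - 1)"
    by (auto simp: complex_eq_iff mult.commute elim!: evenE oddE)
  finally have "ee (of_int n * (tau / 2)) = \<i> * of_real s"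
    by (simp add: s_def mult.commute)
  moreover have "s \<noteq> 0" by (simp add: s_def)
  then have "2 * s\<^sup>2 / (1 + s\<^sup>2)\<^sup>2 > 0"
    by (intro divide_pos_pos zero_less_power) (auto intro: add_pos_nonneg)
  ultimately show ?thesis
    by (simp add: Re_koebe_imaginary)
qed

lemma half_tau_off_lattice: "tau / 2 \<notin> \<Lambda>"
proof
  assume "tau / 2 \<in> \<Lambda>"
  then obtain n :: int where "b / 2 = of_int n * b" unfolding lattice_coords by auto
  then have "of_int n = (1 / 2 :: real)" using b_pos by simp
  then have "of_int (2 * n) = (1 :: real)" by simp
  then have "2 * n = 1" by linarith
  then show False by presburger
qed

lemma half_off_lattice: "1 / 2 \<notin> \<Lambda>"
proof
  assume "1 / 2 \<in> \<Lambda>"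
  then obtain m n :: int where "1 / 2 = of_int m + of_int n / (2::real)" "0 = of_int n * b"
    unfolding lattice_coords by auto
  then have "2 * (of_int m :: real) = 1" using b_pos by simp
  then have "2 * m = 1" by linarith
  then show False by presburger
qed

text \<open>At \<open>tau / 2\<close> every row of the expansion is evaluated at an odd power of
  \<open>ee (tau / 2)\<close>, so all real parts have the same sign. This is the nondegeneracy at
  the parameter \<open>1/4\<close>.\<close>

lemma Re_wp_half_tau_pos: "Re (wp (tau / 2)) > 0"
proof -
  define X where "X = - wp (tau / 2) / (4 * (of_real pi)\<^sup>2) - koebe (ee (tau / 2))"
  have "(\<lambda>k. koebe (ee (of_nat (Suc k) * tau + tau / 2)) + koebe (ee (of_nat (Suc k) * tau - tau / 2))) sums X"
    unfolding X_def by (rule wp_koebe_sums[OF half_tau_off_lattice])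
  then have sX: "(\<lambda>k. Re (koebe (ee (of_nat (Suc k) * tau + tau / 2)) + koebe (ee (of_nat (Suc k) * tau - tau / 2)))) sums Re X"
    by (rule sums_Re)
  have "Re (koebe (ee (of_nat (Suc k) * tau + tau / 2)) + koebe (ee (of_nat (Suc k) * tau - tau / 2))) \<le> 0" for k
  proof -
    have "of_nat (Suc k) * tau + tau / 2 = of_int (2 * int k + 3) * (tau / 2)"
      "of_nat (Suc k) * tau - tau / 2 = of_int (2 * int k + 1) * (tau / 2)"
      by (simp_all add: field_simps)
    note e = this
    have "odd (2 * int k + 3)" "odd (2 * int k + 1)" by simp_all
    from this[THEN Re_koebe_ee_odd] show ?thesis
      unfolding e plus_complex.sel by linarith
  qed
  from sums_le[OF this sX sums_zero] have "Re X \<le> 0" .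
  moreover have "Re (koebe (ee (tau / 2))) < 0" using Re_koebe_ee_odd[of 1] by simp
  moreover have "wp (tau / 2) = - of_real (4 * pi\<^sup>2) * (X + koebe (ee (tau / 2)))"
    by (simp add: X_def field_simps)
  then have "Re (wp (tau / 2)) = - (4 * pi\<^sup>2) * (Re X + Re (koebe (ee (tau / 2))))"
    by simp
  ultimately show ?thesis by (simp add: mult_pos_neg)
qed

text \<open>At \<open>1/2\<close> row 0 contributes \<open>koebe (- 1) = - 1/4\<close>, and for
  \<open>b > 1/2\<close> the other rows add up to less than \<open>1/4\<close>. Used to exclude
  nontrivial critical points of \<open>green\<close> on the real axis.\<close>

lemma Re_wp_half_pos:
  assumes "b > 1 / 2"
  shows "Re (wp (1 / 2)) > 0"
proof -
  define q where "q = exp (- 2 * pi * b)"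
  \<comment> \<open>The bound 15 lies below \<open>2.5 ^ 3\<close>; \<open>exp 1\<close> is at least
    \<open>2.5\<close>, and \<open>2 * pi * b > pi > 3\<close>.\<close>
  have q: "0 < q" "q < 1 / 15"
  proof -
    have "(2.5 :: real) ^ 3 \<le> exp 1 ^ 3"
      using exp_lower_Taylor_quadratic[of 1] by (intro power_mono) auto
    also have "exp 1 ^ 3 = exp (3 :: real)" by (simp flip: exp_of_nat_mult)
    also have "exp 3 < exp (2 * pi * b)"
    proof -
      have "3 < pi" by (rule pi_gt3)
      also have "pi = 2 * pi * (1 / 2)" by simp
      also have "\<dots> < 2 * pi * b" using assms by (intro mult_strict_left_mono) auto
      finally show ?thesis by simp
    qed
    finally have "15 < exp (2 * pi * b)" by (simp add: power3_eq_cube)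
    then show "q < 1 / 15" by (simp add: q_def exp_minus divide_simps)
  qed (simp add: q_def)
  have etau: "ee tau = - of_real q"
  proof -
    have "2 * of_real pi * \<i> * tau = of_real (- 2 * pi * b) + \<i> * of_real pi"
      by (simp add: complex_eq_iff)
    then show ?thesis unfolding ee_def q_def by (simp only: exp_add exp_of_real cis_conv_exp[symmetric] cis_pi) simp
  qed
  have ehalf: "ee (1 / 2) = - 1" "ee (- (1 / 2)) = - 1"
    by (simp_all add: ee_def exp_minus)
  define X where "X = - wp (1 / 2) / (4 * (of_real pi)\<^sup>2) - koebe (ee (1 / 2))"
  define a where "a = (\<lambda>k. (- q) ^ Suc k)"
  have kterm: "koebe (ee (of_nat (Suc k) * tau + 1 / 2)) + koebe (ee (of_nat (Suc k) * tau - 1 / 2))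
      = of_real (- 2 * a k / (1 + a k)\<^sup>2)" for k
  proof -
    have "ee (of_nat (Suc k) * tau + 1 / 2) = of_real (- a k)"
      "ee (of_nat (Suc k) * tau + - (1 / 2)) = of_real (- a k)"
      unfolding ee_add ee_power etau ehalf by (simp_all add: a_def)
    then show ?thesis by (simp add: koebe_def)
  qed
  have "(\<lambda>k. koebe (ee (of_nat (Suc k) * tau + 1 / 2)) + koebe (ee (of_nat (Suc k) * tau - 1 / 2))) sums X"
    unfolding X_def by (rule wp_koebe_sums[OF half_off_lattice])
  then have "(\<lambda>k. Re (of_real (- 2 * a k / (1 + a k)\<^sup>2))) sums Re X"
    unfolding kterm by (rule sums_Re)
  then have sX: "(\<lambda>k. - 2 * a k / (1 + a k)\<^sup>2) sums Re X" by simp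
  have sg: "(\<lambda>k. 3 * q * q ^ k) sums (3 * q * (1 / (1 - q)))"
    using q by (intro sums_mult geometric_sums) auto
  \<comment> \<open>As \<open>\<bar>a k\<bar> \<le> 1/15\<close>, the denominator is at least
    \<open>2/3\<close>. The geometric sum \<open>3 * q / (1 - q)\<close> is then below
    \<open>3/14 < 1/4\<close>.\<close>
  have "- 2 * a k / (1 + a k)\<^sup>2 \<le> 3 * q * q ^ k" for k
  proof -
    have abs_a: "\<bar>a k\<bar> = q * q ^ k" using q by (simp add: a_def abs_mult power_abs)
    have "q * q ^ k \<le> q * 1" using q by (intro mult_left_mono power_le_one) auto
    then have "\<bar>a k\<bar> \<le> 1 / 15" using abs_a q by linarith
    then have "(14 / 15)\<^sup>2 \<le> (1 + a k)\<^sup>2" by (intro power_mono) auto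
    then have "2 / 3 \<le> (1 + a k)\<^sup>2" by (simp add: power2_eq_square)
    have "- 2 * a k / (1 + a k)\<^sup>2 \<le> 2 * \<bar>a k\<bar> / (1 + a k)\<^sup>2"
      by (intro divide_right_mono) auto
    also have "\<dots> \<le> 2 * \<bar>a k\<bar> / (2 / 3)"
      using \<open>2 / 3 \<le> (1 + a k)\<^sup>2\<close> by (intro divide_left_mono) auto
    finally show ?thesis using abs_a by simp
  qed
  from sums_le[OF this sX sg] have "Re X \<le> 3 * q * (1 / (1 - q))" .
  also have "\<dots> < 1 / 4" using q by (simp add: field_simps)
  finally have "Re X < 1 / 4" .
  moreover have "Re (koebe (ee (1 / 2))) = - 1 / 4" by (simp add: ehalf koebe_def)
  moreover have "wp (1 / 2) = - of_real (4 * pi\<^sup>2) * (X + koebe (ee (1 / 2)))"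
    by (simp add: X_def field_simps)
  then have "Re (wp (1 / 2)) = - (4 * pi\<^sup>2) * (Re X + Re (koebe (ee (1 / 2))))"
    by simp
  ultimately show ?thesis by (simp add: mult_pos_neg)
qed

end

subsection \<open>Monotonicity on the symmetry axes\<close>

context rhombic_torus
begin

lemma lattice_Complex: "Complex x y \<in> \<Lambda> \<longleftrightarrow> (\<exists>m n :: int. x = of_int m + of_int n / 2 \<and> y = of_int n * b)"
  by (simp add: lattice_coords)

lemma not_lattice_Im: "0 < y \<Longrightarrow> y < b \<Longrightarrow> Complex x y \<notin> \<Lambda>"
proof
  assume "0 < y" "y < b" "Complex x y \<in> \<Lambda>"
  then obtain n :: int where n: "y = of_int n * b"
    unfolding lattice_Complex by auto
  have "0 < of_int n * b" "of_int n * b < 1 * b" using \<open>0 < y\<close> \<open>y < b\<close> n by auto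
  then have "0 < n" "n < 1" using b_pos by (simp_all add: zero_less_mult_iff)
  then show False by simp
qed

lemma not_lattice_Re: "0 < x \<Longrightarrow> x < 1 \<Longrightarrow> Complex x 0 \<notin> \<Lambda>"
proof
  assume "0 < x" "x < 1" "Complex x 0 \<in> \<Lambda>"
  then obtain m :: int where "0 < real_of_int m" "real_of_int m < 1"
    unfolding lattice_Complex using b_pos by auto
  then show False by simp
qed

lemma not_lattice_imaginary: "0 < y \<Longrightarrow> y \<le> b \<Longrightarrow> Complex 0 y \<notin> \<Lambda>"
proof
  assume y: "0 < y" "y \<le> b" "Complex 0 y \<in> \<Lambda>"
  then obtain m n :: int where mn: "0 = of_int m + of_int n / (2 :: real)" "y = of_int n * b"
    unfolding lattice_Complex by auto
  have "0 < of_int n * b" "of_int n * b \<le> 1 * b" using y mn by auto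
  then have "n = 1" using b_pos by (auto simp: zero_less_mult_iff)
  then have "2 * m + 1 = 0" using mn(1) by simp
  then show False by presburger
qed

lemma two_ib_lattice: "Complex 0 (2 * b) \<in> \<Lambda>"
  unfolding lattice_Complex by (rule exI[of _ "-1"], rule exI[of _ 2]) simp

lemma Complex_half_0: "Complex (1 / 2) 0 = 1 / 2"
  by (simp add: complex_eq_iff)

text \<open>Up to sign, the point \<open>\<i> * b\<close> is the half period \<open>1/2\<close>
  modulo the lattice, which joins the values of \<open>wp\<close> on the two axes.\<close>

lemma wp_imaginary_b: "wp (Complex 0 b) = wp (1 / 2)"
proof -
  have "wp (Complex 0 b) = wp (- Complex 0 b)" by (simp add: wp_uminus)
  also have "- Complex 0 b = 1 / 2 + - tau" by (simp add: complex_eq_iff)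
  also have "wp (1 / 2 + - tau) = wp (1 / 2)" by (rule wp_lattice) simp
  finally show ?thesis .
qed

lemma continuous_on_wp: "continuous_on (- \<Lambda>) wp"
  by (rule holomorphic_on_imp_continuous_on[OF wp_holomorphic])

lemma continuous_on_wp_compose [continuous_intros]:
  assumes "continuous_on A f" "\<And>x. x \<in> A \<Longrightarrow> f x \<notin> \<Lambda>"
  shows "continuous_on A (\<lambda>x. wp (f x))"
  by (rule continuous_on_compose2[OF continuous_on_wp assms(1)]) (use assms in auto)

lemma cnj_Complex_0: "cnj (Complex x 0) = Complex x 0"
  by (simp add: complex_eq_iff)

lemma Im_wp_real: "Im (wp (Complex x 0)) = 0"
proof -
  have "cnj (wp (Complex x 0)) = wp (Complex x 0)"
    unfolding cnj_wp by (simp add: cnj_Complex_0)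
  then show ?thesis by (simp add: complex_eq_iff)
qed

lemma wp_neg_cnj: "wp (- cnj z) = cnj (wp z)"
  by (simp add: wp_uminus cnj_wp)

lemma Im_wp_imaginary: "Im (wp (Complex 0 y)) = 0"
proof -
  have "- cnj (Complex 0 y) = Complex 0 y" by (simp add: complex_eq_iff)
  then have "cnj (wp (Complex 0 y)) = wp (Complex 0 y)" by (metis wp_neg_cnj)
  then show ?thesis by (simp add: complex_eq_iff)
qed

lemma wp_reg_near_0:
  obtains \<rho> where "\<rho> > 0" "\<And>z. norm z < \<rho> \<Longrightarrow> Re (wp_reg z) > 1 / 2"
proof -
  have "isCont wp_reg 0"
    using holomorphic_on_imp_continuous_on[OF wp_reg_holomorphic] rad_pos
    by (simp add: continuous_on_eq_continuous_at)
  then obtain \<rho> where "\<rho> > 0" and \<rho>: "\<And>z :: complex. dist z 0 < \<rho> \<Longrightarrow> dist (wp_reg z) (wp_reg 0) < 1 / 2"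
    unfolding continuous_at_eps_delta by (metis half_gt_zero_iff zero_less_one)
  then show ?thesis
  proof (intro that[of \<rho>])
    fix z :: complex assume "norm z < \<rho>"
    then have "norm (wp_reg z - 1) < 1 / 2"
      using \<rho>[of z] by (simp add: dist_norm wp_reg_0)
    then show "Re (wp_reg z) > 1 / 2"
      using abs_Re_le_cmod[of "wp_reg z - 1"] by (simp add: abs_if split: if_splits)
  qed
qed

text \<open>Both come from the leading term \<open>1 / z\<^sup>2\<close>, negative on the imaginary
  axis and positive on the real one.\<close>

lemma wp_imaginary_low: "\<exists>\<delta>>0. \<forall>y\<in>{0<..<\<delta>}. Re (wp (Complex 0 y)) < M"
  and wp_real_high: "\<exists>\<delta>>0. \<forall>y\<in>{0<..<\<delta>}. Re (wp (Complex y 0)) > M"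
proof -
  obtain \<rho> where \<rho>: "\<rho> > 0" "\<And>z. norm z < \<rho> \<Longrightarrow> Re (wp_reg z) > 1 / 2"
    by (rule wp_reg_near_0) blast
  \<comment> \<open>For \<open>0 < y < \<delta>\<close> this gives
    \<open>1 / (2 * y\<^sup>2) > \<bar>M\<bar> + 1\<close>; the factor 2 pays for knowing only
    \<open>Re (wp_reg z) > 1/2\<close>.\<close>
  define \<delta> where "\<delta> = min \<rho> (1 / sqrt (2 * (\<bar>M\<bar> + 1)))"
  have \<delta>: "\<delta> > 0" using \<rho> by (simp add: \<delta>_def)
  have big: "\<bar>M\<bar> < r / y\<^sup>2" if "0 < y" "y < \<delta>" "1 / 2 < r" for y r
  proof -
    have "y < 1 / sqrt (2 * (\<bar>M\<bar> + 1))" using that by (simp add: \<delta>_def)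
    then have "y\<^sup>2 < (1 / sqrt (2 * (\<bar>M\<bar> + 1)))\<^sup>2" using that by (intro power_strict_mono) auto
    also have "\<dots> = 1 / (2 * (\<bar>M\<bar> + 1))" by (simp add: power_divide)
    finally have "y\<^sup>2 * (2 * (\<bar>M\<bar> + 1)) < 1" by (simp add: field_simps)
    moreover have "y\<^sup>2 * (2 * (\<bar>M\<bar> + 1)) = 2 * (\<bar>M\<bar> * y\<^sup>2) + 2 * y\<^sup>2" by (simp add: algebra_simps)
    ultimately have "\<bar>M\<bar> * y\<^sup>2 < 1 / 2" using zero_le_power2[of y] by linarith
    then have "\<bar>M\<bar> * y\<^sup>2 < r" using that by linarith
    then show ?thesis using that by (simp add: pos_less_divide_eq)
  qed
  have "Re (wp (Complex 0 y)) < M" if y: "y \<in> {0<..<\<delta>}" for y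
  proof -
    have sq: "(Complex 0 y)\<^sup>2 = - complex_of_real (y\<^sup>2)"
      by (simp add: complex_eq_iff power2_eq_square)
    have "Re (wp (Complex 0 y)) = - (Re (wp_reg (Complex 0 y)) / y\<^sup>2)"
      unfolding wp_eq_reg sq by (simp only: divide_minus_right Re_divide_of_real uminus_complex.sel)
    moreover have "norm (Complex 0 y) < \<rho>" using y by (simp add: \<delta>_def cmod_def)
    ultimately show ?thesis using big[of y "Re (wp_reg (Complex 0 y))"] \<rho>(2)[of "Complex 0 y"] y by auto
  qed
  then show "\<exists>\<delta>>0. \<forall>y\<in>{0<..<\<delta>}. Re (wp (Complex 0 y)) < M" using \<delta> by blast
  have "Re (wp (Complex y 0)) > M" if y: "y \<in> {0<..<\<delta>}" for y
  proof -
    have sq: "(Complex y 0)\<^sup>2 = complex_of_real (y\<^sup>2)"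
      by (simp add: complex_eq_iff power2_eq_square)
    have "Re (wp (Complex y 0)) = Re (wp_reg (Complex y 0)) / y\<^sup>2"
      unfolding wp_eq_reg sq by (simp only: Re_divide_of_real)
    moreover have "norm (Complex y 0) < \<rho>" using y by (simp add: \<delta>_def cmod_def)
    ultimately show ?thesis using big[of y "Re (wp_reg (Complex y 0))"] \<rho>(2)[of "Complex y 0"] y by auto
  qed
  then show "\<exists>\<delta>>0. \<forall>y\<in>{0<..<\<delta>}. Re (wp (Complex y 0)) > M" using \<delta> by blast
qed

text \<open>The lattice meets the imaginary axis only in multiples of \<open>2 * \<i> * b\<close>,
  so \<open>wp\<close>, which is real there, is injective up to height \<open>b\<close>; the pole
  fixes the direction.\<close>

lemma wp_imaginary_strict_mono:
  assumes "0 < y1" "y1 < y2" "y2 \<le> b"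
  shows "Re (wp (Complex 0 y1)) < Re (wp (Complex 0 y2))"
proof (rule inj_on_half_open_imp_strict_mono[where f = "\<lambda>y. Re (wp (Complex 0 y))" and c = b])
  show "continuous_on {0<..b} (\<lambda>y. Re (wp (Complex 0 y)))"
    unfolding Complex_eq by (intro continuous_intros) (use not_lattice_imaginary in \<open>auto simp: Complex_eq\<close>)
  show "inj_on (\<lambda>y. Re (wp (Complex 0 y))) {0<..b}"
  proof (rule inj_onI)
    fix x y assume xy: "x \<in> {0<..b}" "y \<in> {0<..b}" "Re (wp (Complex 0 x)) = Re (wp (Complex 0 y))"
    then have "wp (Complex 0 x) = wp (Complex 0 y)"
      by (simp add: complex_eq_iff Im_wp_imaginary)
    then have "Complex 0 x + Complex 0 y \<in> \<Lambda> \<or> Complex 0 x - Complex 0 y \<in> \<Lambda>"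
      using wp_eq_iff not_lattice_imaginary xy by auto
    then obtain m n :: int where mn: "0 = of_int m + of_int n / (2::real)"
       "x + y = of_int n * b \<or> x - y = of_int n * b"
      unfolding complex_add complex_diff lattice_Complex by auto
    from mn(1) have "n = - 2 * m" by simp
    with mn(2) have "x + y = of_int (- m) * (2 * b) \<or> x - y = of_int (- m) * (2 * b)"
      by (simp add: ac_simps)
    then show "x = y"
    proof
      assume a: "x + y = of_int (- m) * (2 * b)"
      have "0 < x + y" using xy by auto
      then have "0 < of_int (- m) * (2 * b)" unfolding a .
      then have "1 \<le> - m" using b_pos by (simp add: zero_less_mult_iff mult_less_0_iff)
      then have "1 * (2 * b) \<le> of_int (- m) * (2 * b)" using b_pos by (intro mult_right_mono) auto
      then have "1 * (2 * b) \<le> x + y" unfolding a .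
      then show "x = y" using xy by simp
    next
      assume a: "x - y = of_int (- m) * (2 * b)"
      then have "\<bar>of_int (- m)\<bar> * (2 * b) = \<bar>x - y\<bar>" using b_pos by (simp add: abs_mult)
      also have "\<dots> < 1 * (2 * b)" using xy by auto
      finally have "\<bar>of_int (- m)\<bar> < (1::real)" using b_pos by (subst (asm) mult_less_cancel_right_pos) auto
      then have "m = 0" by linarith
      then show "x = y" using a by simp
    qed
  qed
qed (use wp_imaginary_low assms in auto)

text \<open>The same argument with the period 1; the opposite sign of the pole reverses the
  direction.\<close>

lemma wp_real_strict_antimono:
  assumes "0 < x1" "x1 < x2" "x2 \<le> 1 / 2"
  shows "Re (wp (Complex x2 0)) < Re (wp (Complex x1 0))"
proof -
  have "- Re (wp (Complex x1 0)) < - Re (wp (Complex x2 0))"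
  proof (rule inj_on_half_open_imp_strict_mono[where f = "\<lambda>y. - Re (wp (Complex y 0))" and c = "1 / 2"])
    show "continuous_on {0<..1/2} (\<lambda>y. - Re (wp (Complex y 0)))"
      unfolding Complex_eq by (intro continuous_intros) (use not_lattice_Re in \<open>auto simp: Complex_eq\<close>)
    show "inj_on (\<lambda>y. - Re (wp (Complex y 0))) {0<..1/2}"
    proof (rule inj_onI)
      fix x y assume xy: "x \<in> {0<..1/2}" "y \<in> {0<..1/2}" "- Re (wp (Complex x 0)) = - Re (wp (Complex y 0))"
      then have "wp (Complex x 0) = wp (Complex y 0)"
        by (simp add: complex_eq_iff Im_wp_real)
      then have "Complex x 0 + Complex y 0 \<in> \<Lambda> \<or> Complex x 0 - Complex y 0 \<in> \<Lambda>"
        using wp_eq_iff not_lattice_Re xy by auto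
      then obtain m where "x + y = real_of_int m \<or> x - y = of_int m"
        unfolding complex_add complex_diff lattice_Complex using b_pos by auto
      then show "x = y"
      proof
        assume a: "x + y = real_of_int m"
        then have "0 < real_of_int m" using xy by auto
        then have "0 < m" by simp
        then have "1 \<le> real_of_int m" by simp
        then show "x = y" using a xy by auto
      next
        assume a: "x - y = real_of_int m"
        moreover have "\<bar>x - y\<bar> < 1" using xy by auto
        ultimately have "\<bar>real_of_int m\<bar> < 1" by simp
        then have "m = 0" by linarith
        then show "x = y" using a by simp
      qed
    qed
    show "\<exists>\<delta>>0. \<forall>y\<in>{0<..<\<delta>}. - Re (wp (Complex y 0)) < M" for M
      using wp_real_high[of "- M"] by (auto simp: minus_less_iff)
  qed (use assms in auto)
  then show ?thesis by simp
qed

text \<open>Up to the factor \<open>- 2 \<pi>\<close> this is twice the Wirtinger derivative of the Green function,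
  Hecke's form of weight one.\<close>

definition hecke :: "complex \<Rightarrow> complex" where
  "hecke z = (if z \<in> \<Lambda> then 0 else zeta z + of_real (2 * pi * Im z / b) * \<i>)"

lemma hecke_lattice: "w \<in> \<Lambda> \<Longrightarrow> hecke (z + w) = hecke z"
proof (rule period_lattice)
  show "hecke (z + 1) = hecke z" for z
    by (simp add: hecke_def lattice_shift zeta_plus_1)
  show "hecke (z + tau) = hecke z" for z
    using b_pos by (simp add: hecke_def lattice_shift zeta_plus_tau add_divide_distrib algebra_simps)
qed auto

lemma hecke_uminus: "hecke (- z) = - hecke z"
  by (simp add: hecke_def zeta_uminus)

lemma cnj_hecke: "cnj (hecke z) = hecke (cnj z)"
  by (simp add: hecke_def cnj_zeta)

lemma hecke_neg_cnj: "hecke (- cnj z) = - cnj (hecke z)"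
  by (simp add: hecke_uminus cnj_hecke)

text \<open>Oddness and periodicity clash at half periods. Lattice points are included through the
  default value 0 in \<open>hecke\<close>.\<close>

lemma hecke_half_period:
  assumes "2 * z \<in> \<Lambda>"
  shows "hecke z = 0"
proof -
  have "hecke z = hecke (- z + 2 * z)" by simp
  also have "\<dots> = - hecke z" unfolding hecke_lattice[OF assms] by (rule hecke_uminus)
  finally show ?thesis by (simp add: eq_neg_iff_add_eq_0)
qed

text \<open>Up to the factor \<open>2 * pi\<close>, the vertical derivative of the Green function.
  Its zeros on the line \<open>Re z = p\<close> correspond to the zeros of the pair equation on the
  imaginary axis.\<close>

definition vfun :: "real \<Rightarrow> real \<Rightarrow> real" where
  "vfun x y = Im (hecke (Complex x y))"

lemma vfun_off: "Complex x y \<notin> \<Lambda> \<Longrightarrow> vfun x y = Im (zeta (Complex x y)) + 2 * pi * y / b"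
  by (simp add: vfun_def hecke_def)

lemma vfun_DERIV:
  assumes "Complex x y \<notin> \<Lambda>"
  shows "(vfun x has_real_derivative 2 * pi / b - Re (wp (Complex x y))) (at y)"
proof -
  have "((\<lambda>t. Im (zeta (Complex x t)) + 2 * pi * t / b) has_real_derivative
      Re (- wp (Complex x y)) + 2 * pi / b) (at y)"
    using b_pos by (intro DERIV_add DERIV_vertical(1)[OF zeta_DERIV[OF assms]]) (auto intro!: derivative_eq_intros)
  moreover have "open {t. Complex x t \<notin> \<Lambda>}"
  proof -
    have "open ((\<lambda>t. Complex x t) -` (- \<Lambda>))"
      by (rule continuous_open_vimage[OF open_off_lattice])
         (auto simp: Complex_eq intro!: continuous_intros)
    then show ?thesis by (simp add: vimage_def)
  qed
  ultimately have "(vfun x has_real_derivative Re (- wp (Complex x y)) + 2 * pi / b) (at y)"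
    by (rule has_field_derivative_transform_within_open) (use assms vfun_off in auto)
  then show ?thesis by (simp add: algebra_simps)
qed

lemma vfun_real_axis: "vfun x 0 = 0"
proof -
  have "cnj (hecke (Complex x 0)) = hecke (Complex x 0)"
    unfolding cnj_hecke by (simp add: cnj_Complex_0)
  then show ?thesis by (simp add: vfun_def complex_eq_iff)
qed

lemma vfun_b: "vfun 0 b = 0"
proof -
  have "2 * Complex 0 b = Complex 0 (2 * b)" by (simp add: complex_eq_iff)
  then have "hecke (Complex 0 b) = 0" using two_ib_lattice by (intro hecke_half_period) simp
  then show ?thesis by (simp add: vfun_def)
qed

text \<open>Point reflection \<open>z \<mapsto> tau - z\<close>; it exchanges the bottom and the top
  edge of the strip and reverses the sign.\<close>

lemma vfun_reflect: "vfun (1 / 2 - x) (b - y) = - vfun x y"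
proof -
  have "Complex (1 / 2 - x) (b - y) = - Complex x y + tau" by (simp add: complex_eq_iff)
  then have "hecke (Complex (1 / 2 - x) (b - y)) = - hecke (Complex x y)"
    by (simp only: hecke_lattice[OF lattice_tau] hecke_uminus)
  then show ?thesis by (simp add: vfun_def)
qed

lemma vfun_continuous_on: "(\<And>y. y \<in> S \<Longrightarrow> Complex x y \<notin> \<Lambda>) \<Longrightarrow> continuous_on S (vfun x)"
  using vfun_DERIV by (meson DERIV_isCont continuous_at_imp_continuous_on)

lemma theta_quot_cnj: "cnj (theta_quot z) = theta_quot (cnj z)"
  by (simp add: theta_quot_def cnj_theta cnj_deriv_theta)

lemma deriv_theta_quot_cnj: "cnj (deriv theta_quot z) = deriv theta_quot (cnj z)"
proof -
  have d: "(theta_quot has_field_derivative deriv theta_quot z) (at z)" for z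
    using theta_quot_holomorphic[of UNIV] by (intro holomorphic_derivI) auto
  have "(cnj \<circ> theta_quot \<circ> cnj has_field_derivative cnj (deriv theta_quot z)) (at (cnj z))"
    using has_field_derivative_cnj_cnj[of theta_quot "deriv theta_quot z" "cnj z"] d[of z] by simp
  moreover have "cnj \<circ> theta_quot \<circ> cnj = theta_quot"
    by (auto simp: theta_quot_cnj)
  ultimately show ?thesis using d DERIV_unique by metis
qed

definition zeta_reg :: "complex \<Rightarrow> complex" where
  "zeta_reg z = deriv theta_quot z / theta_quot z"

lemma zeta_eq_reg:
  assumes "z \<notin> \<Lambda>"
  shows "zeta z = 1 / z + zeta_reg z"
proof -
  have "z \<noteq> 0" using assms by auto
  have d: "(theta_quot has_field_derivative deriv theta_quot z) (at z)"
    using theta_quot_holomorphic[of UNIV] by (intro holomorphic_derivI) auto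
  have "((\<lambda>z. z * theta_quot z) has_field_derivative theta_quot z + z * deriv theta_quot z) (at z)"
    by (rule derivative_eq_intros d refl)+ simp
  then have "deriv theta z = theta_quot z + z * deriv theta_quot z"
    unfolding theta_eq_quot[symmetric] by (rule DERIV_imp_deriv)
  moreover have "theta_quot z \<noteq> 0" using assms theta_quot_eq_0_iff by blast
  ultimately show ?thesis
    using \<open>z \<noteq> 0\<close> by (simp add: zeta_def zeta_reg_def theta_eq_quot[of z] divide_simps)
qed

lemma zeta_reg_holomorphic: "zeta_reg holomorphic_on - (\<Lambda> - {0})"
proof -
  have "deriv theta_quot holomorphic_on A" for A
    using holomorphic_deriv[OF theta_quot_holomorphic[of UNIV] open_UNIV] holomorphic_on_subset by blast
  then show ?thesis
    unfolding zeta_reg_def[abs_def]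
    by (intro holomorphic_on_divide theta_quot_holomorphic) (auto simp: theta_quot_eq_0_iff)
qed

text \<open>\<open>zeta_reg\<close> is real on the real axis and Lipschitz on the disc. The bound
  serves at the pole, where \<open>1 / z\<close> must be compared with the remainder uniformly in
  the direction of \<open>z\<close>.\<close>

lemma zeta_reg_Im_bound:
  obtains M where "\<And>x y. Complex x y \<in> cball 0 (rad / 2) \<Longrightarrow> \<bar>Im (zeta_reg (Complex x y))\<bar> \<le> M * \<bar>y\<bar>"
proof -
  have sub: "cball 0 (rad / 2) \<subseteq> ball 0 rad" using rad_pos by auto
  have ball: "ball 0 rad \<subseteq> - (\<Lambda> - {0})" using ball_rad_lattice by auto
  have hol: "zeta_reg holomorphic_on ball 0 rad"
    by (rule holomorphic_on_subset[OF zeta_reg_holomorphic ball])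
  have "compact (deriv zeta_reg ` cball 0 (rad / 2))"
    using holomorphic_on_imp_continuous_on[OF holomorphic_deriv[OF hol open_ball]] sub
    by (intro compact_continuous_image) (auto intro: continuous_on_subset)
  then obtain M where M: "\<And>z. z \<in> cball 0 (rad / 2) \<Longrightarrow> norm (deriv zeta_reg z) \<le> M"
    using compact_imp_bounded[THEN bounded_iff[THEN iffD1]] by (metis imageI)
  show ?thesis
  proof (rule that)
    fix x y assume z: "Complex x y \<in> cball 0 (rad / 2)"
    have x: "Complex x 0 \<in> cball 0 (rad / 2)"
    proof -
      have "norm (Complex x 0) = \<bar>x\<bar>" by (simp add: cmod_def)
      also have "\<dots> \<le> norm (Complex x y)" using abs_Re_le_cmod[of "Complex x y"] by simp
      finally show ?thesis using z by simp
    qed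
    have "norm (zeta_reg (Complex x y) - zeta_reg (Complex x 0)) \<le> M * norm (Complex x y - Complex x 0)"
    proof (rule field_differentiable_bound[where f' = "deriv zeta_reg"])
      show "(zeta_reg has_field_derivative deriv zeta_reg w) (at w within cball 0 (rad / 2))"
        if "w \<in> cball 0 (rad / 2)" for w
        by (rule has_field_derivative_at_within, rule holomorphic_derivI[OF hol open_ball])
           (use that sub in blast)
    next
      show "norm (deriv zeta_reg w) \<le> M" if "w \<in> cball 0 (rad / 2)" for w
        using M that by blast
    qed (rule convex_cball z x)+
    moreover have "norm (Complex x y - Complex x 0) = \<bar>y\<bar>" by (simp add: cmod_def complex_diff)
    moreover have "Im (zeta_reg (Complex x 0)) = 0"
    proof -
      have "cnj (zeta_reg (Complex x 0)) = zeta_reg (Complex x 0)"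
        unfolding zeta_reg_def complex_cnj_divide theta_quot_cnj deriv_theta_quot_cnj by (simp add: cnj_Complex_0)
      then show ?thesis by (simp add: complex_eq_iff)
    qed
    ultimately show "\<bar>Im (zeta_reg (Complex x y))\<bar> \<le> M * \<bar>y\<bar>"
      using abs_Im_le_cmod[of "zeta_reg (Complex x y) - zeta_reg (Complex x 0)"] by simp
  qed
qed

end

text \<open>The assumption says that \<open>1 / 2\<close> is a strict local maximum of the Green function in the
  imaginary direction.\<close>

locale long_rhombic_torus = rhombic_torus +
  assumes long: "Re (wp (1 / 2)) > 2 * pi / b"
begin

lemma wp_real_large:
  assumes "0 < x" "x \<le> 1 / 2"
  shows "Re (wp (Complex x 0)) > 2 * pi / b"
proof (cases "x = 1 / 2")
  case True
  then show ?thesis using long by (simp only: Complex_half_0)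
next
  case False
  then have "Re (wp (Complex (1 / 2) 0)) < Re (wp (Complex x 0))"
    using assms by (intro wp_real_strict_antimono) auto
  then show ?thesis using long by (simp only: Complex_half_0)
qed

text \<open>Away from the pole, \<open>vfun\<close> starts from 0 on the real axis with negative
  slope \<open>2 * pi / b - Re wp\<close>. Near the pole the term
  \<open>- y / (norm z)\<^sup>2\<close> beats everything that is of order \<open>y\<close>.\<close>

lemma vfun_neg_near_bottom:
  "\<exists>\<delta>>0. \<forall>x\<in>{0..1/2}. \<forall>y. 0 < y \<longrightarrow> y < \<delta> \<longrightarrow> vfun x y < 0"
proof (rule compact_edge_uniform)
  fix x0 :: real assume x0: "x0 \<in> {0..1/2}"
  show "\<exists>e>0. \<forall>x\<in>{0..1/2}. \<forall>y. \<bar>x - x0\<bar> < e \<longrightarrow> 0 < y \<longrightarrow> y < e \<longrightarrow> vfun x y < 0"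
  proof (cases "x0 = 0")
    case False
    then have x0p: "0 < x0" using x0 by simp
    have nl: "Complex x0 0 \<notin> \<Lambda>" using not_lattice_Re x0p x0 by simp
    define U where "U = {z \<in> - \<Lambda>. Re (wp z) > 2 * pi / b}"
    have "open U" unfolding U_def
    proof -
      have "open ((- \<Lambda>) \<inter> (\<lambda>z. Re (wp z)) -` {2 * pi / b<..})"
        by (intro continuous_open_preimage open_off_lattice continuous_intros continuous_on_wp) auto
      then show "open {z \<in> - \<Lambda>. Re (wp z) > 2 * pi / b}" by (simp add: vimage_def Int_def)
    qed
    moreover have "Complex x0 0 \<in> U" using nl wp_real_large x0p x0 by (simp add: U_def)
    ultimately obtain r where r: "r > 0" "ball (Complex x0 0) r \<subseteq> U" using open_contains_ball by blast
    have inU: "Complex x t \<in> U" if "\<bar>x - x0\<bar> < r / 2" "0 \<le> t" "t < r / 2" for x t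
    proof -
      have "norm (Complex x t - Complex x0 0) \<le> \<bar>x - x0\<bar> + \<bar>t\<bar>"
        using cmod_le[of "Complex x t - Complex x0 0"] by simp
      then have "Complex x t \<in> ball (Complex x0 0) r" using that by (simp add: dist_norm norm_minus_commute)
      then show ?thesis using r by blast
    qed
    have "vfun x y < 0" if xy: "\<bar>x - x0\<bar> < r / 2" "0 < y" "y < r / 2" for x y
    proof -
      have "vfun x y < vfun x 0"
      proof (rule DERIV_neg_imp_decreasing[OF xy(2)])
        fix t assume t: "0 \<le> t" "t \<le> y"
        then have "Complex x t \<in> U" using inU xy by simp
        then show "\<exists>d. (vfun x has_real_derivative d) (at t) \<and> d < 0"
          using vfun_DERIV[of x t] by (auto simp: U_def)
      qed
      then show ?thesis by (simp add: vfun_real_axis)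
    qed
    then show ?thesis using r by (intro exI[of _ "r / 2"]) auto
  next
    case True
    obtain M where M: "\<And>x y. Complex x y \<in> cball 0 (rad / 2) \<Longrightarrow> \<bar>Im (zeta_reg (Complex x y))\<bar> \<le> M * \<bar>y\<bar>"
      by (rule zeta_reg_Im_bound) blast
    define C where "C = \<bar>M\<bar> + 2 * pi / b + 1"
    have C: "C > 0" using b_pos by (simp add: C_def add_nonneg_pos)
    \<comment> \<open>From \<open>norm z < 2 * e\<close> follow both
      \<open>norm z \<le> rad / 2\<close>, needed for the Lipschitz bound, and
      \<open>1 / (norm z)\<^sup>2 > C\<close>.\<close>
    define e where "e = min (rad / 4) (1 / (2 * sqrt C))"
    have e: "e > 0" using rad_pos C by (simp add: e_def)
    have "vfun x y < 0" if xy: "\<bar>x - x0\<bar> < e" "0 < y" "y < e" for x y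
    proof -
      define z where "z = Complex x y"
      have z_le: "norm z < 2 * e" using cmod_le[of z] xy True by (simp add: z_def)
      then have zc: "z \<in> cball 0 (rad / 2)" by (simp add: e_def)
      have "z \<noteq> 0" using xy by (auto simp: z_def complex_eq_iff)
      then have nl: "z \<notin> \<Lambda>" using ball_rad_lattice[of z] z_le rad_pos by (simp add: e_def)
      have n: "norm z > 0" using \<open>z \<noteq> 0\<close> by simp
      have "norm z < 1 / sqrt C" using z_le by (simp add: e_def)
      then have "(norm z)\<^sup>2 < (1 / sqrt C)\<^sup>2" by (intro power_strict_mono) auto
      then have "(norm z)\<^sup>2 < 1 / C" using C by (simp add: power_divide)
      then have "C < 1 / (norm z)\<^sup>2" using C n by (simp add: field_simps)
      then have Cy: "C * y < 1 / (norm z)\<^sup>2 * y" using xy by (intro mult_strict_right_mono) auto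
      have "Im (1 / z) = - y / (norm z)\<^sup>2"
        by (simp add: Im_divide z_def cmod_def)
      then have "vfun x y = - y / (norm z)\<^sup>2 + Im (zeta_reg z) + 2 * pi * y / b"
        using vfun_off[of x y] zeta_eq_reg[OF nl] nl by (simp add: z_def)
      also have "\<dots> \<le> - y / (norm z)\<^sup>2 + \<bar>M\<bar> * y + 2 * pi * y / b"
      proof -
        have "Im (zeta_reg z) \<le> M * \<bar>y\<bar>" using M[of x y] zc by (simp add: z_def abs_le_iff)
        also have "\<dots> \<le> \<bar>M\<bar> * y" using xy by (simp add: mult_right_mono)
        finally show ?thesis by simp
      qed
      also have "\<dots> = (C - 1) * y - 1 / (norm z)\<^sup>2 * y" by (simp add: C_def algebra_simps)
      also have "\<dots> < 0" using Cy xy by (simp add: algebra_simps)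
      finally show ?thesis .
    qed
    then show ?thesis using e by blast
  qed
qed auto

text \<open>Inside the strip, with \<open>t = 1 / (wp p - wp (\<i> * y))\<close>, the function is up
  to a positive factor a real quadratic polynomial in \<open>t\<close> with leading coefficient
  \<open>\<gamma> \<ge> 0\<close>, hence convex in \<open>t\<close>. As \<open>t\<close> increases
  with \<open>y\<close>, quasiconvexity in \<open>y\<close> remains. On the boundary lines
  \<open>p = 0\<close> and \<open>p = 1/2\<close> the function is monotone.\<close>

lemma Re_wp_vertical_quasiconvex:
  assumes p: "0 \<le> p" "p \<le> 1 / 2" and y: "0 < y1" "y1 < y2" "y2 < y3" "y3 < b"
    and lt: "Re (wp (Complex p y1)) < m" "Re (wp (Complex p y3)) < m"
  shows "Re (wp (Complex p y2)) < m"
proof -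
  consider "p = 0" | "p = 1 / 2" | "0 < p" "p < 1 / 2" using p by linarith
  then show ?thesis
  proof cases
    case 1
    then show ?thesis using wp_imaginary_strict_mono[of y2 y3] y lt by simp
  next
    case 2
    have eq: "wp (Complex (1 / 2) t) = wp (Complex 0 (b - t))" for t
    proof -
      have "Complex (1 / 2) t = - Complex 0 (b - t) + tau" by (simp add: complex_eq_iff)
      then show ?thesis by (simp only: wp_lattice[OF lattice_tau] wp_uminus)
    qed
    show ?thesis using wp_imaginary_strict_mono[of "b - y2" "b - y1"] y lt unfolding 2 eq by simp
  next
    case 3
    define P where "P = Complex p 0"
    have P: "P \<notin> \<Lambda>" using not_lattice_Re 3 by (simp add: P_def)
    obtain \<alpha> \<beta> where id: "\<And>z. z \<notin> \<Lambda> \<Longrightarrow> z + P \<notin> \<Lambda> \<Longrightarrow> z - P \<notin> \<Lambda> \<Longrightarrow>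
      (wp_scale P)\<^sup>2 * (wp z - wp P)\<^sup>2 * (wp (z + P) + wp (z - P)) =
      \<alpha> * (wp z - wp P)\<^sup>2 + \<beta> * (wp z - wp P) + (theta (2 * P))\<^sup>2 * (deriv theta 0)\<^sup>2 / theta P ^ 4"
      using wp_sum_quadratic[OF P] by metis
    have real: "\<exists>r. theta (Complex t 0) = of_real r" for t
    proof -
      have "cnj (theta (Complex t 0)) = theta (Complex t 0)" unfolding cnj_theta by (simp add: cnj_Complex_0)
      then show ?thesis by (metis Reals_cnj_iff Reals_cases)
    qed
    have real': "\<exists>r. deriv theta 0 = of_real r"
    proof -
      have "cnj (deriv theta 0) = deriv theta 0" unfolding cnj_deriv_theta by simp
      then show ?thesis by (metis Reals_cnj_iff Reals_cases)
    qed
    obtain r1 r2 r3 where r: "theta P = of_real r1" "theta (2 * P) = of_real r2" "deriv theta 0 = of_real r3"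
      using real[of p] real[of "2 * p"] real' by (auto simp: P_def Complex_eq)
    have r1: "r1 \<noteq> 0" and r3: "r3 \<noteq> 0" using r P deriv_theta_0 theta_eq_0_iff[of P] by auto
    define K where "K = (r1\<^sup>2 / r3\<^sup>2)\<^sup>2"
    define \<gamma> where "\<gamma> = r2\<^sup>2 * r3\<^sup>2 / r1 ^ 4"
    have K: "K > 0" and \<gamma>: "\<gamma> \<ge> 0" using r1 r3 by (simp_all add: K_def \<gamma>_def)
    have scale: "(wp_scale P)\<^sup>2 = of_real K" by (simp add: wp_scale_def r K_def)
    have gam: "(theta (2 * P))\<^sup>2 * (deriv theta 0)\<^sup>2 / theta P ^ 4 = of_real \<gamma>" by (simp add: r \<gamma>_def)
    define c where "c = Re (wp P)"
    define X where "X = (\<lambda>y. Re (wp (Complex 0 y)))"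
    have wpP: "wp P = of_real c" using Im_wp_real[of p] by (simp add: c_def P_def complex_eq_iff)
    have wpX: "wp (Complex 0 y) = of_real (X y)" for y
      using Im_wp_imaginary[of y] by (simp add: X_def complex_eq_iff)
    \<comment> \<open>\<open>wp\<close> increases along the imaginary axis up to
      \<open>wp (1/2)\<close> and then along the real axis from \<open>1/2\<close> down to
      \<open>p\<close>; hence \<open>t\<close> below is positive.\<close>
    have Xc: "X y < c" if "0 < y" "y < b" for y
    proof -
      have "X y < X b" using wp_imaginary_strict_mono[of y b] that by (simp add: X_def)
      also have "X b = Re (wp (Complex (1 / 2) 0))" by (simp add: X_def wp_imaginary_b Complex_half_0)
      also have "\<dots> < c" using wp_real_strict_antimono[of p "1 / 2"] 3 by (simp add: c_def P_def)
      finally show ?thesis .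
    qed
    define t where "t = (\<lambda>y. 1 / (c - X y))"
    have key: "2 * K * Re (wp (Complex p y)) = Re \<alpha> - Re \<beta> * t y + \<gamma> * (t y)\<^sup>2" if yb: "0 < y" "y < b" for y
    proof -
      define z where "z = Complex 0 y"
      have zs: "z + P = Complex p y" "z - P = Complex (- p) y" by (simp_all add: z_def P_def complex_eq_iff)
      have off: "z \<notin> \<Lambda>" "z + P \<notin> \<Lambda>" "z - P \<notin> \<Lambda>"
        unfolding zs unfolding z_def by (rule not_lattice_Im[OF yb])+
      have "z - P = - cnj (z + P)" by (simp add: zs complex_eq_iff)
      then have "wp (z - P) = cnj (wp (z + P))" by (simp only: wp_neg_cnj)
      then have sum: "wp (z + P) + wp (z - P) = of_real (2 * Re (wp (Complex p y)))"
        by (simp add: zs complex_eq_iff)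
      have "(wp_scale P)\<^sup>2 * (wp z - wp P)\<^sup>2 * (wp (z + P) + wp (z - P)) =
        \<alpha> * (wp z - wp P)\<^sup>2 + \<beta> * (wp z - wp P) + (theta (2 * P))\<^sup>2 * (deriv theta 0)\<^sup>2 / theta P ^ 4"
        by (rule id[OF off])
      moreover have "wp z - wp P = of_real (X y - c)" by (simp add: z_def wpX wpP)
      ultimately have "complex_of_real (K * (X y - c)\<^sup>2 * (2 * Re (wp (Complex p y)))) =
        \<alpha> * of_real ((X y - c)\<^sup>2) + \<beta> * of_real (X y - c) + of_real \<gamma>"
        unfolding sum scale gam by simp
      from arg_cong[OF this, of Re]
      have "K * (X y - c)\<^sup>2 * (2 * Re (wp (Complex p y))) =
        Re \<alpha> * (X y - c)\<^sup>2 + Re \<beta> * (X y - c) + \<gamma>" by simp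
      moreover have "X y - c = - (1 / t y)" using Xc[OF yb] by (simp add: t_def)
      moreover have "t y > 0" using Xc[OF yb] by (simp add: t_def)
      ultimately show ?thesis
        by (simp add: field_simps power2_eq_square)
    qed
    have t_mono: "t u < t v" if "0 < u" "u < v" "v < b" for u v
      using Xc[of u] Xc[of v] wp_imaginary_strict_mono[of u v] that
      by (auto simp: t_def X_def intro!: divide_strict_left_mono mult_pos_pos)
    define q where "q = (\<lambda>s. Re \<alpha> - Re \<beta> * s + \<gamma> * s\<^sup>2)"
    have t12: "t y1 < t y2" and t23: "t y2 < t y3" using t_mono y by auto
    \<comment> \<open>Convexity as an exact identity: the defect is \<open>\<gamma>\<close> times
      the product of the three differences.\<close>
    have "(t y3 - t y1) * q (t y2) \<le> (t y3 - t y2) * q (t y1) + (t y2 - t y1) * q (t y3)"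
    proof -
      have "(t y3 - t y2) * q (t y1) + (t y2 - t y1) * q (t y3) - (t y3 - t y1) * q (t y2)
        = \<gamma> * ((t y3 - t y1) * (t y2 - t y1) * (t y3 - t y2))"
        unfolding q_def by (simp add: power2_eq_square algebra_simps)
      moreover have "0 \<le> \<gamma> * ((t y3 - t y1) * (t y2 - t y1) * (t y3 - t y2))"
        using \<gamma> t12 t23 by (intro mult_nonneg_nonneg) auto
      ultimately show ?thesis by linarith
    qed
    also have "\<dots> < (t y3 - t y2) * (2 * K * m) + (t y2 - t y1) * (2 * K * m)"
    proof -
      have "q (t y1) < 2 * K * m" "q (t y3) < 2 * K * m"
        using key[of y1] key[of y3] y lt K by (simp_all add: q_def flip: key)
      then show ?thesis using t12 t23 by (intro add_strict_mono mult_strict_left_mono) auto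
    qed
    also have "\<dots> = (t y3 - t y1) * (2 * K * m)" by (simp add: algebra_simps)
    finally have "q (t y2) < 2 * K * m" using t12 t23 by (subst (asm) mult_less_cancel_left_pos) auto
    then have "2 * K * Re (wp (Complex p y2)) < 2 * K * m" using key[of y2] y by (simp add: q_def)
    then show ?thesis using K by simp
  qed
qed

lemma vfun_pos_near_top:
  "\<exists>\<delta>>0. \<forall>x\<in>{0..1/2}. \<forall>y. b - \<delta> < y \<longrightarrow> y < b \<longrightarrow> vfun x y > 0"
proof -
  obtain \<delta> where \<delta>: "\<delta> > 0" "\<And>x y. x \<in> {0..1/2} \<Longrightarrow> 0 < y \<Longrightarrow> y < \<delta> \<Longrightarrow> vfun x y < 0"
    using vfun_neg_near_bottom by blast
  have "vfun x y > 0" if "x \<in> {0..1/2}" "b - \<delta> < y" "y < b" for x y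
    using \<delta>(2)[of "1 / 2 - x" "b - y"] vfun_reflect[of x y] that by auto
  then show ?thesis using \<delta>(1) by blast
qed

text \<open>\<open>vfun\<close> is negative near the bottom and positive near the top, so the mean
  value theorem yields points below and above the zero with positive slope; quasiconvexity carries
  this to the zero between them.\<close>

lemma vfun_zero_slope:
  assumes p: "0 \<le> p" "p \<le> 1 / 2" and y: "0 < y" "y < b" and z: "vfun p y = 0"
  shows "Re (wp (Complex p y)) < 2 * pi / b"
proof -
  obtain \<delta>1 where \<delta>1: "\<delta>1 > 0" "\<And>y. 0 < y \<Longrightarrow> y < \<delta>1 \<Longrightarrow> vfun p y < 0"
    using vfun_neg_near_bottom p by auto
  obtain \<delta>2 where \<delta>2: "\<delta>2 > 0" "\<And>y. b - \<delta>2 < y \<Longrightarrow> y < b \<Longrightarrow> vfun p y > 0"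
    using vfun_pos_near_top p by auto
  define u where "u = min (\<delta>1 / 2) (y / 2)"
  define v where "v = max (b - \<delta>2 / 2) ((y + b) / 2)"
  have u: "0 < u" "u < y" "vfun p u < 0" using \<delta>1 y by (auto simp: u_def min_less_iff_disj)
  have v: "y < v" "v < b" "vfun p v > 0" using \<delta>2 y by (auto simp: v_def less_max_iff_disj)
  have D: "(vfun p has_real_derivative 2 * pi / b - Re (wp (Complex p t))) (at t)" if "0 < t" "t < b" for t
    using that not_lattice_Im by (intro vfun_DERIV) auto
  obtain s1 where s1: "u < s1" "s1 < y" "vfun p y - vfun p u = (y - u) * (2 * pi / b - Re (wp (Complex p s1)))"
    using MVT2[of u y "vfun p" "\<lambda>t. 2 * pi / b - Re (wp (Complex p t))"] D u y by auto
  obtain s2 where s2: "y < s2" "s2 < v" "vfun p v - vfun p y = (v - y) * (2 * pi / b - Re (wp (Complex p s2)))"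
    using MVT2[of y v "vfun p" "\<lambda>t. 2 * pi / b - Re (wp (Complex p t))"] D v y by auto
  have "0 < (y - u) * (2 * pi / b - Re (wp (Complex p s1)))" using s1(3) u z by simp
  then have "Re (wp (Complex p s1)) < 2 * pi / b" using u by (simp add: zero_less_mult_iff)
  moreover have "0 < (v - y) * (2 * pi / b - Re (wp (Complex p s2)))" using s2(3) v z by simp
  then have "Re (wp (Complex p s2)) < 2 * pi / b" using v by (simp add: zero_less_mult_iff)
  ultimately show ?thesis
    using Re_wp_vertical_quasiconvex[of p s1 y s2] p u v s1 s2 by auto
qed

text \<open>The slope is positive at both zeros, hence by quasiconvexity on the whole segment
  between them, and \<open>vfun\<close> could not return to 0.\<close>

lemma vfun_zero_unique:
  assumes p: "0 \<le> p" "p \<le> 1 / 2" and u: "0 < u" "u < b" "vfun p u = 0" and v: "0 < v" "v < b" "vfun p v = 0"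
  shows "u = v"
proof -
  have False if u: "0 < u" "u < b" "vfun p u = 0" and v: "0 < v" "v < b" "vfun p v = 0" and "u < v" for u v
  proof -
    have "vfun p u < vfun p v"
    proof (rule DERIV_pos_imp_increasing[OF \<open>u < v\<close>])
      fix t assume t: "u \<le> t" "t \<le> v"
      have "Re (wp (Complex p t)) < 2 * pi / b"
        using vfun_zero_slope[OF p u] vfun_zero_slope[OF p v] Re_wp_vertical_quasiconvex[of p u t v "2 * pi / b"] p u v t
        by (cases "t = u"; cases "t = v") auto
      then show "\<exists>d. (vfun p has_real_derivative d) (at t) \<and> d > 0"
        using vfun_DERIV[of p t] not_lattice_Im[of t p] t u v by auto
    qed
    then show False using u v by simp
  qed
  from this[OF u v] this[OF v u] show ?thesis using linorder_less_linear[of u v] by blast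
qed

lemma vfun_zero_exists:
  assumes p: "0 \<le> p" "p \<le> 1 / 2"
  shows "\<exists>y. 0 < y \<and> y < b \<and> vfun p y = 0"
proof -
  obtain \<delta>1 where \<delta>1: "\<delta>1 > 0" "\<And>y. 0 < y \<Longrightarrow> y < \<delta>1 \<Longrightarrow> vfun p y < 0"
    using vfun_neg_near_bottom p by auto
  obtain \<delta>2 where \<delta>2: "\<delta>2 > 0" "\<And>y. b - \<delta>2 < y \<Longrightarrow> y < b \<Longrightarrow> vfun p y > 0"
    using vfun_pos_near_top p by auto
  define u where "u = min (\<delta>1 / 2) (b / 4)"
  define v where "v = max (b - \<delta>2 / 2) (b / 2)"
  have u: "0 < u" "u < v" "vfun p u < 0" using \<delta>1 b_pos by (auto simp: u_def v_def)
  have v: "v < b" "vfun p v > 0" using \<delta>2 b_pos by (auto simp: v_def)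
  have "\<exists>x. u \<le> x \<and> x \<le> v \<and> vfun p x = 0"
    using u v by (intro IVT' vfun_continuous_on not_lattice_Im) auto
  then obtain x where "u \<le> x" "x \<le> v" "vfun p x = 0" by blast
  then show ?thesis using u v by (intro exI[of _ x]) auto
qed

section \<open>The critical curve\<close>

definition crit_y :: "real \<Rightarrow> real" where
  "crit_y p = (THE y. 0 < y \<and> y < b \<and> vfun p y = 0)"

lemma crit_y_unique:
  assumes "0 \<le> p" "p \<le> 1 / 2"
  shows "0 < y \<and> y < b \<and> vfun p y = 0 \<longleftrightarrow> y = crit_y p"
proof -
  have "\<exists>!y. 0 < y \<and> y < b \<and> vfun p y = 0"
    using vfun_zero_exists vfun_zero_unique assms by blast
  from theI'[OF this] show ?thesis
    unfolding crit_y_def[symmetric] using vfun_zero_unique[OF assms] by blast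
qed

lemma crit_y:
  assumes "0 \<le> p" "p \<le> 1 / 2"
  shows "0 < crit_y p" "crit_y p < b" "vfun p (crit_y p) = 0"
    "Re (wp (Complex p (crit_y p))) < 2 * pi / b"
  using crit_y_unique[OF assms] vfun_zero_slope[OF assms] by auto

text \<open>The graph is compact and the projection to the parameter is injective on it; the inverse
  of such a projection is continuous.\<close>

lemma continuous_on_crit_y: "continuous_on {0..1/2} crit_y"
proof -
  obtain \<delta>1 where \<delta>1: "\<delta>1 > 0" "\<And>x y. x \<in> {0..1/2} \<Longrightarrow> 0 < y \<Longrightarrow> y < \<delta>1 \<Longrightarrow> vfun x y < 0"
    using vfun_neg_near_bottom by blast
  obtain \<delta>2 where \<delta>2: "\<delta>2 > 0" "\<And>x y. x \<in> {0..1/2} \<Longrightarrow> b - \<delta>2 < y \<Longrightarrow> y < b \<Longrightarrow> vfun x y > 0"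
    using vfun_pos_near_top by blast
  \<comment> \<open>The collars near bottom and top contain no zeros, so cutting them off loses
    nothing, and the remaining compact rectangle avoids the lattice.\<close>
  define B :: "(real \<times> real) set" where "B = {0..1/2} \<times> {\<delta>1..b - \<delta>2}"
  have off: "Complex (fst u) (snd u) \<notin> \<Lambda>" if "u \<in> B" for u :: "real \<times> real"
    using that \<delta>1 \<delta>2 by (intro not_lattice_Im) (auto simp: B_def)
  define w where "w = (\<lambda>u. Im (zeta (Complex (fst u) (snd u))) + 2 * pi * snd u / b)"
  have w: "w u = vfun (fst u) (snd u)" if "u \<in> B" for u
    using vfun_off[OF off[OF that]] by (simp add: w_def)
  have "continuous_on B w"
    unfolding w_def Complex_eq
    by (intro continuous_intros continuous_on_compose2[OF holomorphic_on_imp_continuous_on[OF zeta_holomorphic]])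
       (use off b_pos in \<open>auto simp: Complex_eq\<close>)
  then have "closed {u \<in> B. w u = 0}"
    by (intro continuous_closed_preimage_constant) (auto simp: B_def closed_Times)
  moreover have "bounded {u \<in> B. w u = 0}"
    by (rule bounded_subset[of B]) (auto simp: B_def bounded_Times)
  ultimately have cpt: "compact {u \<in> B. w u = 0}" by (simp add: compact_eq_bounded_closed)
  have eq: "{u \<in> B. w u = 0} = (\<lambda>p. (p, crit_y p)) ` {0..1/2}"
  proof (intro set_eqI iffI)
    fix u assume u: "u \<in> {u \<in> B. w u = 0}"
    then have "fst u \<in> {0..1/2}" "0 < snd u" "snd u < b" using \<delta>1 \<delta>2 by (auto simp: B_def)
    moreover have "vfun (fst u) (snd u) = 0" using u w[of u] by simp
    ultimately have "snd u = crit_y (fst u)" using crit_y_unique[of "fst u" "snd u"] by auto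
    then have "u = (fst u, crit_y (fst u))" by (simp add: prod_eq_iff)
    then show "u \<in> (\<lambda>p. (p, crit_y p)) ` {0..1/2}" using \<open>fst u \<in> {0..1/2}\<close> by (rule image_eqI)
  next
    fix u assume "u \<in> (\<lambda>p. (p, crit_y p)) ` {0..1/2}"
    then obtain p where p: "p \<in> {0..1/2}" "u = (p, crit_y p)" by blast
    have "u \<in> B" using crit_y[of p] \<delta>1(2)[of p "crit_y p"] \<delta>2(2)[of p "crit_y p"] p by (force simp: B_def)
    then show "u \<in> {u \<in> B. w u = 0}" using w[of u] crit_y[of p] p by auto
  qed
  have "continuous_on (fst ` {u \<in> B. w u = 0}) (\<lambda>p. (p, crit_y p))"
    by (rule continuous_on_inv[OF _ cpt]) (auto simp: eq intro!: continuous_intros)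
  moreover have "fst ` {u \<in> B. w u = 0} = {0..1/2}" unfolding eq by force
  ultimately have "continuous_on {0..1/2} (\<lambda>p. snd (p, crit_y p))"
    by (intro continuous_on_snd) simp
  then show ?thesis by simp
qed

lemma crit_y_quarter: "crit_y (1 / 4) = b / 2"
proof -
  have "Complex (1 / 4) (b / 2) = tau / 2" by (simp add: complex_eq_iff)
  then have "vfun (1 / 4) (b / 2) = 0"
    using hecke_half_period[of "tau / 2"] unfolding vfun_def by (simp only:) simp
  then show ?thesis using crit_y_unique[of "1 / 4" "b / 2"] b_pos by auto
qed

end

subsection \<open>Degenerate parameters\<close>

context long_rhombic_torus
begin

definition crit_pt :: "real \<Rightarrow> complex" where
  "crit_pt p = Complex p (crit_y p)"

lemma continuous_on_crit_pt: "continuous_on {0..1/2} crit_pt"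
  unfolding crit_pt_def[abs_def] Complex_eq by (intro continuous_intros continuous_on_crit_y)

lemma crit_pt_off_lattice: "p \<in> {0..1/2} \<Longrightarrow> crit_pt p \<notin> \<Lambda>"
  using crit_y[of p] not_lattice_Im[of "crit_y p" p] by (simp add: crit_pt_def)

text \<open>Taken on the closed interval, so that an accumulation at \<open>0\<close> or
  \<open>1/2\<close> is also caught.\<close>

definition degenerate_set :: "real set" where
  "degenerate_set = {p \<in> {0..1/2}. Re (wp (crit_pt p)) = 0}"

text \<open>The primitive \<open>F = zeta + 2 \<pi> z / b\<close> of \<open>2 \<pi> / b - wp\<close> is real exactly on the critical
  curve and locally invertible there, so degeneracy along the curve is a real-analytic condition
  in the parameter \<open>F\<close>.\<close>

lemma degenerate_set_islimpt:
  assumes p0: "p0 \<in> {0..1/2}" and lim: "p0 islimpt degenerate_set"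
  shows "\<exists>\<epsilon>>0. \<forall>p\<in>{0..1/2}. \<bar>p - p0\<bar> < \<epsilon> \<longrightarrow> p \<in> degenerate_set"
proof -
  define F where "F = (\<lambda>z. zeta z + of_real (2 * pi / b) * z)"
  define z0 where "z0 = crit_pt p0"
  have z0: "z0 \<in> - \<Lambda>" using crit_pt_off_lattice p0 by (simp add: z0_def)
  have F_hol: "F holomorphic_on - \<Lambda>"
    unfolding F_def by (intro holomorphic_intros zeta_holomorphic)
  have "(F has_field_derivative - wp z0 + of_real (2 * pi / b)) (at z0)"
    unfolding F_def by (rule derivative_eq_intros zeta_DERIV refl | use z0 in simp)+
  then have "deriv F z0 = - wp z0 + of_real (2 * pi / b)" by (rule DERIV_imp_deriv)
  moreover have "Re (wp z0) < 2 * pi / b" using crit_y(4)[of p0] p0 by (simp add: z0_def crit_pt_def)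
  \<comment> \<open>The strict upcrossing once more: the real part of \<open>deriv F\<close> is the
    slope of \<open>vfun\<close> at the zero.\<close>
  ultimately have "Re (deriv F z0) > 0" by simp
  then have "deriv F z0 \<noteq> 0" by auto
  then obtain r where r: "r > 0" "ball z0 r \<subseteq> - \<Lambda>" "open (F ` ball z0 r)" "inj_on F (ball z0 r)"
    using has_complex_derivative_locally_invertible[OF F_hol z0 open_off_lattice] by blast
  obtain g where g: "g holomorphic_on (F ` ball z0 r)" "\<And>z. z \<in> ball z0 r \<Longrightarrow> g (F z) = z"
    using holomorphic_has_inverse[OF holomorphic_on_subset[OF F_hol r(2)] open_ball r(4)] by metis
  define s0 where "s0 = F z0"
  have F_real: "F (crit_pt p) = of_real (Re (F (crit_pt p)))" if "p \<in> {0..1/2}" for p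
  proof -
    have "Im (F (crit_pt p)) = vfun p (crit_y p)"
      using vfun_off crit_pt_off_lattice[OF that] by (simp add: F_def crit_pt_def)
    then show ?thesis using crit_y(3)[of p] that by (simp add: complex_eq_iff)
  qed
  have "s0 \<in> F ` ball z0 r" using r by (simp add: s0_def)
  then obtain \<rho> where \<rho>: "\<rho> > 0" "ball s0 \<rho> \<subseteq> F ` ball z0 r" using r(3) open_contains_ball by blast
  have cnj_ball: "cnj s \<in> ball s0 \<rho>" if "s \<in> ball s0 \<rho>" for s
  proof -
    have "cnj s0 = s0" using F_real[OF p0] by (metis z0_def s0_def complex_cnj_complex_of_real)
    then have "s0 - cnj s = cnj (s0 - s)" by simp
    then have "dist s0 (cnj s) = dist s0 s" by (simp only: dist_norm complex_mod_cnj)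
    then show ?thesis using that by simp
  qed
  have g_ball: "g s \<in> ball z0 r" if s: "s \<in> ball s0 \<rho>" for s
  proof -
    obtain z where "z \<in> ball z0 r" "s = F z" using subsetD[OF \<rho>(2) s] by (rule imageE)
    then show ?thesis using g(2)[of z] by simp
  qed
  \<comment> \<open>Schwarz reflection: the sum is holomorphic in \<open>s\<close> and equals
    \<open>2 * Re (wp (g s))\<close> at real \<open>s\<close>, whereas the real part alone is not
    holomorphic.\<close>
  define D where "D = (\<lambda>s. wp (g s) + cnj (wp (g (cnj s))))"
  have wpg: "(\<lambda>s. wp (g s)) holomorphic_on ball s0 \<rho>"
  proof -
    have "(wp \<circ> g) holomorphic_on ball s0 \<rho>"
      by (rule holomorphic_on_compose_gen[OF holomorphic_on_subset[OF g(1) \<rho>(2)] wp_holomorphic])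
         (use g_ball r(2) in blast)
    then show ?thesis by (simp add: o_def)
  qed
  have "(\<lambda>s. cnj (wp (g (cnj s)))) holomorphic_on ball s0 \<rho>"
  proof -
    have "((cnj \<circ> (\<lambda>s. wp (g s)) \<circ> cnj) has_field_derivative cnj (deriv (\<lambda>s. wp (g s)) (cnj s))) (at s)"
      if "s \<in> ball s0 \<rho>" for s
      by (rule has_field_derivative_cnj_cnj) (rule holomorphic_derivI[OF wpg open_ball cnj_ball[OF that]])
    then show ?thesis
      unfolding o_def holomorphic_on_open[OF open_ball] by blast
  qed
  then have D_hol: "D holomorphic_on ball s0 \<rho>"
    unfolding D_def by (intro holomorphic_intros wpg)
  have cont: "continuous_on {0..1/2} (\<lambda>p. F (crit_pt p))"
    by (rule continuous_on_compose2[OF holomorphic_on_imp_continuous_on[OF F_hol] continuous_on_crit_pt])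
       (use crit_pt_off_lattice in auto)
  obtain \<epsilon>1 where \<epsilon>1: "\<epsilon>1 > 0" "\<And>p. p \<in> {0..1/2} \<Longrightarrow> dist p p0 < \<epsilon>1 \<Longrightarrow> dist (F (crit_pt p)) s0 < \<rho>"
    using cont[unfolded continuous_on_iff, rule_format, OF p0 \<rho>(1)] by (auto simp: s0_def z0_def)
  obtain \<epsilon>2 where \<epsilon>2: "\<epsilon>2 > 0" "\<And>p. p \<in> {0..1/2} \<Longrightarrow> dist p p0 < \<epsilon>2 \<Longrightarrow> dist (crit_pt p) z0 < r"
    using continuous_on_crit_pt[unfolded continuous_on_iff, rule_format, OF p0 r(1)] by (auto simp: z0_def)
  define \<epsilon> where "\<epsilon> = min \<epsilon>1 \<epsilon>2"
  have \<epsilon>: "\<epsilon> > 0" using \<epsilon>1 \<epsilon>2 by (simp add: \<epsilon>_def)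
  have inb: "F (crit_pt p) \<in> ball s0 \<rho>" and ginv: "g (F (crit_pt p)) = crit_pt p"
    and Dp: "D (F (crit_pt p)) = of_real (2 * Re (wp (crit_pt p)))"
    if p: "p \<in> {0..1/2}" "dist p p0 < \<epsilon>" for p
  proof -
    show "F (crit_pt p) \<in> ball s0 \<rho>" using \<epsilon>1 p by (simp add: \<epsilon>_def dist_commute)
    have "crit_pt p \<in> ball z0 r" using \<epsilon>2 p by (simp add: \<epsilon>_def dist_commute)
    then show gp: "g (F (crit_pt p)) = crit_pt p" by (rule g)
    have cF: "cnj (F (crit_pt p)) = F (crit_pt p)" using F_real[OF p(1)] by (metis complex_cnj_complex_of_real)
    then show "D (F (crit_pt p)) = of_real (2 * Re (wp (crit_pt p)))"
      unfolding D_def cF gp by (simp add: complex_eq_iff)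
  qed
  define U where "U = (\<lambda>p. F (crit_pt p)) ` {p \<in> degenerate_set. dist p p0 < \<epsilon>}"
  have "s0 islimpt U"
    unfolding islimpt_approachable
  proof (intro allI impI)
    fix e :: real assume "e > 0"
    then obtain d where d: "d > 0" "\<And>p. p \<in> {0..1/2} \<Longrightarrow> dist p p0 < d \<Longrightarrow> dist (F (crit_pt p)) s0 < e"
      using cont[unfolded continuous_on_iff, rule_format, OF p0 \<open>e > 0\<close>] by (auto simp: s0_def z0_def)
    obtain p where p: "p \<in> degenerate_set" "p \<noteq> p0" "dist p p0 < min d \<epsilon>"
      using lim[unfolded islimpt_approachable, rule_format, of "min d \<epsilon>"] d(1) \<epsilon> by auto
    have pI: "p \<in> {0..1/2}" using p by (simp add: degenerate_set_def)
    \<comment> \<open>Local injectivity of \<open>F\<close> keeps the images of distinct parameters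
      distinct, so that \<open>s0\<close> is a genuine accumulation point.\<close>
    have "F (crit_pt p) \<noteq> s0"
    proof
      assume "F (crit_pt p) = s0"
      then have "g (F (crit_pt p)) = g (F (crit_pt p0))" by (simp only: s0_def z0_def)
      moreover have "g (F (crit_pt p)) = crit_pt p" by (rule ginv[OF pI]) (use p in simp)
      moreover have "g (F (crit_pt p0)) = crit_pt p0" by (rule ginv[OF p0]) (use \<epsilon> in simp)
      ultimately have "crit_pt p = crit_pt p0" by metis
      then show False using p by (simp add: crit_pt_def)
    qed
    then show "\<exists>x'\<in>U. x' \<noteq> s0 \<and> dist x' s0 < e"
      using p d(2)[OF pI] by (intro bexI[of _ "F (crit_pt p)"]) (simp_all add: U_def)
  qed
  moreover have "U \<subseteq> ball s0 \<rho>" using inb by (auto simp: U_def degenerate_set_def)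
  moreover have "D s = 0" if "s \<in> U" for s
    using that Dp by (auto simp: U_def degenerate_set_def)
  ultimately have D0: "D s = 0" if "s \<in> ball s0 \<rho>" for s
    using analytic_continuation[OF D_hol open_ball _ _ centre_in_ball[THEN iffD2, OF \<rho>(1)] _ _ that, of U] by auto
  have "p \<in> degenerate_set" if p: "p \<in> {0..1/2}" "\<bar>p - p0\<bar> < \<epsilon>" for p
  proof -
    have "dist p p0 < \<epsilon>" using p by (simp add: dist_real_def)
    then have "complex_of_real (2 * Re (wp (crit_pt p))) = 0" using Dp D0 inb p by metis
    then show ?thesis using p by (simp add: degenerate_set_def)
  qed
  then show ?thesis using \<epsilon> by blast
qed

text \<open>The accumulation points form a closed set, which is also open in the interval by
  analyticity. Connectedness would spread degeneracy to \<open>1/4\<close>, against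
  \<open>Re_wp_half_tau_pos\<close>.\<close>

lemma finite_degenerate_set: "finite degenerate_set"
proof (rule ccontr)
  assume inf: "infinite degenerate_set"
  define A where "A = {p \<in> {0..1/2}. p islimpt degenerate_set}"
  have sub: "degenerate_set \<subseteq> {0..1/2}" by (auto simp: degenerate_set_def)
  have "compact {0..1/2::real}" by simp
  then obtain p1 where p1: "p1 \<in> {0..1/2}" "p1 islimpt degenerate_set"
    using inf sub Heine_Borel_imp_Bolzano_Weierstrass by blast
  have open_A: "openin (top_of_set {0..1/2}) A"
    unfolding openin_euclidean_subtopology_iff
  proof (intro conjI ballI)
    show "A \<subseteq> {0..1/2}" by (auto simp: A_def)
    fix p0 assume "p0 \<in> A"
    then obtain \<epsilon> where \<epsilon>: "\<epsilon> > 0" "\<And>p. p \<in> {0..1/2} \<Longrightarrow> \<bar>p - p0\<bar> < \<epsilon> \<Longrightarrow> p \<in> degenerate_set"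
      using degenerate_set_islimpt[of p0] unfolding A_def by blast
    have "p islimpt degenerate_set" if p: "p \<in> {0..1/2}" "dist p p0 < \<epsilon>" for p
      unfolding islimpt_approachable
    proof (intro allI impI)
      fix e :: real assume "e > 0"
      \<comment> \<open>Step to a second degenerate point near \<open>p\<close>. The bound
        \<open>1/8\<close> keeps it in the interval when moving right from below \<open>1/4\<close>
        and left otherwise.\<close>
      define d where "d = min (1 / 8) (min (e / 2) ((\<epsilon> - \<bar>p - p0\<bar>) / 2))"
      have "\<bar>p - p0\<bar> < \<epsilon>" using p by (simp add: dist_real_def)
      moreover have "d \<le> (\<epsilon> - \<bar>p - p0\<bar>) / 2" unfolding d_def by (rule min.coboundedI2, rule min.coboundedI2) simp
      ultimately have d: "d > 0" "d \<le> 1 / 8" "d < e" "\<bar>p - p0\<bar> + d < \<epsilon>"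
        using \<open>e > 0\<close> by (simp_all add: d_def min_less_iff_disj)
      define p' where "p' = (if p < 1 / 4 then p + d else p - d)"
      have "p' \<in> {0..1/2}" using p d by (auto simp: p'_def)
      moreover have "\<bar>p' - p0\<bar> < \<epsilon>" using d by (auto simp: p'_def)
      ultimately have "p' \<in> degenerate_set" by (rule \<epsilon>(2))
      moreover have "p' \<noteq> p" "dist p' p < e" using d by (auto simp: p'_def dist_real_def)
      ultimately show "\<exists>x'\<in>degenerate_set. x' \<noteq> p \<and> dist x' p < e" by blast
    qed
    then show "\<exists>e>0. \<forall>x'\<in>{0..1/2}. dist x' p0 < e \<longrightarrow> x' \<in> A"
      using \<epsilon>(1) by (intro exI[of _ \<epsilon>]) (auto simp: A_def)
  qed
  have "A = {0..1/2} \<inter> {p. p islimpt degenerate_set}" by (auto simp: A_def)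
  then have "closedin (top_of_set {0..1/2}) A"
    using closed_limpts[of degenerate_set] by (simp add: closedin_closed_Int)
  moreover have "connected {0..1/2::real}" by simp
  ultimately have "A = {0..1/2}"
    using open_A p1 unfolding connected_clopen A_def by blast
  then have "1 / 4 \<in> A" by simp
  then have "1 / 4 \<in> degenerate_set"
    using degenerate_set_islimpt[of "1 / 4"] by (auto simp: A_def)
  moreover have "crit_pt (1 / 4) = tau / 2"
    by (simp add: crit_pt_def crit_y_quarter complex_eq_iff)
  ultimately show False using Re_wp_half_tau_pos by (simp add: degenerate_set_def)
qed

end

subsection \<open>The Green identity with a logarithmic singularity\<close>

lemma has_derivative_partials:
  fixes f :: "complex \<Rightarrow> real"
  assumes "(f has_derivative (\<lambda>h. A * Re h + B * Im h)) (at (Complex x y))"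
  shows "((\<lambda>t. f (Complex t y)) has_real_derivative A) (at x)"
    and "((\<lambda>t. f (Complex x t)) has_real_derivative B) (at y)"
proof -
  have 1: "((\<lambda>t. Complex t y) has_derivative (\<lambda>h. Complex h 0)) (at x)"
    and 2: "((\<lambda>t. Complex x t) has_derivative (\<lambda>h. Complex 0 h)) (at y)"
    unfolding Complex_eq by (auto intro!: derivative_eq_intros)
  show "((\<lambda>t. f (Complex t y)) has_real_derivative A) (at x)"
    using has_derivative_compose[OF 1 assms] by (simp add: has_field_derivative_def)
  show "((\<lambda>t. f (Complex x t)) has_real_derivative B) (at y)"
    using has_derivative_compose[OF 2 assms] by (simp add: has_field_derivative_def)
qed

lemma continuous_on_Complex_compose:
  assumes "continuous_on S f" "\<And>x. x \<in> A \<Longrightarrow> Complex (u x) (v x) \<in> S"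
    "continuous_on A u" "continuous_on A v"
  shows "continuous_on A (\<lambda>x. f (Complex (u x) (v x)))"
  by (rule continuous_on_compose2[OF assms(1)])
     (use assms in \<open>auto simp: Complex_eq intro!: continuous_intros\<close>)

text \<open>A shift by half a period, undoing the horizontal offset between the top and bottom edge
  that is caused by \<open>Re tau = 1/2\<close>.\<close>

lemma integral_period:
  fixes V :: "real \<Rightarrow> real"
  assumes cont: "continuous_on UNIV V" and per: "\<And>x. V (x + 1) = V x"
  shows "integral {-1..0} V = integral {-1/2..1/2} V"
proof -
  have i: "V integrable_on {a..c}" for a c
    by (rule integrable_continuous_real) (rule continuous_on_subset[OF cont], simp)
  have "integral {-1..0} V = integral {-1..-1/2} V + integral {-1/2..0} V"
    by (rule Henstock_Kurzweil_Integration.integral_combine[symmetric]) (auto intro: i)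
  moreover have "integral {-1/2..1/2} V = integral {-1/2..0} V + integral {0..1/2} V"
    by (rule Henstock_Kurzweil_Integration.integral_combine[symmetric]) (auto intro: i)
  moreover have "integral {-1..-1/2} V = integral {0..1/2} V"
    using integral_shift_real_ivl[of 0 1 "1/2" V] by (simp add: per)
  ultimately show ?thesis by simp
qed

section \<open>The explicit candidate, its gradient and its singularity\<close>

context rhombic_torus
begin

text \<open>The additive constant is left open until the mean can be normalised; a common value on
  the whole lattice keeps the function periodic everywhere.\<close>

definition green_fun :: "real \<Rightarrow> complex \<Rightarrow> real" where
  "green_fun c z = (if z \<in> \<Lambda> then 0 else (Im z)\<^sup>2 / (2 * b) - ln (norm (theta z)) / (2 * pi) + c)"

definition green_dx :: "complex \<Rightarrow> real" where
  "green_dx z = - Re (hecke z) / (2 * pi)"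

definition green_dy :: "complex \<Rightarrow> real" where
  "green_dy z = Im (hecke z) / (2 * pi)"

text \<open>Under \<open>tau\<close> the quadratic term and the logarithm of
  \<open>norm (tau_mult z)\<close> divided by \<open>2 * pi\<close> both contribute
  \<open>Im z + b / 2\<close>, with opposite signs.\<close>

lemma green_fun_lattice: "w \<in> \<Lambda> \<Longrightarrow> green_fun c (z + w) = green_fun c z"
proof (rule period_lattice)
  show "green_fun c (z + 1) = green_fun c z" for z
    by (simp add: green_fun_def lattice_shift theta_plus_1)
  show "green_fun c (z + tau) = green_fun c z" for z
  proof (cases "z \<in> \<Lambda>")
    case False
    have "norm (tau_mult z) = exp (pi * b + 2 * pi * Im z)"
      unfolding tau_mult_def norm_mult norm_minus_cancel norm_exp_eq_Re norm_ee
      by (simp add: exp_add[symmetric])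
    then have "ln (norm (theta (z + tau))) = pi * b + 2 * pi * Im z + ln (norm (theta z))"
      using False theta_eq_0_iff[of z] by (simp add: theta_plus_tau' norm_mult ln_mult)
    then show ?thesis
      using False b_pos by (simp add: green_fun_def lattice_shift field_simps power2_eq_square)
  qed (simp add: green_fun_def lattice_shift)
qed auto

lemma green_fun_uminus: "green_fun c (- z) = green_fun c z"
  by (simp add: green_fun_def theta_uminus)

lemma green_fun_cnj: "green_fun c (cnj z) = green_fun c z"
  by (simp add: green_fun_def cnj_theta[symmetric])

lemma green_dy_cnj: "green_dy (cnj z) = - green_dy z"
  by (simp add: green_dy_def cnj_hecke[symmetric])

lemma green_dx_lattice: "w \<in> \<Lambda> \<Longrightarrow> green_dx (z + w) = green_dx z"
  and green_dy_lattice: "w \<in> \<Lambda> \<Longrightarrow> green_dy (z + w) = green_dy z"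
  by (simp_all add: green_dx_def green_dy_def hecke_lattice)

lemma green_fun_has_derivative:
  assumes z: "z \<notin> \<Lambda>"
  shows "(green_fun c has_derivative (\<lambda>h. green_dx z * Re h + green_dy z * Im h)) (at z)"
proof -
  have nz: "theta z \<noteq> 0" using z by (simp add: theta_eq_0_iff)
  \<comment> \<open>Division by \<open>theta z\<close> moves the argument of \<open>Ln\<close> to 1,
    away from the branch cut.\<close>
  have "((\<lambda>w. Ln (theta w / theta z)) has_field_derivative
      (1 / (theta z / theta z)) * (deriv theta z / theta z)) (at z)"
    by (rule DERIV_chain2[of Ln]; (rule has_field_derivative_Ln)?)
       (auto intro!: derivative_eq_intros theta_DERIV simp: nz complex_nonpos_Reals_iff)
  then have "((\<lambda>w. Ln (theta w / theta z)) has_field_derivative zeta z) (at z)"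
    using nz by (simp add: zeta_def)
  then have "((\<lambda>w. Ln (theta w / theta z)) has_derivative (\<lambda>h. zeta z * h)) (at z)"
    by (simp add: has_field_derivative_def)
  then have "((\<lambda>w. (Im w)\<^sup>2 / (2 * b) - (Re (Ln (theta w / theta z)) + ln (norm (theta z))) / (2 * pi) + c)
      has_derivative (\<lambda>h. 2 * Im z * Im h / (2 * b) - Re (zeta z * h) / (2 * pi))) (at z)"
    using b_pos by (auto intro!: derivative_eq_intros simp: field_simps)
  moreover have "(\<lambda>h. 2 * Im z * Im h / (2 * b) - Re (zeta z * h) / (2 * pi)) =
      (\<lambda>h. green_dx z * Re h + green_dy z * Im h)"
    using z b_pos by (auto simp: green_dx_def green_dy_def hecke_def field_simps)
  ultimately have "((\<lambda>w. (Im w)\<^sup>2 / (2 * b) - (Re (Ln (theta w / theta z)) + ln (norm (theta z))) / (2 * pi) + c)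
      has_derivative (\<lambda>h. green_dx z * Re h + green_dy z * Im h)) (at z)" by simp
  then show ?thesis
  proof (rule has_derivative_transform_within_open[OF _ open_off_lattice])
    fix w assume w: "w \<in> - \<Lambda>"
    then have "theta w \<noteq> 0" by (simp add: theta_eq_0_iff)
    then have "Re (Ln (theta w / theta z)) = ln (norm (theta w)) - ln (norm (theta z))"
      using nz by (simp add: norm_divide ln_div)
    then show "(Im w)\<^sup>2 / (2 * b) - (Re (Ln (theta w / theta z)) + ln (norm (theta z))) / (2 * pi) + c
        = green_fun c w"
      using w by (simp add: green_fun_def)
  qed (use z in auto)
qed

lemma continuous_on_green_fun: "continuous_on (- \<Lambda>) (green_fun c)"
  using green_fun_has_derivative
  by (auto intro!: continuous_at_imp_continuous_on dest: has_derivative_continuous)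

lemma continuous_on_green_dy: "continuous_on (- \<Lambda>) green_dy"
proof -
  have "continuous_on (- \<Lambda>) (\<lambda>z. Im (zeta z + of_real (2 * pi * Im z / b) * \<i>) / (2 * pi))"
    using b_pos
    by (intro continuous_intros continuous_at_imp_continuous_on ballI DERIV_isCont[OF zeta_DERIV]) auto
  then show ?thesis
    by (rule continuous_on_cong[THEN iffD1, rotated -1]) (simp_all add: green_dy_def hecke_def)
qed

lemma green_dx_DERIV:
  assumes "Complex x y \<notin> \<Lambda>"
  shows "((\<lambda>t. green_dx (Complex t y)) has_real_derivative Re (wp (Complex x y)) / (2 * pi)) (at x)"
proof -
  have "((\<lambda>t. - Re (zeta (Complex t y)) / (2 * pi)) has_real_derivative - Re (- wp (Complex x y)) / (2 * pi)) (at x)"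
    by (intro DERIV_cdivide DERIV_minus DERIV_horizontal(1)[OF zeta_DERIV[OF assms]])
  moreover have "open {t. Complex t y \<notin> \<Lambda>}"
  proof -
    have "open ((\<lambda>t. Complex t y) -` (- \<Lambda>))"
      by (rule continuous_open_vimage[OF open_off_lattice])
         (auto simp: Complex_eq intro!: continuous_intros)
    then show ?thesis by (simp add: vimage_def)
  qed
  ultimately have "((\<lambda>t. green_dx (Complex t y)) has_real_derivative - Re (- wp (Complex x y)) / (2 * pi)) (at x)"
    by (rule has_field_derivative_transform_within_open) (use assms in \<open>auto simp: green_dx_def hecke_def\<close>)
  then show ?thesis by simp
qed

lemma green_dy_DERIV:
  assumes "Complex x y \<notin> \<Lambda>"
  shows "((\<lambda>t. green_dy (Complex x t)) has_real_derivative 1 / b - Re (wp (Complex x y)) / (2 * pi)) (at y)"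
proof -
  have "((\<lambda>t. vfun x t / (2 * pi)) has_real_derivative (2 * pi / b - Re (wp (Complex x y))) / (2 * pi)) (at y)"
    by (intro DERIV_cdivide vfun_DERIV assms)
  then show ?thesis by (simp add: vfun_def green_dy_def diff_divide_distrib)
qed

text \<open>Dividing the zero out of \<open>theta\<close> leaves continuous functions on a compact
  half rectangle, so \<open>ln (norm z)\<close> and \<open>1 / z\<close> are the only singular
  contributions. The first bound depends on \<open>y\<close> alone, which suits integration by
  rows.\<close>

lemma green_near_bottom:
  obtains K where "K > 0"
    "\<And>x y. \<bar>x\<bar> \<le> 1 / 2 \<Longrightarrow> 0 < y \<Longrightarrow> y \<le> b / 2 \<Longrightarrow> \<bar>green_fun c (Complex x y)\<bar> \<le> K * (1 + \<bar>ln y\<bar>)"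
    "\<And>x y. \<bar>x\<bar> \<le> 1 / 2 \<Longrightarrow> 0 < y \<Longrightarrow> y \<le> b / 2 \<Longrightarrow> \<bar>green_dy (Complex x y)\<bar> * norm (Complex x y) \<le> K"
proof -
  define S where "S = cbox (Complex (-1/2) 0) (Complex (1/2) (b/2))"
  have S: "Complex x y \<in> S \<longleftrightarrow> \<bar>x\<bar> \<le> 1 / 2 \<and> 0 \<le> y \<and> y \<le> b / 2" for x y
    by (auto simp: S_def in_cbox_complex_iff)
  have off: "z \<in> S \<Longrightarrow> z \<notin> \<Lambda> - {0}" for z
  proof
    assume z: "z \<in> S" "z \<in> \<Lambda> - {0}"
    then obtain m n :: int where mn: "Re z = of_int m + of_int n / 2" "Im z = of_int n * b"
      by (auto simp: lattice_coords)
    have zz: "\<bar>Re z\<bar> \<le> 1 / 2" "0 \<le> Im z" "Im z \<le> b / 2" using z S[of "Re z" "Im z"] by auto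
    have "0 \<le> of_int n * b" "of_int n * b < 1 * b" using mn zz b_pos by auto
    then have "n = 0" using b_pos by (simp add: zero_le_mult_iff)
    then have "\<bar>real_of_int m\<bar> \<le> 1 / 2" using mn zz by simp
    then have "m = 0" by linarith
    then show False using z mn \<open>n = 0\<close> by (simp add: complex_eq_iff)
  qed
  have "compact S" by (simp add: S_def)
  have "compact (zeta_reg ` S)"
    by (intro compact_continuous_image \<open>compact S\<close> holomorphic_on_imp_continuous_on
        holomorphic_on_subset[OF zeta_reg_holomorphic]) (use off in auto)
  then obtain M1 where M1: "\<And>z. z \<in> S \<Longrightarrow> norm (zeta_reg z) \<le> M1"
    using compact_imp_bounded[THEN bounded_iff[THEN iffD1]] by (metis imageI)
  have "continuous_on S (\<lambda>z. ln (norm (theta_quot z)))"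
    by (intro continuous_intros holomorphic_on_imp_continuous_on theta_quot_holomorphic)
       (use off theta_quot_eq_0_iff in auto)
  then have "compact ((\<lambda>z. ln (norm (theta_quot z))) ` S)"
    by (intro compact_continuous_image \<open>compact S\<close>)
  then obtain M2 where M2: "\<And>z. z \<in> S \<Longrightarrow> norm (ln (norm (theta_quot z))) \<le> M2"
    using compact_imp_bounded[THEN bounded_iff[THEN iffD1]] by (metis imageI)
  define K1 where "K1 = b + M2 + (1 + b) + \<bar>c\<bar> + 1"
  define K2 where "K2 = 1 + (M1 + 2 * pi) * (1 + b)"
  have M0: "M1 \<ge> 0" "M2 \<ge> 0"
  proof -
    have "0 \<in> S" using S[of 0 0] b_pos by (simp add: zero_complex.code)
    then show "M1 \<ge> 0" "M2 \<ge> 0" using M1 M2 norm_ge_zero order_trans by blast+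
  qed
  have K: "K1 > 0" "K2 > 0" using b_pos M0 by (auto simp: K1_def K2_def intro: add_pos_nonneg)
  show ?thesis
  proof (rule that[of "K1 + K2"])
    fix x y :: real assume xy: "\<bar>x\<bar> \<le> 1 / 2" "0 < y" "y \<le> b / 2"
    define z where "z = Complex x y"
    have zS: "z \<in> S" using xy S by (simp add: z_def)
    have nl: "z \<notin> \<Lambda>" unfolding z_def using xy b_pos by (intro not_lattice_Im) auto
    have nz: "z \<noteq> 0" using nl by auto
    have z_le: "norm z \<le> 1 + b" using cmod_le[of z] xy by (simp add: z_def)
    have z_ge: "y \<le> norm z" using abs_Im_le_cmod[of z] xy by (simp add: z_def)
    have lnz: "\<bar>ln (norm z)\<bar> \<le> \<bar>ln y\<bar> + (1 + b)"
    proof -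
      have "ln y \<le> ln (norm z)" using z_ge xy nz by (subst ln_le_cancel_iff) auto
      moreover have "ln (norm z) \<le> norm z" using nz ln_le_minus_one[of "norm z"] by simp
      ultimately show ?thesis using z_le b_pos by linarith
    qed
    have "ln (norm (theta z)) = ln (norm z) + ln (norm (theta_quot z))"
      unfolding theta_eq_quot[of z] norm_mult using nz off[OF zS] theta_quot_eq_0_iff[of z]
      by (subst ln_mult) auto
    then have L: "\<bar>ln (norm (theta z))\<bar> \<le> \<bar>ln y\<bar> + (1 + b) + M2" using lnz M2[OF zS] by simp
    have "\<bar>green_fun c z\<bar> \<le> \<bar>(Im z)\<^sup>2 / (2 * b)\<bar> + \<bar>ln (norm (theta z)) / (2 * pi)\<bar> + \<bar>c\<bar>"
    proof -
      have tri: "\<bar>u - v + c\<bar> \<le> \<bar>u\<bar> + \<bar>v\<bar> + \<bar>c\<bar>" for u v :: real by linarith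
      have "green_fun c z = (Im z)\<^sup>2 / (2 * b) - ln (norm (theta z)) / (2 * pi) + c"
        using nl by (simp add: green_fun_def)
      then show ?thesis by (simp only: tri)
    qed
    also have "\<bar>ln (norm (theta z)) / (2 * pi)\<bar> \<le> \<bar>ln (norm (theta z))\<bar>"
      using pi_gt3 by (simp add: abs_mult divide_le_eq mult_le_cancel_left1)
    also have "\<bar>(Im z)\<^sup>2 / (2 * b)\<bar> \<le> b"
    proof -
      have "y\<^sup>2 \<le> b\<^sup>2" using xy b_pos by (intro power_mono) auto
      moreover have "b * (2 * b) = b\<^sup>2 + b\<^sup>2" by (simp add: power2_eq_square)
      ultimately have "y\<^sup>2 \<le> b * (2 * b)" using zero_le_power2[of b] by linarith
      then show ?thesis using b_pos by (simp add: z_def divide_le_eq)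
    qed
    finally have "\<bar>green_fun c z\<bar> \<le> b + (\<bar>ln y\<bar> + (1 + b) + M2) + \<bar>c\<bar>" using L by simp
    also have "\<dots> \<le> K1 + \<bar>ln y\<bar> * 1" by (simp add: K1_def)
    also have "\<dots> \<le> K1 + \<bar>ln y\<bar> * K1" using b_pos M0 by (intro add_mono mult_left_mono) (auto simp: K1_def)
    also have "\<dots> \<le> (K1 + K2) * (1 + \<bar>ln y\<bar>)" using K by (simp add: algebra_simps)
    finally show "\<bar>green_fun c (Complex x y)\<bar> \<le> (K1 + K2) * (1 + \<bar>ln y\<bar>)" by (simp add: z_def)
    have "\<bar>green_dy z\<bar> \<le> norm (hecke z)"
    proof -
      have "\<bar>green_dy z\<bar> = \<bar>Im (hecke z)\<bar> / (2 * pi)" by (simp add: green_dy_def)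
      also have "\<dots> \<le> \<bar>Im (hecke z)\<bar> / 1" using pi_gt3 by (intro divide_left_mono) auto
      also have "\<dots> \<le> norm (hecke z)" using abs_Im_le_cmod by simp
      finally show ?thesis .
    qed
    also have "\<dots> \<le> norm (1 / z) + norm (zeta_reg z) + norm (of_real (2 * pi * Im z / b) * \<i>)"
      using nl zeta_eq_reg[OF nl] by (simp add: hecke_def norm_triangle_le norm_triangle_ineq add_mono)
    also have "norm (of_real (2 * pi * Im z / b) * \<i>) \<le> 2 * pi"
    proof -
      have "norm (of_real (2 * pi * Im z / b) * \<i>) = \<bar>2 * pi * Im z / b\<bar>"
        by (simp only: norm_mult norm_of_real norm_ii mult_1_right)
      also have "\<dots> = 2 * pi * y / b" using xy b_pos by (simp add: z_def)
      also have "\<dots> \<le> 2 * pi" using xy b_pos by (simp add: divide_le_eq)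
      finally show ?thesis .
    qed
    finally have "\<bar>green_dy z\<bar> \<le> 1 / norm z + (M1 + 2 * pi)" using M1[OF zS] by (simp add: norm_divide)
    then have "\<bar>green_dy z\<bar> * norm z \<le> (1 / norm z + (M1 + 2 * pi)) * norm z" by (intro mult_right_mono) auto
    also have "\<dots> = 1 + (M1 + 2 * pi) * norm z" using nz by (simp add: algebra_simps)
    also have "\<dots> \<le> K2" unfolding K2_def using z_le M0 by (intro add_mono mult_left_mono) auto
    finally show "\<bar>green_dy (Complex x y)\<bar> * norm (Complex x y) \<le> K1 + K2" using K by (simp add: z_def)
  qed (use K in auto)
qed

end

text \<open>The partial derivatives are data with the regularity that Green's identity uses;
  instances are smooth periodic functions and the constant 1, which yields the flux.\<close>

locale torus_test = rhombic_torus +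
  fixes \<phi> \<phi>x \<phi>y \<phi>xx \<phi>yy :: "complex \<Rightarrow> real"
  assumes dx: "\<And>x y. ((\<lambda>t. \<phi> (Complex t y)) has_real_derivative \<phi>x (Complex x y)) (at x)"
    and dy: "\<And>x y. ((\<lambda>t. \<phi> (Complex x t)) has_real_derivative \<phi>y (Complex x y)) (at y)"
    and dxx: "\<And>x y. ((\<lambda>t. \<phi>x (Complex t y)) has_real_derivative \<phi>xx (Complex x y)) (at x)"
    and dyy: "\<And>x y. ((\<lambda>t. \<phi>y (Complex x t)) has_real_derivative \<phi>yy (Complex x y)) (at y)"
    and cont: "continuous_on UNIV \<phi>" "continuous_on UNIV \<phi>x" "continuous_on UNIV \<phi>y"
      "continuous_on UNIV \<phi>xx" "continuous_on UNIV \<phi>yy"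
    and per: "\<And>z w. w \<in> lattice tau \<Longrightarrow> \<phi> (z + w) = \<phi> z" "\<And>z w. w \<in> lattice tau \<Longrightarrow> \<phi>x (z + w) = \<phi>x z"
      "\<And>z w. w \<in> lattice tau \<Longrightarrow> \<phi>y (z + w) = \<phi>y z"
    and Lip: "\<And>R. \<exists>L. \<forall>z\<in>cball 0 R. \<forall>w\<in>cball 0 R. \<bar>\<phi> z - \<phi> w\<bar> \<le> L * norm (z - w) \<and> \<bar>\<phi>y z - \<phi>y w\<bar> \<le> L * norm (z - w)"
begin

text \<open>Vertical component of the field \<open>G * grad \<phi> - \<phi> * grad G\<close> in
  Green's second identity.\<close>

definition wronskian :: "real \<Rightarrow> complex \<Rightarrow> real" where
  "wronskian c z = green_fun c z * \<phi>y z - green_dy z * \<phi> z"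

lemma wronskian_lattice: "w \<in> \<Lambda> \<Longrightarrow> wronskian c (z + w) = wronskian c z"
  by (simp add: wronskian_def green_fun_lattice green_dy_lattice per)

lemma continuous_on_wronskian: "continuous_on (- \<Lambda>) (wronskian c)"
  unfolding wronskian_def[abs_def]
  by (intro continuous_intros continuous_on_green_fun continuous_on_green_dy
      continuous_on_subset[OF cont(1)] continuous_on_subset[OF cont(3)]) auto

text \<open>Green's second identity on a strip that avoids the poles. Horizontal fluxes cancel by
  the period 1, so only the two edges remain; the term \<open>\<phi> / b\<close> reflects that the
  candidate has Laplacian \<open>1 / b\<close> off the lattice.\<close>

lemma green_identity:
  assumes \<epsilon>: "0 < \<epsilon>" "\<epsilon> < b / 2"
  shows "integral {\<epsilon>..b - \<epsilon>} (\<lambda>y. integral {-1/2..1/2}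
      (\<lambda>x. green_fun c (Complex x y) * (\<phi>xx (Complex x y) + \<phi>yy (Complex x y)) - \<phi> (Complex x y) / b))
    = integral {-1/2..1/2} (\<lambda>x. wronskian c (Complex x (b - \<epsilon>)) - wronskian c (Complex x \<epsilon>))"
proof -
  have off: "Complex x y \<notin> \<Lambda>" if "y \<in> {\<epsilon>..b - \<epsilon>}" for x y
    using that \<epsilon> by (intro not_lattice_Im) auto
  \<comment> \<open>The integrand is split so that one part is an \<open>x\<close>-derivative and
    the other a \<open>y\<close>-derivative; the terms with \<open>Re wp\<close> cancel in the
    sum.\<close>
  define Ux where "Ux = (\<lambda>x y. green_fun c (Complex x y) * \<phi>xx (Complex x y)
      - Re (wp (Complex x y)) / (2 * pi) * \<phi> (Complex x y))"
  define Wy where "Wy = (\<lambda>x y. green_fun c (Complex x y) * \<phi>yy (Complex x y)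
      - (1 / b - Re (wp (Complex x y)) / (2 * pi)) * \<phi> (Complex x y))"
  have sp: "green_fun c (Complex x y) * (\<phi>xx (Complex x y) + \<phi>yy (Complex x y)) - \<phi> (Complex x y) / b
      = Ux x y + Wy x y" for x y
    by (simp add: Ux_def Wy_def algebra_simps)
  have contx: "continuous_on {-1/2..1/2} (\<lambda>x. Ux x y)" "continuous_on {-1/2..1/2} (\<lambda>x. Wy x y)"
    if y: "y \<in> {\<epsilon>..b - \<epsilon>}" for y
    unfolding Ux_def Wy_def
    by (intro continuous_intros continuous_on_Complex_compose[OF continuous_on_green_fun]
        continuous_on_Complex_compose[OF continuous_on_wp] continuous_on_Complex_compose[OF cont(1)]
        continuous_on_Complex_compose[OF cont(4)] continuous_on_Complex_compose[OF cont(5)];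
        use off[OF y] in simp)+
  have intU: "integral {-1/2..1/2} (\<lambda>x. Ux x y) = 0" if y: "y \<in> {\<epsilon>..b - \<epsilon>}" for y
  proof -
    define U where "U = (\<lambda>x. green_fun c (Complex x y) * \<phi>x (Complex x y) - green_dx (Complex x y) * \<phi> (Complex x y))"
    have "((\<lambda>x. Ux x y) has_integral (U (1/2) - U (-1/2))) {-1/2..1/2}"
    proof (rule fundamental_theorem_of_calculus)
      show "(U has_vector_derivative Ux x y) (at x within {-1/2..1/2})" for x
      proof -
        have "(U has_real_derivative Ux x y) (at x)"
          unfolding U_def Ux_def
          by (rule derivative_eq_intros dx dxx green_dx_DERIV[OF off[OF y]]
              has_derivative_partials(1)[OF green_fun_has_derivative[OF off[OF y]]] refl)+ simp
        then show ?thesis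
          by (simp add: has_real_derivative_iff_has_vector_derivative has_vector_derivative_at_within)
      qed
    qed simp
    moreover have "U (1/2) = U (-1/2)"
    proof -
      have "Complex (1/2) y = Complex (-1/2) y + 1" by (simp add: complex_eq_iff)
      then show ?thesis
        unfolding U_def by (simp only: green_fun_lattice[OF lattice_1] green_dx_lattice[OF lattice_1] per[OF lattice_1])
    qed
    ultimately show ?thesis by (simp add: integral_unique)
  qed
  have inner: "integral {-1/2..1/2} (\<lambda>x. green_fun c (Complex x y) * (\<phi>xx (Complex x y) + \<phi>yy (Complex x y)) - \<phi> (Complex x y) / b)
      = integral {-1/2..1/2} (\<lambda>x. Wy x y)" if y: "y \<in> {\<epsilon>..b - \<epsilon>}" for y
  proof -
    have "integral {-1/2..1/2} (\<lambda>x. Ux x y + Wy x y) = integral {-1/2..1/2} (\<lambda>x. Ux x y) + integral {-1/2..1/2} (\<lambda>x. Wy x y)"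
      by (rule Henstock_Kurzweil_Integration.integral_add) (rule integrable_continuous_real, rule contx[OF y])+
    then show ?thesis unfolding sp intU[OF y] by simp
  qed
  have "integral {\<epsilon>..b - \<epsilon>} (\<lambda>y. integral {-1/2..1/2}
      (\<lambda>x. green_fun c (Complex x y) * (\<phi>xx (Complex x y) + \<phi>yy (Complex x y)) - \<phi> (Complex x y) / b))
     = integral {\<epsilon>..b - \<epsilon>} (\<lambda>y. integral {-1/2..1/2} (\<lambda>x. Wy x y))"
    by (rule integral_cong) (rule inner)
  also have "\<dots> = integral {-1/2..1/2} (\<lambda>x. integral {\<epsilon>..b - \<epsilon>} (\<lambda>y. Wy x y))"
  proof -
    have "continuous_on (cbox (\<epsilon>, -1/2) (b - \<epsilon>, 1/2)) (\<lambda>(y, x). Wy x y)"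
      unfolding Wy_def case_prod_beta
      by (intro continuous_intros continuous_on_Complex_compose[OF continuous_on_green_fun]
          continuous_on_Complex_compose[OF continuous_on_wp] continuous_on_Complex_compose[OF cont(1)]
          continuous_on_Complex_compose[OF cont(5)]; use off in \<open>auto simp: cbox_Pair_eq\<close>)
    from integral_swap_continuous[OF this] show ?thesis by (simp add: cbox_interval)
  qed
  also have "\<dots> = integral {-1/2..1/2} (\<lambda>x. wronskian c (Complex x (b - \<epsilon>)) - wronskian c (Complex x \<epsilon>))"
  proof (rule integral_cong)
    fix x
    have "((\<lambda>y. Wy x y) has_integral (wronskian c (Complex x (b - \<epsilon>)) - wronskian c (Complex x \<epsilon>))) {\<epsilon>..b - \<epsilon>}"
    proof (rule fundamental_theorem_of_calculus)
      show "((\<lambda>y. wronskian c (Complex x y)) has_vector_derivative Wy x y) (at y within {\<epsilon>..b - \<epsilon>})"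
        if y: "y \<in> {\<epsilon>..b - \<epsilon>}" for y
      proof -
        have "((\<lambda>y. wronskian c (Complex x y)) has_real_derivative Wy x y) (at y)"
          unfolding wronskian_def Wy_def
          by (rule derivative_eq_intros dy dyy green_dy_DERIV[OF off[OF y]]
              has_derivative_partials(2)[OF green_fun_has_derivative[OF off[OF y]]] refl)+ simp
        then show ?thesis
          by (simp add: has_real_derivative_iff_has_vector_derivative has_vector_derivative_at_within)
      qed
    qed (use \<epsilon> in simp)
    then show "integral {\<epsilon>..b - \<epsilon>} (Wy x) = wronskian c (Complex x (b - \<epsilon>)) - wronskian c (Complex x \<epsilon>)"
      by (simp add: integral_unique)
  qed
  finally show ?thesis .
qed

text \<open>Translation by \<open>tau\<close> brings the top edge to height
  \<open>- \<epsilon>\<close>, so that the two edges enclose the pole at 0.\<close>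

lemma wronskian_top:
  assumes \<epsilon>: "0 < \<epsilon>" "\<epsilon> < b / 2"
  shows "integral {-1/2..1/2} (\<lambda>x. wronskian c (Complex x (b - \<epsilon>)))
    = integral {-1/2..1/2} (\<lambda>x. wronskian c (Complex x (- \<epsilon>)))"
proof -
  define V where "V = (\<lambda>x. wronskian c (Complex x (- \<epsilon>)))"
  have off: "Complex x (- \<epsilon>) \<notin> \<Lambda>" for x
    using not_lattice_Im[of \<epsilon> "- x"] \<epsilon> lattice_minus_iff[of "Complex x (- \<epsilon>)"] by (simp add: complex_minus)
  have "wronskian c (Complex x (b - \<epsilon>)) = V (x + - (1/2))" for x
  proof -
    have "Complex x (b - \<epsilon>) = Complex (x + - (1/2)) (- \<epsilon>) + tau" by (simp add: complex_eq_iff)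
    then show ?thesis unfolding V_def by (simp only: wronskian_lattice[OF lattice_tau])
  qed
  then have "integral {-1/2..1/2} (\<lambda>x. wronskian c (Complex x (b - \<epsilon>))) = integral {-1/2..1/2} (\<lambda>x. V (x + - (1/2)))"
    by simp
  also have "\<dots> = integral {-1..0} V"
    using integral_shift_real_ivl[of "-1" "- (1/2)" 0 V] by simp
  also have "\<dots> = integral {-1/2..1/2} V"
  proof (rule integral_period)
    show "continuous_on UNIV V"
      unfolding V_def using off
      by (intro continuous_on_Complex_compose[OF continuous_on_wronskian] continuous_intros) auto
    show "V (x + 1) = V x" for x
    proof -
      have "Complex (x + 1) (- \<epsilon>) = Complex x (- \<epsilon>) + 1" by (simp add: complex_eq_iff)
      then show ?thesis unfolding V_def by (simp only: wronskian_lattice[OF lattice_1])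
    qed
  qed
  finally show ?thesis unfolding V_def .
qed

text \<open>Conjugation exchanges the heights \<open>\<epsilon>\<close> and
  \<open>- \<epsilon>\<close>; \<open>green_fun\<close> is even and \<open>green_dy\<close> odd
  under it. This separates a term that tends to 0 from the one that carries the point mass.\<close>

lemma wronskian_jump:
  assumes \<epsilon>: "0 < \<epsilon>" "\<epsilon> < b / 2"
  shows "integral {-1/2..1/2} (\<lambda>x. wronskian c (Complex x (b - \<epsilon>)) - wronskian c (Complex x \<epsilon>)) =
    integral {-1/2..1/2} (\<lambda>x. green_fun c (Complex x \<epsilon>) * (\<phi>y (Complex x (- \<epsilon>)) - \<phi>y (Complex x \<epsilon>)))
    + integral {-1/2..1/2} (\<lambda>x. green_dy (Complex x \<epsilon>) * (\<phi> (Complex x \<epsilon>) + \<phi> (Complex x (- \<epsilon>))))"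
proof -
  have off: "Complex x \<epsilon> \<notin> \<Lambda>" "Complex x (b - \<epsilon>) \<notin> \<Lambda>" for x
    using not_lattice_Im[of \<epsilon> x] not_lattice_Im[of "b - \<epsilon>" x] \<epsilon> by auto
  have off': "Complex x (- \<epsilon>) \<notin> \<Lambda>" for x
    using off(1)[of "- x"] lattice_minus_iff[of "Complex x (- \<epsilon>)"] by (simp add: complex_minus)
  have c: "continuous_on {-1/2..1/2} (\<lambda>x. wronskian c (Complex x y))" if "\<And>x. Complex x y \<notin> \<Lambda>" for y
    using that by (intro continuous_on_Complex_compose[OF continuous_on_wronskian] continuous_intros) auto
  have cf: "continuous_on {-1/2..1/2} (\<lambda>x. f (Complex x y))" if "continuous_on UNIV f" for f :: "complex \<Rightarrow> real" and y
    by (intro continuous_on_Complex_compose[OF that] continuous_intros) auto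
  have cg: "continuous_on {-1/2..1/2} (\<lambda>x. green_fun c (Complex x \<epsilon>))"
     "continuous_on {-1/2..1/2} (\<lambda>x. green_dy (Complex x \<epsilon>))"
    using off by (intro continuous_on_Complex_compose[OF continuous_on_green_fun]
        continuous_on_Complex_compose[OF continuous_on_green_dy] continuous_intros; simp)+
  have "integral {-1/2..1/2} (\<lambda>x. wronskian c (Complex x (b - \<epsilon>)) - wronskian c (Complex x \<epsilon>))
      = integral {-1/2..1/2} (\<lambda>x. wronskian c (Complex x (b - \<epsilon>))) - integral {-1/2..1/2} (\<lambda>x. wronskian c (Complex x \<epsilon>))"
    using off by (intro Henstock_Kurzweil_Integration.integral_diff integrable_continuous_real c) auto
  also have "\<dots> = integral {-1/2..1/2} (\<lambda>x. wronskian c (Complex x (- \<epsilon>)) - wronskian c (Complex x \<epsilon>))"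
    unfolding wronskian_top[OF \<epsilon>] using off off'
    by (intro Henstock_Kurzweil_Integration.integral_diff[symmetric] integrable_continuous_real c) auto
  also have "\<dots> = integral {-1/2..1/2} (\<lambda>x. green_fun c (Complex x \<epsilon>) * (\<phi>y (Complex x (- \<epsilon>)) - \<phi>y (Complex x \<epsilon>))
      + green_dy (Complex x \<epsilon>) * (\<phi> (Complex x \<epsilon>) + \<phi> (Complex x (- \<epsilon>))))"
  proof (rule integral_cong)
    fix x
    have "Complex x (- \<epsilon>) = cnj (Complex x \<epsilon>)" by (simp add: complex_eq_iff)
    then have "green_fun c (Complex x (- \<epsilon>)) = green_fun c (Complex x \<epsilon>)"
      "green_dy (Complex x (- \<epsilon>)) = - green_dy (Complex x \<epsilon>)"
      by (simp_all only: green_fun_cnj green_dy_cnj)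
    then show "wronskian c (Complex x (- \<epsilon>)) - wronskian c (Complex x \<epsilon>) =
      green_fun c (Complex x \<epsilon>) * (\<phi>y (Complex x (- \<epsilon>)) - \<phi>y (Complex x \<epsilon>))
      + green_dy (Complex x \<epsilon>) * (\<phi> (Complex x \<epsilon>) + \<phi> (Complex x (- \<epsilon>)))"
      by (simp add: wronskian_def algebra_simps)
  qed
  also have "\<dots> = integral {-1/2..1/2} (\<lambda>x. green_fun c (Complex x \<epsilon>) * (\<phi>y (Complex x (- \<epsilon>)) - \<phi>y (Complex x \<epsilon>)))
    + integral {-1/2..1/2} (\<lambda>x. green_dy (Complex x \<epsilon>) * (\<phi> (Complex x \<epsilon>) + \<phi> (Complex x (- \<epsilon>))))"
    by (intro Henstock_Kurzweil_Integration.integral_add integrable_continuous_real continuous_intros cg cf cont)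
  finally show ?thesis .
qed

end

lemma (in rhombic_torus) torus_test_const: "torus_test b (\<lambda>_. 1) (\<lambda>_. 0) (\<lambda>_. 0) (\<lambda>_. 0) (\<lambda>_. 0)"
proof
qed (auto intro!: derivative_eq_intros exI[of _ 0])

text \<open>Stokes on the strip between two horizontal edges, that is the Green identity for a constant.\<close>

lemma (in rhombic_torus) integral_green_dy:
  assumes \<epsilon>: "0 < \<epsilon>" "\<epsilon> < b / 2"
  shows "integral {-1/2..1/2} (\<lambda>x. green_dy (Complex x \<epsilon>)) = \<epsilon> / b - 1 / 2"
proof -
  interpret T: torus_test b "\<lambda>_. 1" "\<lambda>_. 0" "\<lambda>_. 0" "\<lambda>_. 0" "\<lambda>_. 0"
    by (rule torus_test_const)
  have "integral {\<epsilon>..b - \<epsilon>} (\<lambda>y::real. integral {-1/2..1/2} (\<lambda>x::real. - (1 / b)))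
      = integral {-1/2..1/2} (\<lambda>x. 2 * green_dy (Complex x \<epsilon>))"
    using T.green_identity[OF \<epsilon>, of 0] T.wronskian_jump[OF \<epsilon>, of 0] by (simp add: mult.commute)
  moreover have "integral {\<epsilon>..b - \<epsilon>} (\<lambda>y::real. integral {-1/2..1/2} (\<lambda>x::real. - (1 / b))) = - (b - 2 * \<epsilon>) / b"
    using \<epsilon> b_pos by (simp add: divide_simps)
  ultimately have "2 * integral {-1/2..1/2} (\<lambda>x. green_dy (Complex x \<epsilon>)) = - (b - 2 * \<epsilon>) / b" by simp
  then show ?thesis using b_pos by (simp add: field_simps)
qed

context torus_test
begin

text \<open>The first term is of size \<open>\<epsilon> * \<bar>ln \<epsilon>\<bar>\<close>. In the
  second, \<open>\<phi>\<close> is replaced by its value at the pole: the flux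
  \<open>\<epsilon> / b - 1/2\<close> counts twice, and the Lipschitz error is dominated because
  \<open>green_dy\<close> is at most of size \<open>1 / norm z\<close>.\<close>

lemma wronskian_jump_limit:
  assumes e: "\<And>n. 0 < e n" "\<And>n. e n < b / 2" "e \<longlonglongrightarrow> 0"
  shows "(\<lambda>n. integral {-1/2..1/2} (\<lambda>x. wronskian c (Complex x (b - e n)) - wronskian c (Complex x (e n))))
    \<longlonglongrightarrow> - \<phi> 0"
proof -
  obtain K where K: "K > 0"
    "\<And>x y. \<bar>x\<bar> \<le> 1 / 2 \<Longrightarrow> 0 < y \<Longrightarrow> y \<le> b / 2 \<Longrightarrow> \<bar>green_fun c (Complex x y)\<bar> \<le> K * (1 + \<bar>ln y\<bar>)"
    "\<And>x y. \<bar>x\<bar> \<le> 1 / 2 \<Longrightarrow> 0 < y \<Longrightarrow> y \<le> b / 2 \<Longrightarrow> \<bar>green_dy (Complex x y)\<bar> * norm (Complex x y) \<le> K"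
    using green_near_bottom[of c] by metis
  obtain L0 where L0: "\<And>z w. z \<in> cball 0 (1 + b) \<Longrightarrow> w \<in> cball 0 (1 + b) \<Longrightarrow>
      \<bar>\<phi> z - \<phi> w\<bar> \<le> L0 * norm (z - w) \<and> \<bar>\<phi>y z - \<phi>y w\<bar> \<le> L0 * norm (z - w)"
    using Lip[of "1 + b"] by blast
  define L where "L = \<bar>L0\<bar>"
  have L: "\<bar>\<phi> z - \<phi> w\<bar> \<le> L * norm (z - w)" "\<bar>\<phi>y z - \<phi>y w\<bar> \<le> L * norm (z - w)"
    if "z \<in> cball 0 (1 + b)" "w \<in> cball 0 (1 + b)" for z w
  proof -
    have "L0 * norm (z - w) \<le> L * norm (z - w)" unfolding L_def by (intro mult_right_mono) auto
    then show "\<bar>\<phi> z - \<phi> w\<bar> \<le> L * norm (z - w)" "\<bar>\<phi>y z - \<phi>y w\<bar> \<le> L * norm (z - w)"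
      using L0[OF that] by linarith+
  qed
  have L_nn: "L \<ge> 0" by (simp add: L_def)
  have inb: "Complex x y \<in> cball 0 (1 + b)" if "\<bar>x\<bar> \<le> 1 / 2" "\<bar>y\<bar> \<le> b / 2" for x y
    using cmod_le[of "Complex x y"] that b_pos by simp
  have off: "Complex x (e n) \<notin> \<Lambda>" for x n
    using not_lattice_Im[of "e n" x] e(1,2)[of n] by auto
  have cf: "continuous_on {-1/2..1/2} (\<lambda>x. f (Complex x y))" if "continuous_on UNIV f" for f :: "complex \<Rightarrow> real" and y
    by (intro continuous_on_Complex_compose[OF that] continuous_intros) auto
  have cg: "continuous_on {-1/2..1/2} (\<lambda>x. green_fun c (Complex x (e n)))"
     "continuous_on {-1/2..1/2} (\<lambda>x. green_dy (Complex x (e n)))" for n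
    using off by (intro continuous_on_Complex_compose[OF continuous_on_green_fun]
        continuous_on_Complex_compose[OF continuous_on_green_dy] continuous_intros; simp)+
  define T1 where "T1 = (\<lambda>n. integral {-1/2..1/2} (\<lambda>x. green_fun c (Complex x (e n)) * (\<phi>y (Complex x (- e n)) - \<phi>y (Complex x (e n)))))"
  have T1: "T1 \<longlonglongrightarrow> 0"
  proof (rule Lim_null_comparison)
    show "\<forall>\<^sub>F n in sequentially. norm (T1 n) \<le> 2 * K * L * ((1 + \<bar>ln (e n)\<bar>) * e n)"
    proof (intro always_eventually allI)
      fix n
      have "norm (T1 n) \<le> integral {-1/2..1/2} (\<lambda>x::real. 2 * K * L * ((1 + \<bar>ln (e n)\<bar>) * e n))"
        unfolding T1_def
      proof (rule integral_norm_bound_integral)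
        fix x :: real assume x: "x \<in> {-1/2..1/2}"
        have "\<bar>\<phi>y (Complex x (- e n)) - \<phi>y (Complex x (e n))\<bar> \<le> L * norm (Complex x (- e n) - Complex x (e n))"
          using x e(1,2)[of n] by (intro L inb) auto
        also have "norm (Complex x (- e n) - Complex x (e n)) = 2 * e n"
          using e(1)[of n] by (simp add: complex_diff cmod_def real_sqrt_mult)
        finally have 1: "\<bar>\<phi>y (Complex x (- e n)) - \<phi>y (Complex x (e n))\<bar> \<le> L * (2 * e n)" .
        have 2: "\<bar>green_fun c (Complex x (e n))\<bar> \<le> K * (1 + \<bar>ln (e n)\<bar>)"
          using x e(1,2)[of n] by (intro K) auto
        have "norm (green_fun c (Complex x (e n)) * (\<phi>y (Complex x (- e n)) - \<phi>y (Complex x (e n))))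
            \<le> (K * (1 + \<bar>ln (e n)\<bar>)) * (L * (2 * e n))"
          unfolding real_norm_def abs_mult using 1 2 K by (intro mult_mono) auto
        then show "norm (green_fun c (Complex x (e n)) * (\<phi>y (Complex x (- e n)) - \<phi>y (Complex x (e n))))
            \<le> 2 * K * L * ((1 + \<bar>ln (e n)\<bar>) * e n)" by (simp add: mult_ac)
      qed (intro integrable_continuous_real continuous_intros cg cf cont)+
      then show "norm (T1 n) \<le> 2 * K * L * ((1 + \<bar>ln (e n)\<bar>) * e n)" by simp
    qed
    have "((\<lambda>t::real. (1 + \<bar>ln t\<bar>) * t) \<longlongrightarrow> 0) (at_right 0)" by real_asymp
    moreover have "filterlim e (at_right 0) sequentially"
      using e(1) e(3) by (auto simp: filterlim_at less_imp_neq[symmetric])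
    ultimately have "(\<lambda>n. (1 + \<bar>ln (e n)\<bar>) * e n) \<longlonglongrightarrow> 0"
      using filterlim_compose by blast
    from tendsto_mult_left[OF this, of "2 * K * L"]
    show "(\<lambda>n. 2 * K * L * ((1 + \<bar>ln (e n)\<bar>) * e n)) \<longlonglongrightarrow> 0" by simp
  qed
  define F where "F = (\<lambda>n x. green_dy (Complex x (e n)) * (\<phi> (Complex x (e n)) + \<phi> (Complex x (- e n)) - 2 * \<phi> 0))"
  \<comment> \<open>Straight above the pole only boundedness is available, so the point
    \<open>x = 0\<close> is reset to obtain pointwise convergence everywhere.\<close>
  define F0 where "F0 = (\<lambda>n x. if x = 0 then 0 else F n x)"
  have F_int: "F n integrable_on {-1/2..1/2}" for n
    unfolding F_def by (intro integrable_continuous_real continuous_intros cg cf cont)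
  have "(\<lambda>n. integral {-1/2..1/2} (F0 n)) \<longlonglongrightarrow> integral {-1/2..1/2} (\<lambda>x::real. 0::real)"
  proof (rule dominated_convergence(2)[where h = "\<lambda>_. 2 * K * L"])
    show "F0 n integrable_on {-1/2..1/2}" for n
      by (rule integrable_spike[OF F_int[of n] negligible_sing[of 0]]) (simp add: F0_def)
    show "norm (F0 n x) \<le> 2 * K * L" if x: "x \<in> {-1/2..1/2}" for n x
    proof (cases "x = 0")
      case False
      have nn: "norm (Complex x (- e n)) = norm (Complex x (e n))" by (simp add: cmod_def)
      have 0: "0 \<in> cball 0 (1 + b)" using b_pos by simp
      have "\<bar>\<phi> (Complex x (e n)) - \<phi> 0\<bar> \<le> L * norm (Complex x (e n) - 0)"
        "\<bar>\<phi> (Complex x (- e n)) - \<phi> 0\<bar> \<le> L * norm (Complex x (- e n) - 0)"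
        using x e(1,2)[of n] by (intro L inb 0; auto)+
      then have "\<bar>\<phi> (Complex x (e n)) + \<phi> (Complex x (- e n)) - 2 * \<phi> 0\<bar> \<le> 2 * L * norm (Complex x (e n))"
        unfolding diff_zero nn by linarith
      then have "norm (F0 n x) \<le> \<bar>green_dy (Complex x (e n))\<bar> * (2 * L * norm (Complex x (e n)))"
        using False by (simp add: F0_def F_def abs_mult mult_left_mono)
      also have "\<dots> = 2 * L * (\<bar>green_dy (Complex x (e n))\<bar> * norm (Complex x (e n)))" by simp
      also have "\<dots> \<le> 2 * L * K" using x e(1,2)[of n] L_nn by (intro mult_left_mono K) auto
      finally show ?thesis by (simp add: mult_ac)
    qed (use K L_nn in \<open>simp add: F0_def\<close>)
    show "(\<lambda>n. F0 n x) \<longlonglongrightarrow> 0" if x: "x \<in> {-1/2..1/2}" for x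
    proof (cases "x = 0")
      case False
      have nl: "Complex x 0 \<notin> \<Lambda>"
        using not_lattice_Re[of x] not_lattice_Re[of "- x"] x False lattice_minus_iff[of "Complex x 0"]
        by (cases "x > 0") (auto simp: complex_minus)
      have lim: "(\<lambda>n. Complex x (e n)) \<longlonglongrightarrow> Complex x 0" "(\<lambda>n. Complex x (- e n)) \<longlonglongrightarrow> Complex x (- 0)"
        by (intro tendsto_Complex tendsto_intros e)+
      have "isCont green_dy (Complex x 0)"
        using continuous_on_green_dy open_off_lattice nl by (simp add: continuous_on_eq_continuous_at)
      then have g: "(\<lambda>n. green_dy (Complex x (e n))) \<longlonglongrightarrow> green_dy (Complex x 0)"
        using lim(1) by (rule isCont_tendsto_compose)
      have "isCont \<phi> z" for z using cont(1) by (simp add: continuous_on_eq_continuous_at)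
      then have p: "(\<lambda>n. \<phi> (Complex x (e n))) \<longlonglongrightarrow> \<phi> (Complex x 0)" "(\<lambda>n. \<phi> (Complex x (- e n))) \<longlonglongrightarrow> \<phi> (Complex x (- 0))"
        using lim by (metis isCont_tendsto_compose)+
      have "(\<lambda>n. F n x) \<longlonglongrightarrow> green_dy (Complex x 0) * (\<phi> (Complex x 0) + \<phi> (Complex x (- 0)) - 2 * \<phi> 0)"
        unfolding F_def by (intro tendsto_intros g p)
      moreover have "green_dy (Complex x 0) = 0" using vfun_real_axis[of x] by (simp add: green_dy_def vfun_def)
      ultimately show ?thesis using False by (simp add: F0_def)
    qed (simp add: F0_def)
  qed auto
  moreover have "integral {-1/2..1/2} (F0 n) = integral {-1/2..1/2} (F n)" for n
    by (rule integral_spike[OF negligible_sing[of 0]]) (simp add: F0_def)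
  ultimately have F_lim: "(\<lambda>n. integral {-1/2..1/2} (F n)) \<longlonglongrightarrow> 0" by simp
  have T2: "integral {-1/2..1/2} (\<lambda>x. green_dy (Complex x (e n)) * (\<phi> (Complex x (e n)) + \<phi> (Complex x (- e n))))
      = integral {-1/2..1/2} (F n) + (e n / b - 1 / 2) * (2 * \<phi> 0)" for n
  proof -
    have "integral {-1/2..1/2} (\<lambda>x. F n x + green_dy (Complex x (e n)) * (2 * \<phi> 0))
      = integral {-1/2..1/2} (F n) + integral {-1/2..1/2} (\<lambda>x. green_dy (Complex x (e n)) * (2 * \<phi> 0))"
      by (intro Henstock_Kurzweil_Integration.integral_add F_int integrable_continuous_real continuous_intros cg)
    also have "integral {-1/2..1/2} (\<lambda>x. green_dy (Complex x (e n)) * (2 * \<phi> 0)) = (e n / b - 1 / 2) * (2 * \<phi> 0)"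
      using integral_green_dy[of "e n"] e by simp
    finally show ?thesis by (simp add: F_def algebra_simps)
  qed
  have "(\<lambda>n. T1 n + (integral {-1/2..1/2} (F n) + (e n / b - 1 / 2) * (2 * \<phi> 0)))
      \<longlonglongrightarrow> 0 + (0 + (0 / b - 1 / 2) * (2 * \<phi> 0))"
    using b_pos by (intro tendsto_intros T1 F_lim e) auto
  then show ?thesis
    unfolding wronskian_jump[OF e(1,2)] T1_def T2 by simp
qed

end

subsection \<open>Existence of the Green function\<close>

lemma compact_norm_bound:
  fixes f :: "'a :: topological_space \<Rightarrow> 'b :: real_normed_vector"
  assumes "compact S" "continuous_on S f"
  obtains M where "\<And>x. x \<in> S \<Longrightarrow> norm (f x) \<le> M"
proof -
  have "bounded (f ` S)" using assms by (intro compact_imp_bounded compact_continuous_image)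
  then obtain M where "\<forall>y\<in>f ` S. norm y \<le> M" unfolding bounded_iff by blast
  then show ?thesis using that by blast
qed

lemma measurable_Complex [measurable]:
  "(\<lambda>(y, x). Complex x y) \<in> borel_measurable (lborel \<Otimes>\<^sub>M lborel)"
  unfolding Complex_eq by measurable

text \<open>Gives access to Fubini. The imaginary part comes first because the singularity is
  controlled row by row.\<close>

lemma lborel_complex: "(lborel :: complex measure) = distr (lborel \<Otimes>\<^sub>M lborel) borel (\<lambda>(y, x). Complex x y)"
proof (rule lborel_eqI)
  fix l u :: complex assume lu: "\<And>b. b \<in> Basis \<Longrightarrow> l \<bullet> b \<le> u \<bullet> b"
  have le: "Re l \<le> Re u" "Im l \<le> Im u" using lu[of 1] lu[of \<i>] by (auto simp: Basis_complex_def)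
  have vim: "(\<lambda>(y, x). Complex x y) -` box l u \<inter> space (lborel \<Otimes>\<^sub>M lborel) = {Im l<..<Im u} \<times> {Re l<..<Re u}"
    by (auto simp: in_box_complex_iff space_pair_measure)
  have "emeasure (distr (lborel \<Otimes>\<^sub>M lborel) borel (\<lambda>(y, x). Complex x y)) (box l u)
      = emeasure (lborel \<Otimes>\<^sub>M lborel) ({Im l<..<Im u} \<times> {Re l<..<Re u})"
    unfolding vim[symmetric] by (rule emeasure_distr) (simp_all add: measurable_Complex)
  also have "\<dots> = emeasure lborel {Im l<..<Im u} * emeasure lborel {Re l<..<Re u}"
    by (rule lborel.emeasure_pair_measure_Times) auto
  also have "\<dots> = (\<Prod>b\<in>Basis. (u - l) \<bullet> b)"
    using le by (simp add: Basis_complex_def ennreal_mult[symmetric] mult.commute)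
  finally show "emeasure (distr (lborel \<Otimes>\<^sub>M lborel) borel (\<lambda>(y, x). Complex x y)) (box l u)
    = (\<Prod>b\<in>Basis. (u - l) \<bullet> b)" .
qed simp

lemma integrable_lborel_complex:
  fixes f :: "complex \<Rightarrow> real"
  assumes "f \<in> borel_measurable borel"
  shows "integrable lborel f \<longleftrightarrow> integrable (lborel \<Otimes>\<^sub>M lborel) (\<lambda>(y, x). f (Complex x y))"
  by (subst lborel_complex, subst integrable_distr_eq)
     (use assms measurable_Complex in \<open>auto simp: case_prod_unfold\<close>)

lemma
  fixes f :: "complex \<Rightarrow> real"
  assumes "integrable lborel f"
  shows integrable_row_integrals: "integrable lborel (\<lambda>y. LINT x|lborel. f (Complex x y))"
    and integral_lborel_complex: "(LINT z|lborel. f z) = (LINT y|lborel. LINT x|lborel. f (Complex x y))"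
proof -
  have m: "f \<in> borel_measurable borel" using assms by auto
  then have i: "integrable (lborel \<Otimes>\<^sub>M lborel) (\<lambda>(y, x). f (Complex x y))"
    using assms integrable_lborel_complex by blast
  show "integrable lborel (\<lambda>y. LINT x|lborel. f (Complex x y))"
    using lborel_pair.integrable_fst'[OF i] by simp
  have "(LINT z|lborel. f z) = (LINT u|(lborel \<Otimes>\<^sub>M lborel). f (case u of (y, x) \<Rightarrow> Complex x y))"
    by (subst lborel_complex, subst integral_distr) (use m measurable_Complex in auto)
  also have "\<dots> = (LINT u|(lborel \<Otimes>\<^sub>M lborel). (\<lambda>(y, x). f (Complex x y)) u)"
    by (simp add: case_prod_unfold)
  also have "\<dots> = (LINT y|lborel. LINT x|lborel. f (Complex x y))"
    using lborel_pair.integral_fst'[OF i] by simp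
  finally show "(LINT z|lborel. f z) = (LINT y|lborel. LINT x|lborel. f (Complex x y))" .
qed

lemma bounded_set_continuous_bound:
  fixes \<psi> :: "complex \<Rightarrow> real"
  assumes "bounded S" "continuous_on UNIV \<psi>"
  obtains M where "M \<ge> 0" "\<And>z. z \<in> S \<Longrightarrow> \<bar>\<psi> z\<bar> \<le> M"
proof -
  have "compact (closure S)" using assms(1) by simp
  then obtain M where "\<And>z. z \<in> closure S \<Longrightarrow> norm (\<psi> z) \<le> M"
    using compact_norm_bound[OF _ continuous_on_subset[OF assms(2) subset_UNIV]] by metis
  then show ?thesis
    using closure_subset[of S] by (intro that[of "max M 0"]) (auto simp: le_max_iff_disj)
qed

lemma set_integrable_mult_continuous:
  fixes \<psi> g :: "complex \<Rightarrow> real"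
  assumes "bounded S" "continuous_on UNIV \<psi>" "set_integrable lborel S g"
  shows "set_integrable lborel S (\<lambda>z. g z * \<psi> z)"
proof -
  obtain M where M: "M \<ge> 0" "\<And>z. z \<in> S \<Longrightarrow> \<bar>\<psi> z\<bar> \<le> M" using bounded_set_continuous_bound[OF assms(1,2)] by blast
  have [measurable]: "\<psi> \<in> borel_measurable borel" by (rule borel_measurable_continuous_onI[OF assms(2)])
  have gi: "integrable lborel (\<lambda>z. indicator S z *\<^sub>R g z)" using assms(3) by (simp add: set_integrable_def)
  then have [measurable]: "(\<lambda>z. indicator S z *\<^sub>R g z) \<in> borel_measurable lborel" by auto
  have eq: "indicator S z *\<^sub>R (g z * \<psi> z) = (indicator S z *\<^sub>R g z) * \<psi> z" for z by simp
  show ?thesis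
    unfolding set_integrable_def eq
  proof (rule Bochner_Integration.integrable_bound[OF integrable_mult_right[OF gi, of M]])
    show "(\<lambda>z. (indicator S z *\<^sub>R g z) * \<psi> z) \<in> borel_measurable lborel" by measurable
    show "AE z in lborel. norm ((indicator S z *\<^sub>R g z) * \<psi> z) \<le> norm (M * (indicator S z *\<^sub>R g z))"
      using M by (intro AE_I2) (auto simp: indicator_def abs_mult mult.commute[of M] mult_left_mono)
  qed
qed

lemma set_integrable_continuous_bounded:
  fixes \<psi> :: "complex \<Rightarrow> real"
  assumes "bounded S" "S \<in> sets borel" "continuous_on UNIV \<psi>"
  shows "set_integrable lborel S \<psi>"
proof -
  have "set_integrable lborel S (\<lambda>_. 1 :: real)"
    using emeasure_bounded_finite[OF assms(1)] assms(2)
    unfolding set_integrable_def by (simp add: integrable_real_indicator)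
  from set_integrable_mult_continuous[OF assms(1,3) this] show ?thesis by simp
qed

text \<open>Bridge from gauge integrals, where powers with a singularity at 0 are available, to
  Lebesgue integrability.\<close>

lemma integrable_nonneg_HK:
  fixes f :: "real \<Rightarrow> real"
  assumes "f \<in> borel_measurable borel" "\<And>x. f x \<ge> 0" "f integrable_on UNIV"
  shows "integrable lborel f"
proof (rule integrableI_bounded)
  obtain I where "(f has_integral I) UNIV" using assms(3) by blast
  then have "(\<integral>\<^sup>+x. ennreal (f x) \<partial>lborel) = ennreal I"
    by (rule nn_integral_has_integral_lborel[OF assms(1,2)])
  then show "(\<integral>\<^sup>+x. ennreal (norm (f x)) \<partial>lborel) < \<infinity>" using assms(2) by simp
qed (use assms in simp)

section \<open>Integration over a fundamental domain\<close>

context rhombic_torus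
begin

text \<open>A fundamental domain whose rows all cover the same interval; it replaces the slanted
  \<open>fund_domain\<close> in computations.\<close>

definition rect :: "complex set" where
  "rect = {z. - 1 / 2 \<le> Re z \<and> Re z < 1 / 2 \<and> 0 \<le> Im z \<and> Im z < b}"

lemma fund_domain_iff:
  "z \<in> fund_domain tau \<longleftrightarrow> 0 \<le> Im z \<and> Im z < b \<and> Im z / (2 * b) \<le> Re z \<and> Re z < Im z / (2 * b) + 1"
proof
  assume "z \<in> fund_domain tau"
  then obtain s t where st: "z = of_real s + of_real t * tau" "0 \<le> s" "s < 1" "0 \<le> t" "t < 1"
    by (auto simp: fund_domain_def)
  then show "0 \<le> Im z \<and> Im z < b \<and> Im z / (2 * b) \<le> Re z \<and> Re z < Im z / (2 * b) + 1"
    using b_pos by simp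
next
  assume a: "0 \<le> Im z \<and> Im z < b \<and> Im z / (2 * b) \<le> Re z \<and> Re z < Im z / (2 * b) + 1"
  have "z = of_real (Re z - Im z / (2 * b)) + of_real (Im z / b) * tau"
    using b_pos by (simp add: complex_eq_iff)
  then show "z \<in> fund_domain tau"
    unfolding fund_domain_def using a b_pos
    by (intro CollectI exI[of _ "Re z - Im z / (2 * b)"] exI[of _ "Im z / b"]) auto
qed

lemma rect_measurable [measurable]: "rect \<in> sets borel"
  unfolding rect_def by measurable

lemma fund_domain_measurable [measurable]: "fund_domain tau \<in> sets borel"
proof -
  have "fund_domain tau = {z. 0 \<le> Im z \<and> Im z < b \<and> Im z / (2 * b) \<le> Re z \<and> Re z < Im z / (2 * b) + 1}"
    using fund_domain_iff by auto
  also have "\<dots> \<in> sets borel" by measurable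
  finally show ?thesis .
qed

text \<open>The part of the fundamental parallelogram to the right of \<open>Re z = 1 / 2\<close> is moved by \<open>- 1\<close>.\<close>

lemma
  fixes f :: "complex \<Rightarrow> real"
  assumes f: "set_integrable lborel rect f" and per: "\<And>z. f (z + 1) = f z"
  shows set_integrable_fund_domain: "set_integrable lborel (fund_domain tau) f"
    and set_integral_fund_domain: "(LINT z:fund_domain tau|lborel. f z) = (LINT z:rect|lborel. f z)"
proof -
  define A where "A = fund_domain tau \<inter> rect"
  define B where "B = rect - fund_domain tau"
  have [measurable]: "A \<in> sets borel" "B \<in> sets borel" by (auto simp: A_def B_def)
  define fA where "fA = (\<lambda>z. indicator A z *\<^sub>R f z)"
  define fB where "fB = (\<lambda>z. indicator B z *\<^sub>R f z)"
  have iA: "integrable lborel fA" and iB: "integrable lborel fB"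
    using set_integrable_subset[OF f, of A] set_integrable_subset[OF f, of B]
    by (auto simp: fA_def fB_def set_integrable_def A_def B_def)
  have mB: "fB \<in> borel_measurable borel" using iB by auto
  have iB': "integrable lborel (\<lambda>z. fB (- 1 + z))"
    using iB mB integrable_distr_eq[of "(+) (- 1)" lborel borel fB] lborel_distr_plus[of "- 1 :: complex"]
    by simp
  have eB: "(LINT z|lborel. fB (- 1 + z)) = (LINT z|lborel. fB z)"
    using mB integral_distr[of "(+) (- 1)" lborel borel fB] lborel_distr_plus[of "- 1 :: complex"]
    by simp
  have Bshift: "- 1 + z \<in> B \<longleftrightarrow> z \<in> fund_domain tau - rect" for z
  proof -
    define t where "t = Im z / (2 * b)"
    show ?thesis
    proof (cases "0 \<le> Im z \<and> Im z < b")
      case True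
      then have t: "0 \<le> t" "t < 1 / 2" using b_pos by (simp_all add: t_def field_simps)
      have "- 1 / 2 \<le> - 1 + x \<and> - 1 + x < 1 / 2 \<and> \<not> (s \<le> - 1 + x \<and> - 1 + x < s + 1) \<longleftrightarrow>
          (s \<le> x \<and> x < s + 1) \<and> \<not> (- 1 / 2 \<le> x \<and> x < 1 / 2)" if "0 \<le> s" "s < 1 / 2" for s x :: real
        using that by auto
      from this[OF t, of "Re z"] True show ?thesis
        unfolding t_def by (simp add: B_def rect_def fund_domain_iff)
    qed (auto simp: B_def rect_def fund_domain_iff)
  qed
  have "f (- 1 + z) = f z" for z using per[of "- 1 + z"] by simp
  then have split: "indicator (fund_domain tau) z *\<^sub>R f z = fA z + fB (- 1 + z)" for z
    unfolding fA_def fB_def using Bshift[of z] by (auto simp: indicator_def A_def)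
  have split': "indicator rect z *\<^sub>R f z = fA z + fB z" for z
    unfolding fA_def fB_def by (auto simp: indicator_def A_def B_def)
  show "set_integrable lborel (fund_domain tau) f"
    unfolding set_integrable_def split using iA iB' by (rule Bochner_Integration.integrable_add)
  show "(LINT z:fund_domain tau|lborel. f z) = (LINT z:rect|lborel. f z)"
    unfolding set_lebesgue_integral_def split split'
    using Bochner_Integration.integral_add[OF iA iB'] Bochner_Integration.integral_add[OF iA iB] eB by simp
qed

lemma theta_measurable [measurable]: "theta \<in> borel_measurable borel"
  by (rule borel_measurable_continuous_onI) (rule continuous_on_theta[OF continuous_on_id])

lemma lattice_measurable [measurable]: "\<Lambda> \<in> sets borel"
  using closed_lattice by (rule borel_closed)

lemma green_fun_measurable [measurable]: "green_fun c \<in> borel_measurable borel"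
  unfolding green_fun_def[abs_def] by measurable

text \<open>The singularities at the lower and upper edge are logarithmic, and
  \<open>z \<mapsto> tau - z\<close> reduces the upper half to the lower.\<close>

lemma green_fun_row_bound:
  obtains D where "integrable lborel D" "D \<in> borel_measurable borel" "\<And>y. D y \<ge> (0::real)"
    "\<And>x y. \<bar>x\<bar> \<le> 1 / 2 \<Longrightarrow> 0 < y \<Longrightarrow> y < b \<Longrightarrow> \<bar>green_fun c (Complex x y)\<bar> \<le> D y"
proof -
  obtain K where K: "K > 0"
    "\<And>x y. \<bar>x\<bar> \<le> 1 / 2 \<Longrightarrow> 0 < y \<Longrightarrow> y \<le> b / 2 \<Longrightarrow> \<bar>green_fun c (Complex x y)\<bar> \<le> K * (1 + \<bar>ln y\<bar>)"
    using green_near_bottom[of c] by metis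
  \<comment> \<open>Integrable majorant of \<open>1 + \<bar>ln y\<bar>\<close>: the inequality
    \<open>ln u \<le> u - 1\<close> at \<open>u = y\<close> handles the positive part and at
    \<open>u = y powr (- 1/2)\<close> the negative part.\<close>
  define k where "k = (\<lambda>y::real. if y \<in> {0..b} then 1 + y + 2 * y powr (- 1 / 2) else 0)"
  have k_meas: "k \<in> borel_measurable borel" unfolding k_def by measurable
  have k_nn: "k y \<ge> 0" for y by (simp add: k_def)
  have "(\<lambda>y::real. 1 + y + 2 * y powr (- 1 / 2)) integrable_on {0..b}"
  proof -
    have "(\<lambda>y::real. y powr (- 1 / 2)) integrable_on {0..b}"
      using has_integral_powr_from_0[of "-1/2" b] b_pos by (auto simp: integrable_on_def)
    moreover have "(\<lambda>y::real. 1 + y) integrable_on {0..b}"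
      by (intro integrable_continuous_real continuous_intros)
    ultimately show ?thesis
      by (intro integrable_add[of "\<lambda>y. 1 + y"] integrable_on_mult_right)
  qed
  then have "k integrable_on UNIV" unfolding k_def by (simp only: integrable_restrict_UNIV)
  then have k_int: "integrable lborel k" by (rule integrable_nonneg_HK[OF k_meas k_nn])
  then have k_int': "integrable lborel (\<lambda>y. k (b - y))"
    using lborel_integrable_real_affine[of k "-1" b] by simp
  have k_ln: "1 + \<bar>ln y\<bar> \<le> k y" if "0 < y" "y \<le> b" for y
  proof -
    have "ln y \<le> y - 1" by (rule ln_le_minus_one) fact
    moreover have "- ln y \<le> 2 * y powr (- 1 / 2)"
    proof -
      have "- ln y / 2 = ln (y powr (- 1 / 2))" using that by (simp add: ln_powr)
      also have "\<dots> \<le> y powr (- 1 / 2) - 1" using that by (intro ln_le_minus_one) simp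
      finally show ?thesis by simp
    qed
    moreover have "0 \<le> y powr (- 1 / 2)" by simp
    ultimately have "\<bar>ln y\<bar> \<le> y + 2 * y powr (- 1 / 2)" using that by linarith
    then show ?thesis using that by (simp add: k_def)
  qed
  define D where "D = (\<lambda>y. K * (k y + k (b - y)))"
  have Dk: "K * k y \<le> D y" "K * k (b - y) \<le> D y" for y
    using K k_nn[of y] k_nn[of "b - y"] by (auto simp: D_def distrib_left)
  show ?thesis
  proof (rule that[of D])
    show "integrable lborel D" unfolding D_def using k_int k_int' by simp
    show "D \<in> borel_measurable borel" unfolding D_def using k_meas by measurable
    show "D y \<ge> 0" for y using K k_nn[of y] k_nn[of "b - y"] by (simp add: D_def)
    fix x y :: real assume xy: "\<bar>x\<bar> \<le> 1 / 2" "0 < y" "y < b"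
    show "\<bar>green_fun c (Complex x y)\<bar> \<le> D y"
    proof (cases "y \<le> b / 2")
      case True
      have "\<bar>green_fun c (Complex x y)\<bar> \<le> K * (1 + \<bar>ln y\<bar>)" using xy True by (intro K)
      also have "\<dots> \<le> K * k y" using K k_ln[of y] xy by (intro mult_left_mono) auto
      finally show ?thesis using Dk(1)[of y] by linarith
    next
      case False
      have bound: "\<bar>green_fun c (Complex x' (b - y))\<bar> \<le> D y" if "\<bar>x'\<bar> \<le> 1 / 2" for x'
      proof -
        have "\<bar>green_fun c (Complex x' (b - y))\<bar> \<le> K * (1 + \<bar>ln (b - y)\<bar>)" using xy False that by (intro K) auto
        also have "\<dots> \<le> K * k (b - y)" using K k_ln[of "b - y"] xy by (intro mult_left_mono) auto
        finally show ?thesis using Dk(2)[of y] by linarith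
      qed
      have e1: "green_fun c (Complex x y) = green_fun c (Complex (1/2 - x) (b - y))"
      proof -
        have "Complex (1/2 - x) (b - y) = - Complex x y + tau" by (simp add: complex_eq_iff)
        then show ?thesis by (simp only: green_fun_lattice[OF lattice_tau] green_fun_uminus)
      qed
      show ?thesis
      proof (cases "x \<ge> 0")
        case True
        then show ?thesis unfolding e1 using xy by (intro bound) auto
      next
        case False
        \<comment> \<open>For \<open>x < 0\<close> the reflected abscissa \<open>1/2 - x\<close>
          exceeds \<open>1/2\<close> and is brought back by the period 1.\<close>
        have "Complex (1/2 - x) (b - y) = Complex (- 1/2 - x) (b - y) + 1" by (simp add: complex_eq_iff)
        then have "green_fun c (Complex x y) = green_fun c (Complex (- 1/2 - x) (b - y))"
          unfolding e1 by (simp only: green_fun_lattice[OF lattice_1])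
        then show ?thesis using bound[of "- 1/2 - x"] xy False by auto
      qed
    qed
  qed
qed

lemma indicator_rect: "indicator rect (Complex x y) = (indicator {-1/2..<1/2} x * indicator {0..<b} y :: real)"
  by (auto simp: rect_def indicator_def)

text \<open>Row-wise domination; the row \<open>y = 0\<close> through the pole is
  negligible.\<close>

lemma set_integrable_rect_green_fun: "set_integrable lborel rect (green_fun c)"
proof -
  obtain D where D: "integrable lborel D" "D \<in> borel_measurable borel" "\<And>y. D y \<ge> (0::real)"
    "\<And>x y. \<bar>x\<bar> \<le> 1 / 2 \<Longrightarrow> 0 < y \<Longrightarrow> y < b \<Longrightarrow> \<bar>green_fun c (Complex x y)\<bar> \<le> D y"
    using green_fun_row_bound[of c] by blast
  define f where "f = (\<lambda>z. indicator rect z *\<^sub>R green_fun c z)"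
  have fm[measurable]: "f \<in> borel_measurable borel" unfolding f_def by measurable
  have f2m[measurable]: "(\<lambda>(y, x). f (Complex x y)) \<in> borel_measurable (lborel \<Otimes>\<^sub>M lborel)"
    using measurable_compose[OF measurable_Complex fm] by (simp add: case_prod_unfold)
  have rowm: "(\<lambda>x. f (Complex x y)) \<in> borel_measurable lborel" for y
    using measurable_compose_Pair1[OF _ f2m, of y] by simp
  have fb: "norm (f (Complex x y)) \<le> D y * indicator {-1/2..1/2} x" if "y \<noteq> 0" for x y
  proof (cases "Complex x y \<in> rect")
    case True
    then have "\<bar>x\<bar> \<le> 1 / 2" "0 < y" "y < b" using that by (auto simp: rect_def)
    moreover have "x \<in> {-1/2..1/2}" using True by (auto simp: rect_def)
    ultimately show ?thesis using D(4) True by (simp add: f_def)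
  qed (simp add: f_def D(3))
  have ind: "integrable lborel (\<lambda>x::real. D y * indicator {-1/2..1/2} x)" for y
    by (intro integrable_mult_right) simp
  have row: "integrable lborel (\<lambda>x. f (Complex x y))" if "y \<noteq> 0" for y
    by (rule Bochner_Integration.integrable_bound[OF ind[of y] rowm])
       (use fb[OF that] D(3) in \<open>auto simp: abs_mult\<close>)
  have "integrable (lborel \<Otimes>\<^sub>M lborel) (\<lambda>(y, x). f (Complex x y))"
  proof (rule lborel_pair.Fubini_integrable[OF f2m])
    show "AE y in lborel. integrable lborel (\<lambda>x. (\<lambda>(y, x). f (Complex x y)) (y, x))"
      using AE_lborel_singleton[of 0] by eventually_elim (simp add: row)
    show "integrable lborel (\<lambda>y. LINT x|lborel. norm ((\<lambda>(y, x). f (Complex x y)) (y, x)))"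
    proof (rule Bochner_Integration.integrable_bound[OF D(1)])
      show "AE y in lborel. norm (LINT x|lborel. norm ((\<lambda>(y, x). f (Complex x y)) (y, x))) \<le> norm (D y)"
        using AE_lborel_singleton[of 0]
      proof eventually_elim
        case (elim y)
        have "(LINT x|lborel. norm (f (Complex x y))) \<le> (LINT x|lborel. D y * indicator {-1/2..1/2::real} x)"
          by (intro integral_mono integrable_norm row ind fb elim)
        also have "\<dots> = D y" by simp
        finally show ?case using D(3)[of y] by (simp add: integral_nonneg_AE)
      qed
      show "(\<lambda>y. LINT x|lborel. norm ((\<lambda>(y, x). f (Complex x y)) (y, x))) \<in> borel_measurable lborel"
        by (rule lborel.borel_measurable_lebesgue_integral) (use f2m in \<open>auto simp: case_prod_unfold\<close>)
    qed
  qed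
  then have "integrable lborel f" using integrable_lborel_complex[OF fm] by blast
  then show ?thesis by (simp add: set_integrable_def f_def)
qed

lemma bounded_rect: "bounded rect"
  by (rule bounded_subset[OF bounded_cbox[of "Complex (-1/2) 0" "Complex (1/2) b"]])
     (auto simp: rect_def in_cbox_complex_iff)

lemmas set_integrable_rect_mult = set_integrable_mult_continuous[OF bounded_rect]
  and set_integrable_rect_continuous = set_integrable_continuous_bounded[OF bounded_rect rect_measurable]

lemma measure_fund_domain: "measure lborel (fund_domain tau) = b"
proof -
  have i: "set_integrable lborel rect (\<lambda>_. 1 :: real)" by (rule set_integrable_rect_continuous) simp
  then have i': "integrable lborel (indicator rect :: complex \<Rightarrow> real)" by (simp add: set_integrable_def)
  have "(LINT z:fund_domain tau|lborel. 1) = (LINT z:rect|lborel. (1::real))"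
    by (rule set_integral_fund_domain[OF i]) simp
  then have "measure lborel (fund_domain tau) = (LINT z|lborel. indicator rect z)"
    by (simp add: set_lebesgue_integral_def)
  also have "\<dots> = (LINT y|lborel. LINT x|lborel. indicator rect (Complex x y))"
    by (rule integral_lborel_complex[OF i'])
  also have "\<dots> = b" using b_pos by (simp add: indicator_rect)
  finally show ?thesis .
qed

end

context torus_test
begin

text \<open>The rectangle is exhausted by the strips of \<open>green_identity\<close>: dominated
  convergence gives the limit of one side, \<open>wronskian_jump_limit\<close> that of the
  other.\<close>

lemma integral_rect_green_laplacian:
  fixes c :: real
  defines "f \<equiv> \<lambda>z. green_fun c z * (\<phi>xx z + \<phi>yy z) - \<phi> z / b"
  shows "set_integrable lborel rect f" "(LINT z:rect|lborel. f z) = - \<phi> 0"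
proof -
  have c1: "continuous_on UNIV (\<lambda>z. \<phi>xx z + \<phi>yy z)" "continuous_on UNIV (\<lambda>z. \<phi> z / b)"
    using b_pos by (auto intro!: continuous_intros cont)
  show fi: "set_integrable lborel rect f"
    unfolding f_def by (intro set_integral_diff set_integrable_rect_mult set_integrable_rect_green_fun
        set_integrable_rect_continuous c1)
  define H where "H = (\<lambda>y. LINT x|lborel. indicator rect (Complex x y) *\<^sub>R f (Complex x y))"
  have fi': "integrable lborel (\<lambda>z. indicator rect z *\<^sub>R f z)" using fi by (simp add: set_integrable_def)
  have Hi: "integrable lborel H" unfolding H_def by (rule integrable_row_integrals[OF fi'])
  have fH: "(LINT z:rect|lborel. f z) = (LINT y|lborel. H y)"
    unfolding H_def set_lebesgue_integral_def by (rule integral_lborel_complex[OF fi'])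
  have H_eq: "H y = integral {-1/2..1/2} (\<lambda>x. f (Complex x y))" if y: "0 < y" "y < b" for y
  proof -
    have "continuous_on {-1/2..1/2} (\<lambda>x. f (Complex x y))"
      unfolding f_def using not_lattice_Im[OF y]
      by (intro continuous_intros continuous_on_Complex_compose[OF continuous_on_green_fun]
          continuous_on_Complex_compose[OF cont(1)]
          continuous_on_Complex_compose[OF cont(4)] continuous_on_Complex_compose[OF cont(5)])
         (use b_pos in auto)
    then have "set_integrable lborel {-1/2..1/2} (\<lambda>x. f (Complex x y))"
      by (rule borel_integrable_atLeastAtMost')
    then have s: "set_integrable lborel {-1/2..<1/2} (\<lambda>x. f (Complex x y))"
      by (rule set_integrable_subset) auto
    have "H y = (LINT x:{-1/2..<1/2}|lborel. f (Complex x y))"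
      using y unfolding H_def set_lebesgue_integral_def indicator_rect by simp
    also have "\<dots> = integral {-1/2..<1/2} (\<lambda>x. f (Complex x y))"
      by (rule set_borel_integral_eq_integral(2)[OF s])
    also have "\<dots> = integral {-1/2..1/2} (\<lambda>x. f (Complex x y))"
      by (rule integral_spike_set; rule negligible_subset[OF negligible_sing[of "1/2"]]) auto
    finally show ?thesis .
  qed
  have H_0: "H y = 0" if "y \<notin> {0..<b}" for y
    using that unfolding H_def indicator_rect by simp
  \<comment> \<open>A null sequence in the open interval from 0 to \<open>b / 2\<close>; the offset
    3 keeps already \<open>e 0\<close> below \<open>b / 2\<close>.\<close>
  define e where "e = (\<lambda>n::nat. b / (n + 3))"
  have e: "0 < e n" "e n < b / 2" for n
    unfolding e_def using b_pos by (intro divide_pos_pos divide_strict_left_mono mult_pos_pos; simp)+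
  have e_lim: "e \<longlonglongrightarrow> 0" unfolding e_def by real_asymp
  have "(\<lambda>n. LINT y|lborel. indicator {e n..b - e n} y *\<^sub>R H y) \<longlonglongrightarrow> (LINT y|lborel. H y)"
  proof (rule integral_dominated_convergence[where w = "\<lambda>y. \<bar>H y\<bar>"])
    show "AE y in lborel. (\<lambda>n. indicator {e n..b - e n} y *\<^sub>R H y) \<longlonglongrightarrow> H y"
      using AE_lborel_singleton[of 0]
    proof eventually_elim
      case (elim y)
      show ?case
      proof (cases "y \<in> {0..<b}")
        case True
        then have y: "0 < y" "y < b" using elim by auto
        have "\<forall>\<^sub>F n in sequentially. e n < y" "\<forall>\<^sub>F n in sequentially. e n < b - y"
          using e_lim y by (auto intro: order_tendstoD(2))
        then have "\<forall>\<^sub>F n in sequentially. indicator {e n..b - e n} y *\<^sub>R H y = H y"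
          by eventually_elim (simp add: indicator_def)
        then show ?thesis by (rule tendsto_eventually)
      qed (simp add: H_0)
    qed
  qed (use Hi in \<open>auto simp: indicator_def\<close>)
  moreover have "(LINT y|lborel. indicator {e n..b - e n} y *\<^sub>R H y) =
      integral {-1/2..1/2} (\<lambda>x. wronskian c (Complex x (b - e n)) - wronskian c (Complex x (e n)))" for n
  proof -
    have "set_integrable lborel {e n..b - e n} H"
      using Hi unfolding set_integrable_def by (intro integrable_mult_indicator) auto
    then have "(LINT y:{e n..b - e n}|lborel. H y) = integral {e n..b - e n} H"
      by (rule set_borel_integral_eq_integral(2))
    also have "\<dots> = integral {e n..b - e n} (\<lambda>y. integral {-1/2..1/2} (\<lambda>x. f (Complex x y)))"
    proof (rule integral_cong)
      fix y assume "y \<in> {e n..b - e n}"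
      then show "H y = integral {-1/2..1/2} (\<lambda>x. f (Complex x y))"
        using e(1)[of n] by (intro H_eq) auto
    qed
    also have "\<dots> = integral {-1/2..1/2} (\<lambda>x. wronskian c (Complex x (b - e n)) - wronskian c (Complex x (e n)))"
      unfolding f_def by (rule green_identity[OF e])
    finally show ?thesis by (simp add: set_lebesgue_integral_def)
  qed
  ultimately have "(\<lambda>n. integral {-1/2..1/2} (\<lambda>x. wronskian c (Complex x (b - e n)) - wronskian c (Complex x (e n))))
      \<longlonglongrightarrow> (LINT y|lborel. H y)" by simp
  then have "(LINT y|lborel. H y) = - \<phi> 0"
    using wronskian_jump_limit[OF e e_lim, of c] LIMSEQ_unique by blast
  then show "(LINT z:rect|lborel. f z) = - \<phi> 0" by (simp add: fH)
qed

end

section \<open>Smooth periodic functions as test functions\<close>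

lemma smooth_dir_deriv: "smooth f \<Longrightarrow> smooth (dir_deriv v f)"
  unfolding smooth_def
proof (intro allI)
  fix vs z assume "\<forall>vs z. foldr dir_deriv vs f differentiable (at z)"
  then have "foldr dir_deriv (vs @ [v]) f differentiable (at z)" by blast
  then show "foldr dir_deriv vs (dir_deriv v f) differentiable (at z)" by simp
qed

lemma smooth_has_derivative:
  assumes "smooth f"
  shows "(f has_derivative (\<lambda>h. dir_deriv 1 f z * Re h + dir_deriv \<i> f z * Im h)) (at z)"
proof -
  have "foldr dir_deriv [] f differentiable (at z)" using assms unfolding smooth_def by blast
  then have d: "(f has_derivative frechet_derivative f (at z)) (at z)"
    by (simp add: frechet_derivative_works)
  interpret bounded_linear "frechet_derivative f (at z)" using d by (rule has_derivative_bounded_linear)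
  have "frechet_derivative f (at z) h = dir_deriv 1 f z * Re h + dir_deriv \<i> f z * Im h" for h
  proof -
    have "h = Re h *\<^sub>R 1 + Im h *\<^sub>R \<i>" by (simp add: complex_eq_iff)
    then have "frechet_derivative f (at z) h = frechet_derivative f (at z) (Re h *\<^sub>R 1 + Im h *\<^sub>R \<i>)" by simp
    then show ?thesis by (simp add: add scaleR dir_deriv_def mult.commute)
  qed
  then have "frechet_derivative f (at z) = (\<lambda>h. dir_deriv 1 f z * Re h + dir_deriv \<i> f z * Im h)" by blast
  then show ?thesis using d by simp
qed

lemma dir_deriv_eq:
  assumes "(f has_derivative D) (at z)"
  shows "dir_deriv v f z = D v"
  using frechet_derivative_at[OF assms] by (simp add: dir_deriv_def)

lemma smooth_continuous_on: "smooth f \<Longrightarrow> continuous_on A f"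
  by (intro continuous_at_imp_continuous_on ballI has_derivative_continuous[OF smooth_has_derivative])

lemma smooth_dir_deriv_shift:
  assumes "smooth f" "\<And>z. f (z + w) = f z"
  shows "dir_deriv v f (z + w) = dir_deriv v f z"
proof -
  have "((\<lambda>x. x + w) has_derivative (\<lambda>h. h)) (at z)" by (auto intro!: derivative_eq_intros)
  from has_derivative_compose[OF this smooth_has_derivative[OF assms(1)]]
  have "(f has_derivative (\<lambda>h. dir_deriv 1 f (z + w) * Re h + dir_deriv \<i> f (z + w) * Im h)) (at z)"
    by (simp add: assms(2))
  then have "dir_deriv v f z = dir_deriv 1 f (z + w) * Re v + dir_deriv \<i> f (z + w) * Im v"
    by (rule dir_deriv_eq)
  moreover have "dir_deriv v f (z + w) = dir_deriv 1 f (z + w) * Re v + dir_deriv \<i> f (z + w) * Im v"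
    by (rule dir_deriv_eq[OF smooth_has_derivative[OF assms(1)]])
  ultimately show ?thesis by simp
qed

lemma smooth_Lipschitz:
  assumes "smooth f"
  obtains L where "\<And>z w. z \<in> cball 0 R \<Longrightarrow> w \<in> cball 0 R \<Longrightarrow> \<bar>f z - f w\<bar> \<le> L * norm (z - w)" "L \<ge> 0"
proof -
  have c: "continuous_on (cball 0 R) (\<lambda>z. \<bar>dir_deriv 1 f z\<bar> + \<bar>dir_deriv \<i> f z\<bar>)"
    by (intro continuous_intros smooth_continuous_on smooth_dir_deriv assms)
  obtain L where L: "\<And>z. z \<in> cball 0 R \<Longrightarrow> norm (\<bar>dir_deriv 1 f z\<bar> + \<bar>dir_deriv \<i> f z\<bar>) \<le> L"
    using compact_norm_bound[OF compact_cball c] by blast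
  have "\<bar>f z - f w\<bar> \<le> \<bar>L\<bar> * norm (z - w)" if "z \<in> cball 0 R" "w \<in> cball 0 R" for z w
  proof -
    have "norm (f z - f w) \<le> \<bar>L\<bar> * norm (z - w)"
    proof (rule differentiable_bound[where S = "cball 0 R"])
      show "(f has_derivative (\<lambda>h. dir_deriv 1 f x * Re h + dir_deriv \<i> f x * Im h)) (at x within cball 0 R)" for x
        by (rule has_derivative_at_withinI[OF smooth_has_derivative[OF assms]])
      show "onorm (\<lambda>h. dir_deriv 1 f x * Re h + dir_deriv \<i> f x * Im h) \<le> \<bar>L\<bar>" if "x \<in> cball 0 R" for x
      proof (rule onorm_le)
        fix h
        have "\<bar>dir_deriv 1 f x * Re h + dir_deriv \<i> f x * Im h\<bar> \<le> \<bar>dir_deriv 1 f x\<bar> * \<bar>Re h\<bar> + \<bar>dir_deriv \<i> f x\<bar> * \<bar>Im h\<bar>"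
          using abs_triangle_ineq[of "dir_deriv 1 f x * Re h" "dir_deriv \<i> f x * Im h"]
          by (simp only: abs_mult)
        also have "\<dots> \<le> \<bar>dir_deriv 1 f x\<bar> * norm h + \<bar>dir_deriv \<i> f x\<bar> * norm h"
          by (intro add_mono mult_left_mono abs_Re_le_cmod abs_Im_le_cmod) auto
        also have "\<dots> = (\<bar>dir_deriv 1 f x\<bar> + \<bar>dir_deriv \<i> f x\<bar>) * norm h" by (simp add: distrib_right)
        also have "\<dots> \<le> \<bar>L\<bar> * norm h" using L[OF that] by (intro mult_right_mono) auto
        finally show "norm (dir_deriv 1 f x * Re h + dir_deriv \<i> f x * Im h) \<le> \<bar>L\<bar> * norm h" by simp
      qed
    qed (use that in auto)
    then show ?thesis by simp
  qed
  then show ?thesis using that[of "\<bar>L\<bar>"] by simp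
qed

context rhombic_torus
begin

lemma torus_test_smooth:
  assumes "smooth f" "periodic tau f"
  shows "torus_test b f (dir_deriv 1 f) (dir_deriv \<i> f) (dir_deriv 1 (dir_deriv 1 f)) (dir_deriv \<i> (dir_deriv \<i> f))"
proof
  have s1: "smooth (dir_deriv 1 f)" "smooth (dir_deriv \<i> f)" using assms(1) by (auto intro: smooth_dir_deriv)
  show "((\<lambda>t. f (Complex t y)) has_real_derivative dir_deriv 1 f (Complex x y)) (at x)" for x y
    by (rule has_derivative_partials[OF smooth_has_derivative[OF assms(1)]])
  show "((\<lambda>t. f (Complex x t)) has_real_derivative dir_deriv \<i> f (Complex x y)) (at y)" for x y
    by (rule has_derivative_partials[OF smooth_has_derivative[OF assms(1)]])
  show "((\<lambda>t. dir_deriv 1 f (Complex t y)) has_real_derivative dir_deriv 1 (dir_deriv 1 f) (Complex x y)) (at x)" for x y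
    by (rule has_derivative_partials[OF smooth_has_derivative[OF s1(1)]])
  show "((\<lambda>t. dir_deriv \<i> f (Complex x t)) has_real_derivative dir_deriv \<i> (dir_deriv \<i> f) (Complex x y)) (at y)" for x y
    by (rule has_derivative_partials[OF smooth_has_derivative[OF s1(2)]])
  show "continuous_on UNIV f" "continuous_on UNIV (dir_deriv 1 f)" "continuous_on UNIV (dir_deriv \<i> f)"
    "continuous_on UNIV (dir_deriv 1 (dir_deriv 1 f))" "continuous_on UNIV (dir_deriv \<i> (dir_deriv \<i> f))"
    by (intro smooth_continuous_on smooth_dir_deriv assms)+
  show p: "f (z + w) = f z" if "w \<in> \<Lambda>" for z w using assms(2) that by (simp add: periodic_def)
  show "dir_deriv 1 f (z + w) = dir_deriv 1 f z" "dir_deriv \<i> f (z + w) = dir_deriv \<i> f z" if "w \<in> \<Lambda>" for z w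
    using p that by (intro smooth_dir_deriv_shift assms; simp)+
  show "\<exists>L. \<forall>z\<in>cball 0 R. \<forall>w\<in>cball 0 R. \<bar>f z - f w\<bar> \<le> L * norm (z - w) \<and>
      \<bar>dir_deriv \<i> f z - dir_deriv \<i> f w\<bar> \<le> L * norm (z - w)" for R
  proof -
    obtain L1 where L1: "L1 \<ge> 0" "\<And>z w. z \<in> cball 0 R \<Longrightarrow> w \<in> cball 0 R \<Longrightarrow> \<bar>f z - f w\<bar> \<le> L1 * norm (z - w)"
      using smooth_Lipschitz[OF assms(1)] by metis
    obtain L2 where L2: "L2 \<ge> 0" "\<And>z w. z \<in> cball 0 R \<Longrightarrow> w \<in> cball 0 R \<Longrightarrow> \<bar>dir_deriv \<i> f z - dir_deriv \<i> f w\<bar> \<le> L2 * norm (z - w)"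
      using smooth_Lipschitz[OF s1(2)] by metis
    have "L1 * norm u \<le> (L1 + L2) * norm u" "L2 * norm u \<le> (L1 + L2) * norm u" for u :: complex
      using L1 L2 by (auto intro!: mult_right_mono)
    then show ?thesis using L1(2) L2(2) by (intro exI[of _ "L1 + L2"]) (meson order_trans)
  qed
qed

lemma AE_off_lattice: "AE z in lborel. z \<notin> \<Lambda>"
proof -
  have "\<Lambda> = (\<lambda>(m :: int, n :: int). of_int m + of_int n * tau) ` UNIV"
    by (auto simp: lattice_def)
  then have "countable \<Lambda>" by simp
  then have "\<Lambda> \<in> null_sets lborel" by (rule countable_imp_null_set_lborel)
  then show ?thesis by (rule AE_not_in)
qed

text \<open>The constant that makes the mean zero; \<open>b\<close> is the area of the
  torus.\<close>

definition green_const :: real where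
  "green_const = - (LINT z:rect|lborel. green_fun 0 z) / b"

definition green_expl :: "complex \<Rightarrow> real" where
  "green_expl = green_fun green_const"

text \<open>The weak equation is the integrated Green identity on \<open>rect\<close>, carried over
  to the parallelogram by periodicity.\<close>

theorem green_expl_is_green_function: "is_green_function tau green_expl"
  unfolding is_green_function_def
proof (intro conjI allI impI)
  show "periodic tau green_expl"
    by (simp add: periodic_def green_expl_def green_fun_lattice)
  show "continuous_on (- \<Lambda>) green_expl"
    unfolding green_expl_def by (rule continuous_on_green_fun)
  have per1: "green_fun c (z + 1) = green_fun c z" for c z by (simp add: green_fun_lattice)
  show "set_integrable lborel (fund_domain tau) green_expl"
    unfolding green_expl_def by (rule set_integrable_fund_domain[OF set_integrable_rect_green_fun per1])
  show "(LINT z:fund_domain tau|lborel. green_expl z) = 0"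
  proof -
    have "(LINT z:fund_domain tau|lborel. green_expl z) = (LINT z:rect|lborel. green_expl z)"
      unfolding green_expl_def by (rule set_integral_fund_domain[OF set_integrable_rect_green_fun per1])
    also have "\<dots> = (LINT z:rect|lborel. green_fun 0 z + green_const)"
      unfolding set_lebesgue_integral_def
    \<comment> \<open>At lattice points \<open>green_expl\<close> has the default value 0 and lacks
      the constant; they form a null set.\<close>
    proof (rule integral_cong_AE)
      show "AE z in lborel. indicator rect z *\<^sub>R green_expl z = indicator rect z *\<^sub>R (green_fun 0 z + green_const)"
        using AE_off_lattice by eventually_elim (simp add: green_expl_def green_fun_def)
    qed (auto simp: green_expl_def)
    also have "\<dots> = (LINT z:rect|lborel. green_fun 0 z) + (LINT z:rect|lborel. green_const)"
      by (intro set_integral_add set_integrable_rect_green_fun set_integrable_rect_continuous) simp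
    also have "(LINT z:rect|lborel. green_const) = b * green_const"
    proof -
      have "(LINT z:rect|lborel. green_const) = (LINT z:fund_domain tau|lborel. green_const)"
        by (rule set_integral_fund_domain[symmetric]) (auto intro!: set_integrable_rect_continuous)
      then show ?thesis by (simp add: set_lebesgue_integral_def measure_fund_domain)
    qed
    finally show ?thesis using b_pos by (simp add: green_const_def)
  qed
  fix \<phi> assume \<phi>: "smooth \<phi> \<and> periodic tau \<phi>"
  interpret T: torus_test b \<phi> "dir_deriv 1 \<phi>" "dir_deriv \<i> \<phi>" "dir_deriv 1 (dir_deriv 1 \<phi>)" "dir_deriv \<i> (dir_deriv \<i> \<phi>)"
    using \<phi> by (intro torus_test_smooth) auto
  have lap: "laplacian \<phi> = (\<lambda>z. dir_deriv 1 (dir_deriv 1 \<phi>) z + dir_deriv \<i> (dir_deriv \<i> \<phi>) z)"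
    by (auto simp: laplacian_def)
  have clap: "continuous_on UNIV (laplacian \<phi>)" unfolding lap by (intro continuous_intros T.cont)
  have "smooth (dir_deriv 1 \<phi>)" "smooth (dir_deriv \<i> \<phi>)" using \<phi> by (auto intro: smooth_dir_deriv)
  then have lap_per: "laplacian \<phi> (z + 1) = laplacian \<phi> z" for z
    unfolding lap by (simp add: smooth_dir_deriv_shift T.per)
  have i1: "set_integrable lborel rect (\<lambda>z. green_expl z * laplacian \<phi> z)"
    unfolding green_expl_def by (intro set_integrable_rect_mult clap set_integrable_rect_green_fun)
  have i2: "set_integrable lborel rect (\<lambda>z. \<phi> z / b)"
    using b_pos by (intro set_integrable_rect_continuous continuous_intros T.cont) auto
  have i3: "set_integrable lborel rect \<phi>" by (intro set_integrable_rect_continuous T.cont)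
  have "(LINT z:rect|lborel. green_expl z * laplacian \<phi> z - \<phi> z / b) = - \<phi> 0"
    using T.integral_rect_green_laplacian(2)[of green_const] by (simp add: green_expl_def lap)
  then have main: "(LINT z:rect|lborel. green_expl z * laplacian \<phi> z) - (LINT z:rect|lborel. \<phi> z / b) = - \<phi> 0"
    using set_integral_diff(2)[OF i1 i2] by simp
  have "(LINT z:fund_domain tau|lborel. green_expl z * (- laplacian \<phi> z))
      = - (LINT z:fund_domain tau|lborel. green_expl z * laplacian \<phi> z)"
    by (simp add: set_lebesgue_integral_def)
  also have "(LINT z:fund_domain tau|lborel. green_expl z * laplacian \<phi> z) = (LINT z:rect|lborel. green_expl z * laplacian \<phi> z)"
    by (rule set_integral_fund_domain[OF i1]) (simp add: lap_per green_expl_def per1)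
  also have "- \<dots> = \<phi> 0 - (LINT z:rect|lborel. \<phi> z / b)" using main by simp
  also have "(LINT z:rect|lborel. \<phi> z / b) = (LINT z:rect|lborel. \<phi> z) / b" by simp
  also have "(LINT z:rect|lborel. \<phi> z) = (LINT z:fund_domain tau|lborel. \<phi> z)"
    by (rule set_integral_fund_domain[OF i3, symmetric]) (simp add: T.per)
  finally show "(LINT z:fund_domain tau|lborel. green_expl z * (- laplacian \<phi> z)) =
      \<phi> 0 - (1 / measure lborel (fund_domain tau)) * (LINT z:fund_domain tau|lborel. \<phi> z)"
    by (simp add: measure_fund_domain)
qed

end

subsection \<open>Uniqueness of the Green function\<close>

lemma cos_add_int_period: "cos (x + of_int n * (2 * pi)) = cos (x :: real)"
  using sin_int_2pin[of n] cos_int_2pin[of n] by (simp add: cos_add mult.commute)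

text \<open>The phase makes the family closed, up to factors, under directional derivatives: each of
  them adds \<open>pi / 2\<close> to \<open>\<gamma>\<close>.\<close>

definition wave :: "real \<Rightarrow> real \<Rightarrow> real \<Rightarrow> complex \<Rightarrow> real" where
  "wave \<alpha> \<beta> \<gamma> z = cos (\<alpha> * Re z + \<beta> * Im z + \<gamma>)"

lemma wave_has_derivative:
  "((\<lambda>z. A * wave \<alpha> \<beta> \<gamma> z) has_derivative
    (\<lambda>h. A * (\<alpha> * Re h + \<beta> * Im h) * wave \<alpha> \<beta> (\<gamma> + pi / 2) z)) (at z)"
proof -
  have e: "wave \<alpha> \<beta> (\<gamma> + pi / 2) z = - sin (\<alpha> * Re z + \<beta> * Im z + \<gamma>)"
    unfolding wave_def add.assoc[symmetric] by (simp add: cos_add)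
  show ?thesis
    unfolding e unfolding wave_def by (auto intro!: derivative_eq_intros simp: algebra_simps)
qed

lemma dir_deriv_wave:
  "dir_deriv v (\<lambda>z. A * wave \<alpha> \<beta> \<gamma> z) = (\<lambda>z. A * (\<alpha> * Re v + \<beta> * Im v) * wave \<alpha> \<beta> (\<gamma> + pi / 2) z)"
  by (rule ext) (rule dir_deriv_eq[OF wave_has_derivative])

lemma smooth_wave: "smooth (wave \<alpha> \<beta> \<gamma>)"
proof -
  have "\<exists>A \<delta>. foldr dir_deriv vs (wave \<alpha> \<beta> \<gamma>) = (\<lambda>z. A * wave \<alpha> \<beta> \<delta> z)" for vs
  proof (induction vs)
    case Nil
    show ?case by (rule exI[of _ 1], rule exI[of _ \<gamma>]) simp
  next
    case (Cons v vs)
    then obtain A \<delta> where "foldr dir_deriv vs (wave \<alpha> \<beta> \<gamma>) = (\<lambda>z. A * wave \<alpha> \<beta> \<delta> z)" by blast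
    then have "foldr dir_deriv (v # vs) (wave \<alpha> \<beta> \<gamma>) =
        (\<lambda>z. (A * (\<alpha> * Re v + \<beta> * Im v)) * wave \<alpha> \<beta> (\<delta> + pi / 2) z)"
      by (simp add: dir_deriv_wave)
    then show ?case by blast
  qed
  then show ?thesis
    unfolding smooth_def
  proof (intro allI)
    fix vs z
    obtain A \<delta> where "foldr dir_deriv vs (wave \<alpha> \<beta> \<gamma>) = (\<lambda>z. A * wave \<alpha> \<beta> \<delta> z)"
      using \<open>\<And>vs. \<exists>A \<delta>. foldr dir_deriv vs (wave \<alpha> \<beta> \<gamma>) = (\<lambda>z. A * wave \<alpha> \<beta> \<delta> z)\<close> by blast
    then show "foldr dir_deriv vs (wave \<alpha> \<beta> \<gamma>) differentiable (at z)"
      using differentiableI[OF wave_has_derivative[of A \<alpha> \<beta> \<delta> z]] by simp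
  qed
qed

lemma laplacian_wave: "laplacian (wave \<alpha> \<beta> \<gamma>) z = - (\<alpha>\<^sup>2 + \<beta>\<^sup>2) * wave \<alpha> \<beta> \<gamma> z"
proof -
  have 1: "dir_deriv v (wave \<alpha> \<beta> \<gamma>) = (\<lambda>z. (\<alpha> * Re v + \<beta> * Im v) * wave \<alpha> \<beta> (\<gamma> + pi / 2) z)" for v
    using dir_deriv_wave[of v 1 \<alpha> \<beta> \<gamma>] by simp
  have "wave \<alpha> \<beta> (\<gamma> + pi / 2 + pi / 2) z = - wave \<alpha> \<beta> \<gamma> z"
  proof -
    have "\<alpha> * Re z + \<beta> * Im z + (\<gamma> + pi / 2 + pi / 2) = (\<alpha> * Re z + \<beta> * Im z + \<gamma>) + pi" by simp
    then show ?thesis unfolding wave_def by (simp only: cos_periodic_pi)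
  qed
  then show ?thesis
    by (simp add: laplacian_def 1 dir_deriv_wave power2_eq_square algebra_simps)
qed

lemma continuous_on_wave: "continuous_on A (wave \<alpha> \<beta> \<gamma>)"
  unfolding wave_def[abs_def] by (intro continuous_intros)

context rhombic_torus
begin

definition lcoord :: "complex \<Rightarrow> real" where "lcoord z = Re z - Im z / (2 * b)"

definition tcoord :: "complex \<Rightarrow> real" where "tcoord z = Im z / b"

lemma coord_add: "lcoord (z + w) = lcoord z + lcoord w" "tcoord (z + w) = tcoord z + tcoord w"
  by (simp_all add: lcoord_def tcoord_def add_divide_distrib)

lemma coord_lattice:
  "lcoord (of_int m + of_int n * tau) = of_int m" "tcoord (of_int m + of_int n * tau) = of_int n"
  using b_pos by (simp_all add: lcoord_def tcoord_def field_simps)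

lemma coord_eq: "z = of_real (lcoord z) + of_real (tcoord z) * tau"
  using b_pos by (simp add: complex_eq_iff lcoord_def tcoord_def)

lemma coord_combination:
  "lcoord (of_real s + of_real t * tau) = s" "tcoord (of_real s + of_real t * tau) = t"
  using b_pos by (simp_all add: lcoord_def tcoord_def)

lemma continuous_on_coord [continuous_intros]:
  "continuous_on A lcoord" "continuous_on A tcoord"
  unfolding lcoord_def[abs_def] tcoord_def[abs_def] using b_pos by (auto intro!: continuous_intros)

lemma fund_domain_coord:
  "z \<in> fund_domain tau \<longleftrightarrow> 0 \<le> lcoord z \<and> lcoord z < 1 \<and> 0 \<le> tcoord z \<and> tcoord z < 1"
  using b_pos unfolding fund_domain_iff lcoord_def tcoord_def
  by (auto simp: zero_le_divide_iff)

lemma bounded_fund_domain: "bounded (fund_domain tau)"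
proof (rule bounded_subset[OF bounded_cbox[of "Complex 0 0" "Complex 2 b"]])
  show "fund_domain tau \<subseteq> cbox (Complex 0 0) (Complex 2 b)"
  proof
    fix z assume z: "z \<in> fund_domain tau"
    then have y: "0 \<le> Im z" "Im z < b" "Im z / (2 * b) \<le> Re z" "Re z < Im z / (2 * b) + 1"
      by (auto simp: fund_domain_iff)
    have "0 \<le> Im z / (2 * b)" "Im z / (2 * b) \<le> 1" using y b_pos by (simp_all add: field_simps)
    then have "0 \<le> Re z" "Re z \<le> 2" using y by linarith+
    then show "z \<in> cbox (Complex 0 0) (Complex 2 b)" using y by (simp add: in_cbox_complex_iff)
  qed
qed

section \<open>Fourier moments and peaked trigonometric kernels\<close>

definition character :: "int \<Rightarrow> int \<Rightarrow> real \<Rightarrow> complex \<Rightarrow> real" where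
  "character j k \<gamma> z = cos (2 * pi * (j * lcoord z + k * tcoord z) + \<gamma>)"

text \<open>The frequencies run through the dual lattice; the term \<open>- j / 2\<close> is the
  shear coming from \<open>Re tau\<close>.\<close>

lemma character_wave:
  "character j k \<gamma> = wave (2 * pi * j) (2 * pi * (k - j / 2) / b) \<gamma>"
  using b_pos by (auto simp: character_def wave_def lcoord_def tcoord_def field_simps)

lemma periodic_character: "periodic tau (character j k \<gamma>)"
  unfolding periodic_def
proof (intro allI ballI)
  fix z w assume "w \<in> \<Lambda>"
  then obtain m n where w: "w = of_int m + of_int n * tau" by (auto simp: lattice_iff)
  have "2 * pi * (j * lcoord (z + w) + k * tcoord (z + w)) + \<gamma> =
     (2 * pi * (j * lcoord z + k * tcoord z) + \<gamma>) + of_int (j * m + k * n) * (2 * pi)"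
    using coord_add[of z w] unfolding w coord_lattice by (simp add: algebra_simps)
  then show "character j k \<gamma> (z + w) = character j k \<gamma> z"
    unfolding character_def by (simp only: cos_add_int_period)
qed

text \<open>A raised cosine with values in \<open>{0..1}\<close> whose maxima are the integers; its
  powers concentrate there.\<close>

definition bump :: "real \<Rightarrow> real" where "bump u = (1 + cos (2 * pi * u)) / 2"

lemma bump_bounds: "0 \<le> bump u" "bump u \<le> 1"
proof -
  define v where "v = cos (2 * pi * u)"
  have "- 1 \<le> v" "v \<le> 1" unfolding v_def by (rule cos_ge_minus_one, rule cos_le_one)
  then show "0 \<le> bump u" "bump u \<le> 1" unfolding bump_def v_def[symmetric] by simp_all
qed

lemma bump_large:
  assumes "0 < \<delta>" "\<delta> \<le> 1 / 2" "bump u > bump \<delta>"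
  shows "\<bar>u - of_int (round u)\<bar> < \<delta>"
proof (rule ccontr)
  define v where "v = \<bar>u - of_int (round u)\<bar>"
  assume "\<not> \<bar>u - of_int (round u)\<bar> < \<delta>"
  then have v: "\<delta> \<le> v" "v \<le> 1 / 2"
    using of_int_round_abs_le[of u] by (auto simp: v_def abs_minus_commute)
  have "cos (2 * pi * v) = cos (2 * pi * (u - of_int (round u)))"
    by (auto simp: v_def abs_if algebra_simps) (metis cos_minus minus_diff_eq)
  also have "\<dots> = cos (2 * pi * u)"
    using cos_add_int_period[of "2 * pi * u" "- round u"] by (simp add: algebra_simps)
  finally have "bump u = bump v" by (simp add: bump_def)
  moreover have "cos (2 * pi * v) \<le> cos (2 * pi * \<delta>)"
    using v assms by (intro cos_monotone_0_pi_le) auto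
  ultimately show False using assms by (simp add: bump_def)
qed

text \<open>Product-to-sum formula. Multiplication by a bump only shifts frequencies and phases, so
  the vanishing of all moments survives multiplication by powers of bumps.\<close>

lemma bump_character:
  "bump (lcoord z - s) * character j k \<gamma> z = character j k \<gamma> z / 2 +
     character (j + 1) k (\<gamma> - 2 * pi * s) z / 4 + character (j - 1) k (\<gamma> + 2 * pi * s) z / 4"
  "bump (tcoord z - t) * character j k \<gamma> z = character j k \<gamma> z / 2 +
     character j (k + 1) (\<gamma> - 2 * pi * t) z / 4 + character j (k - 1) (\<gamma> + 2 * pi * t) z / 4"
proof -
  have c: "cos A * cos C = (cos (C + A) + cos (C - A)) / 2" for A C :: real
    by (simp add: cos_add cos_diff)
  define C where "C = 2 * pi * (j * lcoord z + k * tcoord z) + \<gamma>"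
  have 1: "2 * pi * (of_int (j + 1) * lcoord z + k * tcoord z) + (\<gamma> - 2 * pi * s) = C + 2 * pi * (lcoord z - s)"
    "2 * pi * (of_int (j - 1) * lcoord z + k * tcoord z) + (\<gamma> + 2 * pi * s) = C - 2 * pi * (lcoord z - s)"
    "2 * pi * (j * lcoord z + of_int (k + 1) * tcoord z) + (\<gamma> - 2 * pi * t) = C + 2 * pi * (tcoord z - t)"
    "2 * pi * (j * lcoord z + of_int (k - 1) * tcoord z) + (\<gamma> + 2 * pi * t) = C - 2 * pi * (tcoord z - t)"
    by (simp_all add: C_def algebra_simps)
  have 2: "(1 + cos A) / 2 * cos C = cos C / 2 + cos (C + A) / 4 + cos (C - A) / 4" for A
    using c[of A C] by (simp add: field_simps)
  show "bump (lcoord z - s) * character j k \<gamma> z = character j k \<gamma> z / 2 +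
     character (j + 1) k (\<gamma> - 2 * pi * s) z / 4 + character (j - 1) k (\<gamma> + 2 * pi * s) z / 4"
    unfolding bump_def character_def 1 C_def[symmetric] by (rule 2)
  show "bump (tcoord z - t) * character j k \<gamma> z = character j k \<gamma> z / 2 +
     character j (k + 1) (\<gamma> - 2 * pi * t) z / 4 + character j (k - 1) (\<gamma> + 2 * pi * t) z / 4"
    unfolding bump_def character_def 1 C_def[symmetric] by (rule 2)
qed

lemma continuous_on_character: "continuous_on A (character j k \<gamma>)"
  unfolding character_wave by (rule continuous_on_wave)

lemma continuous_on_bump: "continuous_on A f \<Longrightarrow> continuous_on A (\<lambda>z. bump (f z))" for f :: "complex \<Rightarrow> real"
  unfolding bump_def by (intro continuous_intros) auto

text \<open>All trigonometric moments vanish; testing against high powers of a trigonometric polynomial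
  peaked at \<open>z\<^sub>0\<close> recovers the value at \<open>z\<^sub>0\<close>.\<close>

lemma moments_zero_imp_zero:
  assumes h: "periodic tau h" "continuous_on (- \<Lambda>) h" "set_integrable lborel (fund_domain tau) h"
    and mom: "\<And>j k \<gamma>. (LINT z:fund_domain tau|lborel. h z * character j k \<gamma> z) = 0"
    and z0: "z0 \<notin> \<Lambda>"
  shows "h z0 = 0"
proof -
  define F where "F = fund_domain tau"
  have F_meas [measurable]: "F \<in> sets borel" by (simp add: F_def)
  have Fint: "set_integrable lborel F (\<lambda>z. h z * \<psi> z)" if "continuous_on UNIV \<psi>" for \<psi>
    unfolding F_def by (rule set_integrable_mult_continuous[OF bounded_fund_domain that h(3)])
  have comb: "(LINT z:F|lborel. h z * (\<psi>1 z / 2 + \<psi>2 z / 4 + \<psi>3 z / 4)) = 0"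
    if c: "continuous_on UNIV \<psi>1" "continuous_on UNIV \<psi>2" "continuous_on UNIV \<psi>3"
      and "(LINT z:F|lborel. h z * \<psi>1 z) = 0" "(LINT z:F|lborel. h z * \<psi>2 z) = 0" "(LINT z:F|lborel. h z * \<psi>3 z) = 0"
    for \<psi>1 \<psi>2 \<psi>3
  proof -
    have i: "set_integrable lborel F (\<lambda>z. h z * \<psi>1 z / 2)" "set_integrable lborel F (\<lambda>z. h z * \<psi>2 z / 4)"
      "set_integrable lborel F (\<lambda>z. h z * \<psi>3 z / 4)"
      using Fint[OF c(1)] Fint[OF c(2)] Fint[OF c(3)] by (auto intro: set_integrable_divide)
    have "(LINT z:F|lborel. h z * (\<psi>1 z / 2 + \<psi>2 z / 4 + \<psi>3 z / 4)) =
       (LINT z:F|lborel. (h z * \<psi>1 z / 2 + h z * \<psi>2 z / 4) + h z * \<psi>3 z / 4)"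
      by (simp add: distrib_left)
    also have "\<dots> = 0"
      using that i by (simp add: set_integral_add)
    finally show ?thesis .
  qed
  define w0 where "w0 = of_int \<lfloor>lcoord z0\<rfloor> + of_int \<lfloor>tcoord z0\<rfloor> * tau"
  have w0: "w0 \<in> \<Lambda>" unfolding w0_def lattice_iff by blast
  define z1 where "z1 = z0 - w0"
  have z1c: "lcoord z1 = lcoord z0 - of_int \<lfloor>lcoord z0\<rfloor>" "tcoord z1 = tcoord z0 - of_int \<lfloor>tcoord z0\<rfloor>"
    using coord_add[of z1 w0] by (simp_all add: z1_def w0_def coord_lattice)
  have z1F: "0 \<le> lcoord z1" "lcoord z1 < 1" "0 \<le> tcoord z1" "tcoord z1 < 1"
    unfolding z1c by linarith+
  have hz1: "h z1 = h z0" using h(1) w0 unfolding periodic_def z1_def by (metis diff_add_cancel)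
  have z1: "z1 \<notin> \<Lambda>" using z0 w0 lattice_add[of z1 w0] by (auto simp: z1_def)
  define \<kappa> where "\<kappa> = (\<lambda>z. bump (lcoord z - lcoord z1) * bump (tcoord z - tcoord z1))"
  have \<kappa>_cont: "continuous_on A \<kappa>" for A
    unfolding \<kappa>_def by (intro continuous_intros continuous_on_bump)
  have \<kappa>_bounds: "0 \<le> \<kappa> z" "\<kappa> z \<le> 1" for z
    using bump_bounds by (auto simp: \<kappa>_def mult_le_one)
  have mom1: "(LINT z:F|lborel. h z * (bump (lcoord z - lcoord z1) ^ m * character j k \<gamma> z)) = 0" for m j k \<gamma>
  proof (induction m arbitrary: j k \<gamma>)
    case 0
    then show ?case using mom by (simp add: F_def)
  next
    case (Suc m)
    let ?B = "\<lambda>z. bump (lcoord z - lcoord z1) ^ m"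
    have "bump (lcoord z - lcoord z1) ^ Suc m * character j k \<gamma> z =
      ?B z * character j k \<gamma> z / 2 + ?B z * character (j + 1) k (\<gamma> - 2 * pi * lcoord z1) z / 4
      + ?B z * character (j - 1) k (\<gamma> + 2 * pi * lcoord z1) z / 4" for z
    proof -
      have "bump (lcoord z - lcoord z1) ^ Suc m * character j k \<gamma> z = ?B z * (bump (lcoord z - lcoord z1) * character j k \<gamma> z)"
        by simp
      then show ?thesis unfolding bump_character by (simp only: distrib_left times_divide_eq_right)
    qed
    then show ?case
      by (simp only:) (intro comb Suc.IH continuous_intros continuous_on_bump continuous_on_character)
  qed
  have mom2: "(LINT z:F|lborel. h z * (bump (lcoord z - lcoord z1) ^ m * bump (tcoord z - tcoord z1) ^ n * character j k \<gamma> z)) = 0" for m n j k \<gamma>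
  proof (induction n arbitrary: j k \<gamma>)
    case 0
    then show ?case using mom1 by simp
  next
    case (Suc n)
    let ?B = "\<lambda>z. bump (lcoord z - lcoord z1) ^ m * bump (tcoord z - tcoord z1) ^ n"
    have "bump (lcoord z - lcoord z1) ^ m * bump (tcoord z - tcoord z1) ^ Suc n * character j k \<gamma> z =
      ?B z * character j k \<gamma> z / 2 + ?B z * character j (k + 1) (\<gamma> - 2 * pi * tcoord z1) z / 4
      + ?B z * character j (k - 1) (\<gamma> + 2 * pi * tcoord z1) z / 4" for z
    proof -
      have "bump (lcoord z - lcoord z1) ^ m * bump (tcoord z - tcoord z1) ^ Suc n * character j k \<gamma> z
         = ?B z * (bump (tcoord z - tcoord z1) * character j k \<gamma> z)"
        by simp
      then show ?thesis unfolding bump_character by (simp only: distrib_left times_divide_eq_right)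
    qed
    then show ?case
      by (simp only:) (intro comb Suc.IH continuous_intros continuous_on_bump continuous_on_character)
  qed
  have \<kappa>_mom: "(LINT z:F|lborel. h z * \<kappa> z ^ n) = 0" for n
  proof -
    have "character 0 0 0 z = 1" for z by (simp add: character_def)
    then show ?thesis using mom2[of n n 0 0 0] by (simp add: \<kappa>_def power_mult_distrib)
  qed
  show ?thesis
  proof (rule ccontr)
    assume "h z0 \<noteq> 0"
    define \<sigma> where "\<sigma> = sgn (h z1)"
    have \<sigma>: "\<sigma> * h z1 = \<bar>h z1\<bar>" "\<bar>\<sigma>\<bar> = 1" using \<open>h z0 \<noteq> 0\<close> hz1 by (auto simp: \<sigma>_def sgn_if)
    define c where "c = \<bar>h z1\<bar> / 2"
    have c: "c > 0" using \<open>h z0 \<noteq> 0\<close> hz1 by (simp add: c_def)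
    have "isCont h z1" using h(2) open_off_lattice z1 by (simp add: continuous_on_eq_continuous_at)
    then obtain \<rho> where \<rho>: "\<rho> > 0" "\<And>z. dist z z1 < \<rho> \<Longrightarrow> dist (h z) (h z1) < c"
      using c unfolding continuous_at_eps_delta by metis
    have near: "\<sigma> * h z \<ge> c" if "dist z z1 < \<rho>" for z
    proof -
      have "\<bar>\<sigma> * h z - \<sigma> * h z1\<bar> = \<bar>h z - h z1\<bar>"
        using \<sigma>(2) by (metis abs_mult mult_1 right_diff_distrib)
      also have "\<dots> < c" using \<rho>(2)[OF that] by (simp add: dist_real_def)
      finally show ?thesis using \<sigma>(1) by (simp add: c_def abs_if split: if_splits)
    qed
    define \<delta> where "\<delta> = min (1 / 8) (\<rho> / (2 * (1 + norm tau)))"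
    have n1: "0 < 1 + norm tau" by (simp add: add_pos_nonneg)
    have "\<rho> / (2 * (1 + norm tau)) > 0" using \<rho>(1) n1 by (intro divide_pos_pos mult_pos_pos) auto
    then have "\<delta> > 0 \<and> \<delta> \<le> 1 / 8" unfolding \<delta>_def by linarith
    then have \<delta>: "\<delta> > 0" "\<delta> \<le> 1 / 8" by auto
    have \<delta>\<rho>: "\<delta> * (1 + norm tau) < \<rho>"
    proof -
      have "\<delta> \<le> \<rho> / (2 * (1 + norm tau))" by (simp add: \<delta>_def)
      then have "\<delta> * (1 + norm tau) \<le> \<rho> / 2" using n1 by (simp add: field_simps)
      then show ?thesis using \<rho>(1) by linarith
    qed
    define r where "r = bump \<delta>"
    have r: "1 / 2 \<le> r" "r < 1"
    proof -
      have "cos (pi / 2) \<le> cos (2 * pi * \<delta>)" using \<delta> by (intro cos_monotone_0_pi_le) auto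
      then show "1 / 2 \<le> r" by (simp add: r_def bump_def)
      have "cos (2 * pi * \<delta>) < cos 0" using \<delta> by (intro cos_monotone_0_pi) auto
      then show "r < 1" by (simp add: r_def bump_def)
    qed
    have large: "\<sigma> * h z \<ge> c" if "\<kappa> z > r" for z
    proof -
      define u where "u = lcoord z - lcoord z1"
      define v where "v = tcoord z - tcoord z1"
      have "\<kappa> z \<le> bump u * 1" "\<kappa> z \<le> 1 * bump v"
        unfolding \<kappa>_def u_def v_def by (intro mult_mono order_refl bump_bounds; simp)+
      then have "bump u > bump \<delta>" "bump v > bump \<delta>" using that by (auto simp: r_def)
      then have uv: "\<bar>u - of_int (round u)\<bar> < \<delta>" "\<bar>v - of_int (round v)\<bar> < \<delta>"
        using \<delta> by (auto intro!: bump_large)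
      define w where "w = of_int (round u) + of_int (round v) * tau"
      have w: "w \<in> \<Lambda>" unfolding w_def lattice_iff by blast
      have "z - z1 = of_real u + of_real v * tau"
        using coord_eq[of z] coord_eq[of z1] by (simp add: u_def v_def algebra_simps)
      then have "z - w - z1 = of_real (u - of_int (round u)) + of_real (v - of_int (round v)) * tau"
        by (simp add: w_def algebra_simps)
      then have "norm (z - w - z1) \<le> \<bar>u - of_int (round u)\<bar> + \<bar>v - of_int (round v)\<bar> * norm tau"
        by (metis norm_triangle_ineq norm_mult norm_of_real)
      also have "\<dots> \<le> \<delta> + \<delta> * norm tau" using uv by (intro add_mono mult_right_mono) auto
      also have "\<dots> < \<rho>" using \<delta>\<rho> by (simp add: distrib_left)
      finally have "dist (z - w) z1 < \<rho>" by (simp add: dist_norm)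
      then have "\<sigma> * h (z - w) \<ge> c" by (rule near)
      moreover have "h (z - w) = h z" using h(1) w unfolding periodic_def by (metis diff_add_cancel)
      ultimately show ?thesis by simp
    qed
    \<comment> \<open>Two thresholds \<open>r < r1 < 1\<close>: where
      \<open>\<kappa> z \<le> r\<close> the sign of \<open>h\<close> is unknown, but the integrand
      is at most \<open>\<bar>h z\<bar> * r ^ n\<close>; on \<open>N\<close> it is at least
      \<open>c * r1 ^ n\<close>. Letting \<open>n\<close> grow gives the contradiction.\<close>
    define r1 where "r1 = (1 + r) / 2"
    have r1: "r < r1" "r1 < 1" using r by (auto simp: r1_def)
    define N where "N = F \<inter> {z. \<kappa> z > r1}"
    have \<kappa>_meas [measurable]: "\<kappa> \<in> borel_measurable borel" by (rule borel_measurable_continuous_onI[OF \<kappa>_cont])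
    have N_meas [measurable]: "N \<in> sets borel" unfolding N_def by measurable
    have F_fin: "emeasure lborel F < \<infinity>" unfolding F_def by (rule emeasure_bounded_finite[OF bounded_fund_domain])
    have N_fin: "emeasure lborel N < \<infinity>"
      using emeasure_mono[of N F lborel] F_fin by (auto simp: N_def intro: le_less_trans)
    define V where "V = {z. 0 < lcoord z \<and> lcoord z < 1 \<and> 0 < tcoord z \<and> tcoord z < 1 \<and> \<kappa> z > r1}"
    have V_open: "open V"
      unfolding V_def by (intro open_Collect_conj open_Collect_less continuous_on_const continuous_on_coord \<kappa>_cont)
    have V_ne: "V \<noteq> {}"
    proof -
      \<comment> \<open>\<open>z1\<close> may lie on an edge of the half-open parallelogram, so a
        point of the open set \<open>V\<close> is found by moving diagonally inwards.\<close>
      define path where "path = (\<lambda>\<eta>::real. z1 + of_real \<eta> * (1 + tau))"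
      have path_c: "lcoord (path \<eta>) = lcoord z1 + \<eta>" "tcoord (path \<eta>) = tcoord z1 + \<eta>" for \<eta>
      proof -
        have "path \<eta> = z1 + (of_real \<eta> + of_real \<eta> * tau)" by (simp add: path_def algebra_simps)
        then show "lcoord (path \<eta>) = lcoord z1 + \<eta>" "tcoord (path \<eta>) = tcoord z1 + \<eta>"
          by (simp_all only: coord_add[of z1] coord_combination)
      qed
      have "((\<lambda>\<eta>. bump \<eta> * bump \<eta>) \<longlongrightarrow> bump 0 * bump 0) (at_right 0)"
        unfolding bump_def by (intro tendsto_intros) auto
      then have "\<forall>\<^sub>F \<eta> in at_right 0. bump \<eta> * bump \<eta> > r1"
        using r1(2) by (intro order_tendstoD(1)) (auto simp: bump_def)
      moreover have "\<forall>\<^sub>F \<eta> in at_right 0. \<eta> < min (1 - lcoord z1) (1 - tcoord z1)"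
        using z1F by (intro order_tendstoD(2)[OF tendsto_ident_at]) auto
      moreover have "\<forall>\<^sub>F \<eta> in at_right 0. \<eta> > (0::real)" by (simp add: eventually_at_right_less)
      ultimately have "\<forall>\<^sub>F \<eta> in at_right 0. path \<eta> \<in> V"
      proof eventually_elim
        case (elim \<eta>)
        then show ?case using z1F by (simp add: V_def path_c \<kappa>_def)
      qed
      from eventually_happens'[OF trivial_limit_at_right_real this] show ?thesis by blast
    qed
    have "V \<subseteq> N"
    proof
      fix z assume "z \<in> V"
      then show "z \<in> N" by (simp add: V_def N_def F_def fund_domain_coord)
    qed
    have N_pos: "measure lborel N > 0"
    proof -
      have "\<not> negligible V" using V_open V_ne by (rule open_not_negligible)
      then have "\<not> negligible N" using \<open>V \<subseteq> N\<close> negligible_subset by blast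
      then have "emeasure lborel N \<noteq> 0"
        by (simp add: negligible_iff_null_sets null_sets_def)
      then show ?thesis using N_fin by (simp add: measure_def enn2real_positive_iff less_top zero_less_iff_neq_zero)
    qed
    define H where "H = (LINT z:F|lborel. \<bar>h z\<bar>)"
    have absi: "set_integrable lborel F (\<lambda>z. \<bar>h z\<bar>)" using h(3) unfolding F_def by (rule set_integrable_abs)
    have key: "c * measure lborel N * r1 ^ n \<le> r ^ n * H" for n
    proof -
      have iN: "integrable lborel (\<lambda>z. c * r1 ^ n * indicator N z)"
        using N_fin by (intro integrable_mult_right integrable_real_indicator) auto
      have iH: "integrable lborel (\<lambda>z. r ^ n * (indicator F z *\<^sub>R \<bar>h z\<bar>))"
        using absi by (intro integrable_mult_right) (simp add: set_integrable_def)
      have iK: "integrable lborel (\<lambda>z. \<sigma> * (indicator F z *\<^sub>R (h z * \<kappa> z ^ n)))"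
        using Fint[of "\<lambda>z. \<kappa> z ^ n"] \<kappa>_cont by (intro integrable_mult_right) (auto simp: set_integrable_def intro!: continuous_intros)
      have "(LINT z|lborel. c * r1 ^ n * indicator N z - r ^ n * (indicator F z *\<^sub>R \<bar>h z\<bar>))
          \<le> (LINT z|lborel. \<sigma> * (indicator F z *\<^sub>R (h z * \<kappa> z ^ n)))"
      proof (rule integral_mono[OF Bochner_Integration.integrable_diff[OF iN iH] iK])
        fix z
        show "c * r1 ^ n * indicator N z - r ^ n * (indicator F z *\<^sub>R \<bar>h z\<bar>) \<le> \<sigma> * (indicator F z *\<^sub>R (h z * \<kappa> z ^ n))"
        proof (cases "z \<in> F")
          case zF: True
          have rn: "0 \<le> r ^ n * \<bar>h z\<bar>" using r by simp
          show ?thesis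
          proof (cases "\<kappa> z > r")
            case True
            have A: "\<sigma> * (h z * \<kappa> z ^ n) \<ge> c * \<kappa> z ^ n"
              using large[OF True] \<kappa>_bounds[of z] by (simp add: mult.assoc[symmetric] mult_right_mono)
            show ?thesis
            proof (cases "z \<in> N")
              case True
              then have "r1 ^ n \<le> \<kappa> z ^ n" using r r1 by (intro power_mono) (auto simp: N_def)
              then have "c * r1 ^ n \<le> c * \<kappa> z ^ n" using c by (intro mult_left_mono) auto
              then show ?thesis using A rn True zF by simp
            next
              case False
              have "0 \<le> c * \<kappa> z ^ n" using c \<kappa>_bounds[of z] by simp
              then show ?thesis using A rn False zF by simp
            qed
          next
            case False
            then have "z \<notin> N" using r1 by (auto simp: N_def)
            have "\<bar>\<sigma> * (h z * \<kappa> z ^ n)\<bar> = \<bar>h z\<bar> * \<kappa> z ^ n" using \<sigma>(2) \<kappa>_bounds[of z] by (simp add: abs_mult)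
            also have "\<dots> \<le> \<bar>h z\<bar> * r ^ n" using False \<kappa>_bounds[of z] by (intro mult_left_mono power_mono) auto
            finally show ?thesis using \<open>z \<notin> N\<close> zF by (simp add: mult.commute abs_le_iff)
          qed
        qed (simp add: N_def)
      qed
      also have "(LINT z|lborel. \<sigma> * (indicator F z *\<^sub>R (h z * \<kappa> z ^ n))) = 0"
        using \<kappa>_mom[of n] by (simp add: set_lebesgue_integral_def)
      finally have "(LINT z|lborel. c * r1 ^ n * indicator N z) - (LINT z|lborel. r ^ n * (indicator F z *\<^sub>R \<bar>h z\<bar>)) \<le> 0"
        using Bochner_Integration.integral_diff[OF iN iH] by simp
      moreover have "(LINT z|lborel. c * r1 ^ n * indicator N z) = c * r1 ^ n * measure lborel N" by simp
      moreover have "(LINT z|lborel. r ^ n * (indicator F z *\<^sub>R \<bar>h z\<bar>)) = r ^ n * H"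
        unfolding H_def set_lebesgue_integral_def by (rule integral_mult_right_zero)
      ultimately have "c * r1 ^ n * measure lborel N - r ^ n * H \<le> 0" by (simp only:)
      then show ?thesis by (simp add: mult.commute mult.left_commute)
    qed
    define C where "C = H / (c * measure lborel N)"
    have "(r1 / r) ^ n \<le> C" for n
    proof -
      have "0 < r ^ n" "0 < c * measure lborel N" using r c N_pos by auto
      then show ?thesis using key[of n] by (simp add: C_def power_divide field_simps)
    qed
    moreover have "r1 / r > 1" using r1 r by simp
    then obtain n where "C < (r1 / r) ^ n" using real_arch_pow by blast
    ultimately show False using leD by blast
  qed
qed

text \<open>A nonconstant character is an eigenfunction of the Laplacian with nonzero eigenvalue, so
  the weak equation determines the moment against it; the constant character is covered by the
  mean-zero condition.\<close>

theorem green_function_unique: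
  assumes "is_green_function tau G" "z \<notin> \<Lambda>"
  shows "G z = green_expl z"
proof -
  define h where "h = (\<lambda>z. G z - green_expl z)"
  have G: "periodic tau G" "continuous_on (- \<Lambda>) G" "set_integrable lborel (fund_domain tau) G"
    "(LINT z:fund_domain tau|lborel. G z) = 0"
    and Gw: "\<And>\<phi>. smooth \<phi> \<Longrightarrow> periodic tau \<phi> \<Longrightarrow> (LINT z:fund_domain tau|lborel. G z * (- laplacian \<phi> z)) =
        \<phi> 0 - (1 / measure lborel (fund_domain tau)) * (LINT z:fund_domain tau|lborel. \<phi> z)"
    using assms(1) unfolding is_green_function_def by blast+
  have E: "periodic tau green_expl" "continuous_on (- \<Lambda>) green_expl" "set_integrable lborel (fund_domain tau) green_expl"
    "(LINT z:fund_domain tau|lborel. green_expl z) = 0"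
    and Ew: "\<And>\<phi>. smooth \<phi> \<Longrightarrow> periodic tau \<phi> \<Longrightarrow> (LINT z:fund_domain tau|lborel. green_expl z * (- laplacian \<phi> z)) =
        \<phi> 0 - (1 / measure lborel (fund_domain tau)) * (LINT z:fund_domain tau|lborel. \<phi> z)"
    using green_expl_is_green_function unfolding is_green_function_def by blast+
  have mom: "(LINT z:fund_domain tau|lborel. h z * character j k \<gamma> z) = 0" for j k \<gamma>
  proof -
    have i: "set_integrable lborel (fund_domain tau) (\<lambda>z. G z * character j k \<gamma> z)"
      "set_integrable lborel (fund_domain tau) (\<lambda>z. green_expl z * character j k \<gamma> z)"
      by (intro set_integrable_mult_continuous bounded_fund_domain continuous_on_character G E)+
    have eq: "(LINT z:fund_domain tau|lborel. h z * character j k \<gamma> z) =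
      (LINT z:fund_domain tau|lborel. G z * character j k \<gamma> z) - (LINT z:fund_domain tau|lborel. green_expl z * character j k \<gamma> z)"
      unfolding h_def left_diff_distrib by (rule set_integral_diff(2)[OF i])
    show ?thesis
    proof (cases "j = 0 \<and> k = 0")
      case True
      then have "character j k \<gamma> = (\<lambda>_. cos \<gamma>)" by (auto simp: character_def)
      then show ?thesis unfolding eq using G(4) E(4) by simp
    next
      case False
      define ev where "ev = (2 * pi * j)\<^sup>2 + (2 * pi * (k - j / 2) / b)\<^sup>2"
      have "ev \<noteq> 0" using False b_pos by (auto simp: ev_def sum_power2_eq_zero_iff)
      have lap: "- laplacian (character j k \<gamma>) z = ev * character j k \<gamma> z" for z
        by (simp add: character_wave laplacian_wave ev_def algebra_simps)
      have "smooth (character j k \<gamma>)" unfolding character_wave by (rule smooth_wave)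
      then have "(LINT z:fund_domain tau|lborel. G z * (- laplacian (character j k \<gamma>) z)) =
        (LINT z:fund_domain tau|lborel. green_expl z * (- laplacian (character j k \<gamma>) z))"
        by (simp only: Gw Ew periodic_character)
      then have "(LINT z:fund_domain tau|lborel. ev * (G z * character j k \<gamma> z)) =
        (LINT z:fund_domain tau|lborel. ev * (green_expl z * character j k \<gamma> z))"
        unfolding lap by (simp add: mult.left_commute)
      then show ?thesis unfolding eq using \<open>ev \<noteq> 0\<close> by simp
    qed
  qed
  have "h z = 0"
  proof (rule moments_zero_imp_zero[OF _ _ _ mom assms(2)])
    show "periodic tau h" using G(1) E(1) by (simp add: periodic_def h_def)
    show "continuous_on (- \<Lambda>) h" unfolding h_def by (intro continuous_intros G E)
    show "set_integrable lborel (fund_domain tau) h" unfolding h_def by (intro set_integral_diff G E)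
  qed
  then show ?thesis by (simp add: h_def)
qed

end

subsection \<open>Critical points\<close>

lemma linear_form_eq_0_iff: "(\<lambda>h. A * Re h + B * Im h) = (\<lambda>h. 0) \<longleftrightarrow> A = 0 \<and> B = (0 :: real)"
proof
  assume "(\<lambda>h. A * Re h + B * Im h) = (\<lambda>h. 0)"
  from fun_cong[OF this, of 1] fun_cong[OF this, of \<i>] show "A = 0 \<and> B = 0" by simp
qed auto

lemma critical_point_iff:
  assumes "(f has_derivative (\<lambda>h. A * Re h + B * Im h)) (at z)"
  shows "critical_point f z \<longleftrightarrow> A = 0 \<and> B = 0"
  unfolding critical_point_def
  using has_derivative_unique[OF assms, of "\<lambda>h. 0"] assms linear_form_eq_0_iff[of A B] by auto

context rhombic_torus
begin

text \<open>Off the lattice the choice is determined by uniqueness; on the lattice periodicity is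
  retained, which suffices to locate the discontinuities.\<close>

lemma green_eq_expl: "z \<notin> \<Lambda> \<Longrightarrow> green tau z = green_expl z"
  and green_periodic: "w \<in> \<Lambda> \<Longrightarrow> green tau (z + w) = green tau z"
proof -
  have "is_green_function tau (green tau)"
    unfolding green_def using green_expl_is_green_function by (rule someI[where P = "is_green_function tau"])
  then show "z \<notin> \<Lambda> \<Longrightarrow> green tau z = green_expl z" "w \<in> \<Lambda> \<Longrightarrow> green tau (z + w) = green tau z"
    using green_function_unique by (auto simp: is_green_function_def periodic_def)
qed

lemma green_has_derivative:
  assumes "z \<notin> \<Lambda>"
  shows "(green tau has_derivative (\<lambda>h. green_dx z * Re h + green_dy z * Im h)) (at z)"
  by (rule has_derivative_transform_within_open[OF green_fun_has_derivative[OF assms] open_off_lattice])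
     (use assms green_eq_expl in \<open>auto simp: green_expl_def\<close>)

lemma green_expl_at_pole: "filterlim green_expl at_top (at 0)"
proof -
  have nz: "\<forall>\<^sub>F z in at 0. z \<notin> \<Lambda>"
    using eventually_at_ball'[OF rad_pos, of 0 UNIV]
    by eventually_elim (use ball_rad_lattice in auto)
  have "isCont theta 0" using theta_DERIV by (rule DERIV_isCont)
  then have "(\<lambda>z. norm (theta z)) \<midarrow>0\<rightarrow> 0" using tendsto_norm[of theta "theta 0" "at 0"] by (simp add: isCont_def)
  moreover have "\<forall>\<^sub>F z in at 0. norm (theta z) > 0"
    using nz by eventually_elim (simp add: theta_eq_0_iff)
  ultimately have "filterlim (\<lambda>z. norm (theta z)) (at_right 0) (at 0)"
    by (simp add: filterlim_at eventually_mono)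
  then have "filterlim (\<lambda>z. ln (norm (theta z))) at_bot (at 0)"
    by (rule filterlim_compose[OF ln_at_0])
  then have "filterlim (\<lambda>z. - ln (norm (theta z))) at_top (at 0)"
    by (simp add: filterlim_uminus_at_bot)
  then have "filterlim (\<lambda>z. (1 / (2 * pi)) * - ln (norm (theta z))) at_top (at 0)"
    by (intro filterlim_tendsto_pos_mult_at_top[OF tendsto_const]) auto
  moreover have "((\<lambda>z. (Im z)\<^sup>2 / (2 * b) + green_const) \<longlongrightarrow> (Im 0)\<^sup>2 / (2 * b) + green_const) (at 0)"
    using b_pos by (intro tendsto_intros) auto
  ultimately have "filterlim (\<lambda>z. ((Im z)\<^sup>2 / (2 * b) + green_const) + (1 / (2 * pi)) * - ln (norm (theta z))) at_top (at 0)"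
    by (intro filterlim_tendsto_add_at_top)
  then show ?thesis
  proof (rule filterlim_mono_eventually[OF _ order_refl order_refl])
    show "\<forall>\<^sub>F z in at 0. ((Im z)\<^sup>2 / (2 * b) + green_const) + (1 / (2 * pi)) * - ln (norm (theta z)) = green_expl z"
      using nz by eventually_elim (simp add: green_expl_def green_fun_def)
  qed
qed

text \<open>Whatever value the choice assigns at the pole, \<open>green_expl\<close> tends to
  infinity there.\<close>

lemma not_isCont_green:
  assumes "z \<in> \<Lambda>"
  shows "\<not> isCont (green tau) z"
proof
  assume c: "isCont (green tau) z"
  have "isCont (\<lambda>w. green tau (w + z)) 0"
    by (rule isCont_o2[where f = "\<lambda>w. w + z"]) (use c in \<open>auto intro!: continuous_intros\<close>)
  then have "isCont (green tau) 0" using green_periodic[OF assms] by simp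
  then have "(green tau \<longlongrightarrow> green tau 0) (at 0)" by (simp add: isCont_def)
  moreover have "\<forall>\<^sub>F z in at 0. green tau z = green_expl z"
    using eventually_at_ball'[OF rad_pos, of 0 UNIV]
    by eventually_elim (use ball_rad_lattice green_eq_expl in auto)
  ultimately have "(green_expl \<longlongrightarrow> green tau 0) (at 0)"
    by (rule Lim_transform_eventually)
  moreover have "filterlim green_expl at_infinity (at 0)"
    by (rule filterlim_at_top_imp_at_infinity[OF green_expl_at_pole])
  ultimately show False
    using not_tendsto_and_filterlim_at_infinity[of "at (0 :: complex)" green_expl] by simp
qed

lemma green_grad_eq_0_iff: "green_dx z = 0 \<and> green_dy z = 0 \<longleftrightarrow> hecke z = 0"
  by (auto simp: green_dx_def green_dy_def complex_eq_iff)

lemma critical_point_green: "critical_point (green tau) z \<longleftrightarrow> z \<notin> \<Lambda> \<and> hecke z = 0"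
proof (cases "z \<in> \<Lambda>")
  case True
  then show ?thesis
    using not_isCont_green[OF True] has_derivative_continuous unfolding critical_point_def by blast
next
  case False
  then show ?thesis
    unfolding critical_point_iff[OF green_has_derivative[OF False]] green_grad_eq_0_iff by simp
qed

lemma green_pair_has_derivative:
  assumes "z - p \<notin> \<Lambda>" "z + p \<notin> \<Lambda>"
  shows "(green_pair tau p has_derivative (\<lambda>h. (green_dx (z - p) + green_dx (z + p)) / 2 * Re h
      + (green_dy (z - p) + green_dy (z + p)) / 2 * Im h)) (at z)"
proof -
  have t: "((\<lambda>w. w - p) has_derivative (\<lambda>h. h)) (at z)" "((\<lambda>w. w + p) has_derivative (\<lambda>h. h)) (at z)"
    by (auto intro!: derivative_eq_intros)
  have "((\<lambda>w. green tau (w - p)) has_derivative (\<lambda>h. green_dx (z - p) * Re h + green_dy (z - p) * Im h)) (at z)"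
    "((\<lambda>w. green tau (w + p)) has_derivative (\<lambda>h. green_dx (z + p) * Re h + green_dy (z + p) * Im h)) (at z)"
    using has_derivative_compose[OF t(1) green_has_derivative[OF assms(1)]]
      has_derivative_compose[OF t(2) green_has_derivative[OF assms(2)]] by auto
  from bounded_linear.has_derivative[OF bounded_linear_divide has_derivative_add[OF this], of 2]
  have "((\<lambda>w. (green tau (w - p) + green tau (w + p)) / 2) has_derivative
     (\<lambda>h. (green_dx (z - p) * Re h + green_dy (z - p) * Im h + (green_dx (z + p) * Re h + green_dy (z + p) * Im h)) / 2)) (at z)"
    .
  then show ?thesis
    unfolding green_pair_def[abs_def] by (rule has_derivative_eq_rhs) (simp add: fun_eq_iff field_simps)
qed

text \<open>The assumption keeps the two poles apart modulo the lattice. At one of them the other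
  summand is continuous and can be subtracted, which exposes the discontinuity.\<close>

lemma critical_point_green_pair:
  assumes "2 * p \<notin> \<Lambda>"
  shows "critical_point (green_pair tau p) z \<longleftrightarrow>
    z - p \<notin> \<Lambda> \<and> z + p \<notin> \<Lambda> \<and> hecke (z - p) + hecke (z + p) = 0"
proof -
  have sing: "\<not> critical_point (green_pair tau p) z" if "z - p \<in> \<Lambda> \<or> z + p \<in> \<Lambda>"
  proof
    assume "critical_point (green_pair tau p) z"
    then have c: "isCont (green_pair tau p) z"
      unfolding critical_point_def by (rule has_derivative_continuous)
    have cg: "isCont (\<lambda>w. green tau (w + q)) z" if "z + q \<notin> \<Lambda>" for q
      by (rule isCont_o2[where f = "\<lambda>w. w + q"])
         (use has_derivative_continuous[OF green_has_derivative[OF that]] in \<open>auto intro!: continuous_intros\<close>)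
    have bad: False if q: "z + q \<in> \<Lambda>" "isCont (\<lambda>w. green tau (w + q)) z" for q
    proof -
      have "isCont (\<lambda>w. green tau (w + - q + q)) (z + q)"
        by (rule isCont_o2[where f = "\<lambda>w. w + - q" and g = "\<lambda>w. green tau (w + q)"])
           (use q(2) in \<open>auto intro!: continuous_intros\<close>)
      then show False using not_isCont_green[OF q(1)] by simp
    qed
    have d: "(z + p) - (z - p) = 2 * p" by simp
    from that show False
    proof
      assume m: "z - p \<in> \<Lambda>"
      then have "z + p \<notin> \<Lambda>" using lattice_diff[of "z + p" "z - p"] assms d by auto
      then have "isCont (\<lambda>w. 2 * green_pair tau p w - green tau (w + p)) z"
        by (intro continuous_intros c cg)
      moreover have "2 * green_pair tau p w - green tau (w + p) = green tau (w + - p)" for w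
        by (simp add: green_pair_def field_simps)
      ultimately have "isCont (\<lambda>w. green tau (w + - p)) z" by (simp only:)
      then show False using bad[of "- p"] m by simp
    next
      assume m: "z + p \<in> \<Lambda>"
      then have "z + - p \<notin> \<Lambda>" using lattice_diff[of "z + p" "z - p"] assms d by auto
      then have "isCont (\<lambda>w. 2 * green_pair tau p w - green tau (w + - p)) z"
        by (intro continuous_intros c cg)
      moreover have "2 * green_pair tau p w - green tau (w + - p) = green tau (w + p)" for w
        by (simp add: green_pair_def field_simps)
      ultimately have "isCont (\<lambda>w. green tau (w + p)) z" by (simp only:)
      then show False using bad[of p] m by simp
    qed
  qed
  have reg: "critical_point (green_pair tau p) z \<longleftrightarrow> hecke (z - p) + hecke (z + p) = 0"
    if o: "z - p \<notin> \<Lambda>" "z + p \<notin> \<Lambda>"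
  proof -
    have "critical_point (green_pair tau p) z \<longleftrightarrow>
      (green_dx (z - p) + green_dx (z + p)) / 2 = 0 \<and> (green_dy (z - p) + green_dy (z + p)) / 2 = 0"
      by (rule critical_point_iff[OF green_pair_has_derivative[OF o]])
    also have "\<dots> \<longleftrightarrow> hecke (z - p) + hecke (z + p) = 0"
      by (auto simp: green_dx_def green_dy_def complex_eq_iff field_simps)
    finally show ?thesis .
  qed
  show ?thesis using sing reg by blast
qed

lemma green_dx_has_derivative:
  assumes "z \<notin> \<Lambda>"
  shows "(green_dx has_derivative (\<lambda>h. Re (wp z * h) / (2 * pi))) (at z)"
    and "(green_dy has_derivative (\<lambda>h. Im h / b - Im (wp z * h) / (2 * pi))) (at z)"
proof -
  have z: "(zeta has_derivative (\<lambda>h. - wp z * h)) (at z)"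
    using zeta_DERIV[OF assms] unfolding has_field_derivative_def .
  have "((\<lambda>w. - Re (zeta w) / (2 * pi)) has_derivative (\<lambda>h. - Re (- wp z * h) / (2 * pi))) (at z)"
    by (intro has_derivative_minus has_derivative_Re[OF z] bounded_linear.has_derivative[OF bounded_linear_divide])
  then have "(green_dx has_derivative (\<lambda>h. - Re (- wp z * h) / (2 * pi))) (at z)"
    by (rule has_derivative_transform_within_open[OF _ open_off_lattice])
       (use assms in \<open>auto simp: green_dx_def hecke_def\<close>)
  then show "(green_dx has_derivative (\<lambda>h. Re (wp z * h) / (2 * pi))) (at z)" by simp
  have "((\<lambda>w. Im (zeta w) / (2 * pi) + Im w / b) has_derivative (\<lambda>h. Im (- wp z * h) / (2 * pi) + Im h / b)) (at z)"
    by (intro has_derivative_add has_derivative_Im[OF z] has_derivative_Im[OF has_derivative_ident]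
        bounded_linear.has_derivative[OF bounded_linear_divide])
  then have "(green_dy has_derivative (\<lambda>h. Im (- wp z * h) / (2 * pi) + Im h / b)) (at z)"
    by (rule has_derivative_transform_within_open[OF _ open_off_lattice])
       (use assms b_pos in \<open>auto simp: green_dy_def hecke_def field_simps\<close>)
  moreover have "(\<lambda>h. Im (- wp z * h) / (2 * pi) + Im h / b) = (\<lambda>h. Im h / b - Im (wp z * h) / (2 * pi))"
    by (auto simp: field_simps)
  ultimately show "(green_dy has_derivative (\<lambda>h. Im h / b - Im (wp z * h) / (2 * pi))) (at z)" by simp
qed

lemma Re_of_real_mult: "Re (of_real r * z) = r * Re z"
  by simp

lemma Im_of_real_mult: "Im (of_real r * z) = r * Im z"
  by simp

text \<open>When the sum of the two \<open>wp\<close> values is real, the Hessian is diagonal with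
  entries \<open>R / (2 * pi)\<close> and \<open>1 / b - R / (2 * pi)\<close>; their sum
  \<open>1 / b\<close> is the Laplacian.\<close>

lemma det_hessian_green_pair:
  assumes o: "z - p \<notin> \<Lambda>" "z + p \<notin> \<Lambda>" and S: "wp (z - p) + wp (z + p) = of_real (2 * R)"
  shows "det (hessian (green_pair tau p) z) = R / (2 * pi) * (1 / b - R / (2 * pi))"
proof -
  define U where "U = {w. w - p \<notin> \<Lambda> \<and> w + p \<notin> \<Lambda>}"
  have "open U"
  proof -
    have "open ((\<lambda>w. w - p) -` (- \<Lambda>) \<inter> (\<lambda>w. w + p) -` (- \<Lambda>))"
      by (intro open_Int continuous_open_vimage open_off_lattice) (auto intro!: continuous_intros)
    then show ?thesis by (simp add: U_def vimage_def Int_def)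
  qed
  have zU: "z \<in> U" using o by (simp add: U_def)
  define gx where "gx = (\<lambda>w. (green_dx (w - p) + green_dx (w + p)) / 2)"
  define gy where "gy = (\<lambda>w. (green_dy (w - p) + green_dy (w + p)) / 2)"
  have grad: "dir_deriv 1 (green_pair tau p) w = gx w" "dir_deriv \<i> (green_pair tau p) w = gy w" if "w \<in> U" for w
    using that dir_deriv_eq[OF green_pair_has_derivative, of w p] by (simp_all add: U_def gx_def gy_def)
  have t: "((\<lambda>w. w - p) has_derivative (\<lambda>h. h)) (at z)" "((\<lambda>w. w + p) has_derivative (\<lambda>h. h)) (at z)"
    by (auto intro!: derivative_eq_intros)
  have S': "wp (z - p) * h + wp (z + p) * h = of_real (2 * R) * h" for h
    unfolding S[symmetric] by (simp add: distrib_right)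
  have "(gx has_derivative (\<lambda>h. (Re (wp (z - p) * h) / (2 * pi) + Re (wp (z + p) * h) / (2 * pi)) / 2)) (at z)"
    unfolding gx_def
    by (intro bounded_linear.has_derivative[OF bounded_linear_divide] has_derivative_add
        has_derivative_compose[OF t(1) green_dx_has_derivative(1)[OF o(1)]]
        has_derivative_compose[OF t(2) green_dx_has_derivative(1)[OF o(2)]])
  moreover have "(Re (wp (z - p) * h) / (2 * pi) + Re (wp (z + p) * h) / (2 * pi)) / 2 = R * Re h / (2 * pi)" for h
  proof -
    have "Re (wp (z - p) * h) + Re (wp (z + p) * h) = Re (of_real (2 * R) * h)"
      unfolding S'[symmetric] plus_complex.sel ..
    then have "Re (wp (z - p) * h) + Re (wp (z + p) * h) = 2 * (R * Re h)"
      by (simp only: Re_of_real_mult mult.assoc)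
    moreover have "(u / (2 * pi) + v / (2 * pi)) / 2 = r / (2 * pi)" if "u + v = 2 * r" for u v r :: real
      using that by (simp add: add_divide_distrib[symmetric])
    ultimately show ?thesis by blast
  qed
  ultimately have gx': "(gx has_derivative (\<lambda>h. R * Re h / (2 * pi))) (at z)" by (simp only:)
  have "(gy has_derivative (\<lambda>h. ((Im h / b - Im (wp (z - p) * h) / (2 * pi)) + (Im h / b - Im (wp (z + p) * h) / (2 * pi))) / 2)) (at z)"
    unfolding gy_def
    by (intro bounded_linear.has_derivative[OF bounded_linear_divide] has_derivative_add
        has_derivative_compose[OF t(1) green_dx_has_derivative(2)[OF o(1)]]
        has_derivative_compose[OF t(2) green_dx_has_derivative(2)[OF o(2)]])
  moreover have "((Im h / b - Im (wp (z - p) * h) / (2 * pi)) + (Im h / b - Im (wp (z + p) * h) / (2 * pi))) / 2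
      = Im h / b - R * Im h / (2 * pi)" for h
  proof -
    have "Im (wp (z - p) * h) + Im (wp (z + p) * h) = Im (of_real (2 * R) * h)"
      unfolding S'[symmetric] plus_complex.sel ..
    then have "Im (wp (z - p) * h) + Im (wp (z + p) * h) = 2 * (R * Im h)"
      by (simp only: Im_of_real_mult mult.assoc)
    moreover have "((y - u / (2 * pi)) + (y - v / (2 * pi))) / 2 = y - r / (2 * pi)" if "u + v = 2 * r" for y u v r :: real
    proof -
      have "((y - u / (2 * pi)) + (y - v / (2 * pi))) / 2 = y - ((u + v) / 2) / (2 * pi)" by (simp add: field_simps)
      then show ?thesis by (simp add: that)
    qed
    ultimately show ?thesis by blast
  qed
  ultimately have gy': "(gy has_derivative (\<lambda>h. Im h / b - R * Im h / (2 * pi))) (at z)" by (simp only:)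
  have "(dir_deriv 1 (green_pair tau p) has_derivative (\<lambda>h. R * Re h / (2 * pi))) (at z)"
    by (rule has_derivative_transform_within_open[OF gx' \<open>open U\<close> zU]) (simp add: grad)
  note 1 = dir_deriv_eq[OF this]
  have "(dir_deriv \<i> (green_pair tau p) has_derivative (\<lambda>h. Im h / b - R * Im h / (2 * pi))) (at z)"
    by (rule has_derivative_transform_within_open[OF gy' \<open>open U\<close> zU]) (simp add: grad)
  note 2 = dir_deriv_eq[OF this]
  show ?thesis
    unfolding hessian_def det_2 by (simp add: 1 2)
qed

section \<open>Half periods, reflections and representatives on the axes\<close>

lemma two_torsion_iff: "z \<in> two_torsion tau \<longleftrightarrow> 2 * z \<in> \<Lambda>"
proof
  assume "z \<in> two_torsion tau"
  then obtain t w where tw: "z = t + w" "t \<in> {0, 1/2, tau/2, (1 + tau)/2}" "w \<in> \<Lambda>"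
    by (auto simp: two_torsion_def)
  have "2 * ((1 + tau) / 2) = 1 + tau" by simp
  then have "2 * ((1 + tau) / 2) \<in> \<Lambda>" using lattice_add[OF lattice_1 lattice_tau] by metis
  then have "\<forall>t\<in>{0, 1/2, tau/2, (1 + tau)/2}. 2 * t \<in> \<Lambda>" by simp
  then have "2 * t \<in> \<Lambda>" using tw(2) by blast
  moreover have "2 * z = 2 * t + (w + w)" by (simp add: tw(1))
  ultimately show "2 * z \<in> \<Lambda>" using lattice_add[OF _ lattice_add[OF tw(3) tw(3)]] by metis
next
  assume "2 * z \<in> \<Lambda>"
  then obtain m n where mn: "2 * z = of_int m + of_int n * tau" by (auto simp: lattice_iff)
  define w where "w = of_int (m div 2) + of_int (n div 2) * tau"
  have w: "w \<in> \<Lambda>" unfolding w_def lattice_iff by blast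
  have half: "of_int k = 2 * of_int (k div 2) + of_int (k mod 2)" for k :: int
    by (metis mult_div_mod_eq of_int_add of_int_mult of_int_numeral)
  have "z = (of_int m + of_int n * tau) / 2" unfolding mn[symmetric] by simp
  also have "\<dots> = (of_int (m mod 2) + of_int (n mod 2) * tau) / 2 + w"
    by (subst half[of m], subst half[of n]) (simp add: w_def field_simps)
  finally have "z = (of_int (m mod 2) + of_int (n mod 2) * tau) / 2 + w" .
  moreover have "(of_int (m mod 2) + of_int (n mod 2) * tau) / 2 \<in> {0, 1/2, tau/2, (1 + tau)/2}"
    using mod_2_eq_odd[of m] mod_2_eq_odd[of n] by (auto simp: mod2_eq_if)
  ultimately show "z \<in> two_torsion tau" using w unfolding two_torsion_def by blast
qed

lemma torus_rel_iff: "(z, w) \<in> torus_rel tau \<longleftrightarrow> z - w \<in> \<Lambda>"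
  by (simp add: torus_rel_def)

lemma conj_symmetric_iff: "conj_symmetric tau a \<longleftrightarrow> a - cnj a \<in> \<Lambda> \<or> a + cnj a \<in> \<Lambda>"
  by (simp add: conj_symmetric_def torus_rel_iff)

text \<open>The fixed loci of the two reflections are the images of the real and the imaginary axis.\<close>

lemma conj_symmetric_cases:
  assumes "conj_symmetric tau a"
  obtains (real) x where "a - Complex x 0 \<in> \<Lambda>" | (imaginary) y where "a - Complex 0 y \<in> \<Lambda>"
proof -
  consider "a - cnj a \<in> \<Lambda>" | "a + cnj a \<in> \<Lambda>" using assms conj_symmetric_iff by blast
  then show ?thesis
  proof cases
    case 1
    then obtain m n :: int where mn: "0 = of_int m + of_int n / (2 :: real)" "2 * Im a = of_int n * b"
      unfolding lattice_coords by auto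
    have "n = - 2 * m" using mn(1) by simp
    then have "Im a = of_int (- m) * b" using mn(2) by simp
    then have "a - Complex (Re a - of_int (- m) / 2) 0 = of_int (- m) * tau" by (simp add: complex_eq_iff)
    moreover have "of_int (- m) * tau \<in> \<Lambda>"
      unfolding lattice_iff by (rule exI[of _ 0], rule exI[of _ "- m"]) simp
    ultimately show ?thesis using real by metis
  next
    case 2
    then obtain m n :: int where mn: "2 * Re a = of_int m + of_int n / 2" "0 = of_int n * b"
      unfolding lattice_coords by auto
    then have Re: "2 * Re a = of_int m" using b_pos by simp
    show ?thesis
    proof (cases "even m")
      case True
      then obtain k where "m = 2 * k" by blast
      then have "a - Complex 0 (Im a) = of_int k" using Re by (simp add: complex_eq_iff)
      then show ?thesis using imaginary by (metis lattice_of_int)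
    next
      case False
      then obtain k where "m = 2 * k + 1" by (blast elim: oddE)
      then have "a - Complex 0 (Im a - b) = of_int k + of_int 1 * tau" using Re by (simp add: complex_eq_iff)
      then show ?thesis using imaginary unfolding lattice_iff by metis
    qed
  qed
qed

lemma lattice_Complex_int: "Complex (of_int k) 0 \<in> \<Lambda>" "Complex 0 (of_int k * (2 * b)) \<in> \<Lambda>"
proof -
  show "Complex (of_int k) 0 \<in> \<Lambda>"
    unfolding lattice_Complex by (rule exI[of _ k], rule exI[of _ 0]) simp
  show "Complex 0 (of_int k * (2 * b)) \<in> \<Lambda>"
    unfolding lattice_Complex by (rule exI[of _ "- k"], rule exI[of _ "2 * k"]) simp
qed

text \<open>Rounding leaves \<open>\<bar>u\<bar> \<le> 1/2\<close>, and the end values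
  \<open>0\<close> and \<open>1/2\<close> are half periods. The sign \<open>s\<close> lets oddness
  of the functions involved be applied afterwards.\<close>

lemma real_representative:
  assumes "2 * Complex x 0 \<notin> \<Lambda>"
  obtains x' s where "0 < x'" "x' < 1 / 2" "s \<in> {1, - 1}" "of_int s * Complex x 0 - Complex x' 0 \<in> \<Lambda>"
proof -
  define u where "u = x - of_int (round x)"
  have u: "\<bar>u\<bar> \<le> 1 / 2" using of_int_round_abs_le[of x] by (simp add: u_def abs_minus_commute)
  have "2 * Complex u 0 \<notin> \<Lambda>"
  proof
    assume "2 * Complex u 0 \<in> \<Lambda>"
    moreover have "2 * Complex x 0 = 2 * Complex u 0 + Complex (of_int (2 * round x)) 0"
      by (simp add: u_def complex_eq_iff)
    ultimately show False using assms lattice_add lattice_Complex_int(1) by metis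
  qed
  then have "u \<noteq> 0" "\<bar>u\<bar> \<noteq> 1 / 2"
  proof -
    assume a: "2 * Complex u 0 \<notin> \<Lambda>"
    have "2 * Complex u 0 = Complex (2 * u) 0" by (simp add: complex_eq_iff)
    with a have b: "Complex (2 * u) 0 \<notin> \<Lambda>" by simp
    show "u \<noteq> 0" using b lattice_Complex_int(1)[of 0] by auto
    show "\<bar>u\<bar> \<noteq> 1 / 2"
    proof
      assume "\<bar>u\<bar> = 1 / 2"
      then have "2 * u = of_int 1 \<or> 2 * u = of_int (- 1)" by (auto simp: abs_if split: if_splits)
      then show False using b lattice_Complex_int(1) by metis
    qed
  qed
  then have u': "0 < \<bar>u\<bar>" "\<bar>u\<bar> < 1 / 2" using u by auto
  define s :: int where "s = (if u > 0 then 1 else - 1)"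
  have "of_int s * Complex x 0 - Complex \<bar>u\<bar> 0 = Complex (of_int (s * round x)) 0"
    using u'(1) by (auto simp: complex_eq_iff u_def s_def abs_if)
  then have "of_int s * Complex x 0 - Complex \<bar>u\<bar> 0 \<in> \<Lambda>" using lattice_Complex_int(1) by metis
  then show ?thesis by (rule that[OF u', rotated]) (simp add: s_def)
qed

lemma imaginary_representative:
  assumes "2 * Complex 0 y \<notin> \<Lambda>"
  obtains y' s where "0 < y'" "y' < b" "s \<in> {1, - 1}" "of_int s * Complex 0 y - Complex 0 y' \<in> \<Lambda>"
proof -
  define k where "k = round (y / (2 * b))"
  define u where "u = y - of_int k * (2 * b)"
  have u: "\<bar>u\<bar> \<le> b"
  proof -
    have "\<bar>y / (2 * b) - of_int k\<bar> \<le> 1 / 2"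
      using of_int_round_abs_le[of "y / (2 * b)"] by (simp add: k_def abs_minus_commute)
    then have "\<bar>y / (2 * b) - of_int k\<bar> * (2 * b) \<le> 1 / 2 * (2 * b)" using b_pos by (intro mult_right_mono) auto
    moreover have "\<bar>y / (2 * b) - of_int k\<bar> * (2 * b) = \<bar>(y / (2 * b) - of_int k) * (2 * b)\<bar>"
      using b_pos by (simp add: abs_mult)
    moreover have "(y / (2 * b) - of_int k) * (2 * b) = u" using b_pos by (simp add: u_def field_simps)
    ultimately show ?thesis by simp
  qed
  have nl: "Complex 0 (2 * u) \<notin> \<Lambda>"
  proof
    assume "Complex 0 (2 * u) \<in> \<Lambda>"
    moreover have "2 * Complex 0 y = Complex 0 (2 * u) + Complex 0 (of_int (2 * k) * (2 * b))"
      by (simp add: u_def complex_eq_iff)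
    ultimately show False using assms lattice_add lattice_Complex_int(2) by metis
  qed
  have "u \<noteq> 0" using nl lattice_Complex_int(2)[of 0] by auto
  moreover have "\<bar>u\<bar> \<noteq> b"
  proof
    assume "\<bar>u\<bar> = b"
    then have "2 * u = of_int 1 * (2 * b) \<or> 2 * u = of_int (- 1) * (2 * b)" by (auto simp: abs_if split: if_splits)
    then show False using nl lattice_Complex_int(2) by metis
  qed
  ultimately have u': "0 < \<bar>u\<bar>" "\<bar>u\<bar> < b" using u by auto
  define s :: int where "s = (if u > 0 then 1 else - 1)"
  have "of_int s * Complex 0 y - Complex 0 \<bar>u\<bar> = Complex 0 (of_int (s * k) * (2 * b))"
    using u'(1) by (auto simp: complex_eq_iff u_def s_def abs_if)
  then have "of_int s * Complex 0 y - Complex 0 \<bar>u\<bar> \<in> \<Lambda>" using lattice_Complex_int(2) by metis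
  then show ?thesis by (rule that[OF u', rotated]) (simp add: s_def)
qed

lemma hecke_real_DERIV:
  assumes "Complex x 0 \<notin> \<Lambda>"
  shows "((\<lambda>t. Re (hecke (Complex t 0))) has_real_derivative - Re (wp (Complex x 0))) (at x)"
proof -
  have "((\<lambda>t. - 2 * pi * green_dx (Complex t 0)) has_real_derivative - 2 * pi * (Re (wp (Complex x 0)) / (2 * pi))) (at x)"
    by (intro DERIV_cmult green_dx_DERIV assms)
  then show ?thesis by (simp add: green_dx_def)
qed

lemma hecke_half: "hecke (1 / 2) = 0"
  by (rule hecke_half_period) simp

end

text \<open>Half periods account for at most three classes, so a nontrivial critical point
  \<open>a\<close> exists. Without reflection symmetry, \<open>a\<close>, \<open>- a\<close>,
  \<open>cnj a\<close> and the half periods would form six classes. On the real axis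
  \<open>Re hecke\<close> would decrease strictly to its zero at \<open>1/2\<close>, which is
  impossible; on the imaginary axis \<open>Re wp\<close> reaches \<open>2 * pi / b\<close> below
  height \<open>b\<close> and still increases to \<open>wp (1/2)\<close>.\<close>

lemma (in rhombic_torus) critical_points_card_imp_long:
  assumes "b > 1 / 2" and card: "card (green_critical_points tau) = 5"
  shows "Re (wp (1 / 2)) > 2 * pi / b"
proof -
  define cls where "cls = (\<lambda>z. torus_rel tau `` {z})"
  define Q where "Q = green_critical_points tau"
  have Q: "Q = cls ` {z. critical_point (green tau) z}"
    by (auto simp: Q_def green_critical_points_def quotient_def cls_def)
  have fin: "finite Q" using card card.infinite[of Q] by (auto simp: Q_def)
  have cls_eq: "cls z = cls w \<longleftrightarrow> z - w \<in> \<Lambda>" for z w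
  proof
    assume "cls z = cls w"
    moreover have "w \<in> cls w" by (simp add: cls_def torus_rel_iff)
    ultimately have "w \<in> cls z" by simp
    then show "z - w \<in> \<Lambda>" by (simp add: cls_def torus_rel_iff)
  next
    assume zw: "z - w \<in> \<Lambda>"
    have "z - v \<in> \<Lambda> \<longleftrightarrow> w - v \<in> \<Lambda>" for v
      using lattice_shift[OF zw, of "w - v"] by simp
    then show "cls z = cls w" by (auto simp: cls_def torus_rel_iff)
  qed
  have crit_tors: "critical_point (green tau) z" if "2 * z \<in> \<Lambda>" "z \<notin> \<Lambda>" for z
    using that hecke_half_period by (simp add: critical_point_green)
  have t3: "(1 + tau) / 2 \<notin> \<Lambda>"
  proof
    assume "(1 + tau) / 2 \<in> \<Lambda>"
    then have "cnj ((1 + tau) / 2) \<in> \<Lambda>" by (rule lattice_cnj)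
    moreover have "tau / 2 = 1 - cnj ((1 + tau) / 2)" by (simp add: complex_eq_iff)
    ultimately have "tau / 2 \<in> \<Lambda>" using lattice_diff[OF lattice_1] by metis
    then show False using half_tau_off_lattice by blast
  qed
  have d12: "1 / 2 - tau / 2 \<notin> \<Lambda>"
  proof
    assume "1 / 2 - tau / 2 \<in> \<Lambda>"
    then have "(1 / 2 - tau / 2) + tau \<in> \<Lambda>" by (rule lattice_add) simp
    moreover have "(1 / 2 - tau / 2) + tau = (1 + tau) / 2" by (simp add: field_simps)
    ultimately show False using t3 by simp
  qed
  have d13: "1 / 2 - (1 + tau) / 2 \<notin> \<Lambda>"
  proof -
    have "1 / 2 - (1 + tau) / 2 = - (tau / 2)" by (simp add: field_simps)
    then show ?thesis using half_tau_off_lattice by simp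
  qed
  have d23: "tau / 2 - (1 + tau) / 2 \<notin> \<Lambda>"
  proof -
    have "tau / 2 - (1 + tau) / 2 = - (1 / 2)" by (simp add: field_simps)
    then show ?thesis using half_off_lattice by simp
  qed
  define T where "T = {1 / 2, tau / 2, (1 + tau) / 2}"
  have T: "2 * t \<in> \<Lambda>" "t \<notin> \<Lambda>" if "t \<in> T" for t
  proof -
    have t: "t = 1 / 2 \<or> t = tau / 2 \<or> t = (1 + tau) / 2" using that by (simp add: T_def)
    then have "t \<in> two_torsion tau" unfolding two_torsion_def
      by (intro CollectI exI[of _ t] exI[of _ 0] conjI) auto
    then show "2 * t \<in> \<Lambda>" by (simp only: two_torsion_iff)
    show "t \<notin> \<Lambda>" using t half_off_lattice half_tau_off_lattice t3 by metis
  qed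
  have "cls ` T \<subseteq> Q" using crit_tors T by (auto simp: Q)
  moreover have "card (cls ` T) \<le> 3"
    using card_image_le[of T cls] card_insert_le_m1[of 3] by (simp add: T_def card_insert_if split: if_splits)
  then have "cls ` T \<noteq> Q" using card by (auto simp: Q_def)
  ultimately obtain a where a: "critical_point (green tau) a" "cls a \<notin> cls ` T" using Q by blast
  have a_off: "a \<notin> \<Lambda>" "hecke a = 0" using a(1) critical_point_green by auto
  have a2: "2 * a \<notin> \<Lambda>"
  proof
    assume "2 * a \<in> \<Lambda>"
    then have "a \<in> two_torsion tau" by (simp only: two_torsion_iff)
    then obtain t w where tw: "a = t + w" "t \<in> {0, 1/2, tau/2, (1 + tau)/2}" "w \<in> \<Lambda>"
      unfolding two_torsion_def by blast
    then have "t \<noteq> 0" using a_off by (intro notI) simp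
    then have "t \<in> T" using tw(2) unfolding T_def by blast
    moreover have "cls a = cls t" using tw by (simp add: cls_eq)
    ultimately show False using a(2) by blast
  qed
  have sym: "a - cnj a \<in> \<Lambda> \<or> a + cnj a \<in> \<Lambda>"
  proof (rule ccontr)
    assume n: "\<not> (a - cnj a \<in> \<Lambda> \<or> a + cnj a \<in> \<Lambda>)"
    have ca2: "2 * cnj a \<notin> \<Lambda>" using a2 lattice_cnj_iff[of "2 * a"] by simp
    have ntors: "t - z \<notin> \<Lambda>" if "t \<in> T" "2 * z \<notin> \<Lambda>" for t z
    proof
      assume "t - z \<in> \<Lambda>"
      then have "(t - z) + (t - z) \<in> \<Lambda>" by (intro lattice_add)
      then have "2 * t - ((t - z) + (t - z)) \<in> \<Lambda>" using T(1)[OF that(1)] by (intro lattice_diff)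
      then show False using that(2) by simp
    qed
    have crit': "critical_point (green tau) (- a)" "critical_point (green tau) (cnj a)"
      using a_off hecke_uminus[of a] cnj_hecke[of a] by (simp_all add: critical_point_green)
    define L where "L = map cls [1 / 2, tau / 2, (1 + tau) / 2, a, - a, cnj a]"
    have T_mem: "1 / 2 \<in> T" "tau / 2 \<in> T" "(1 + tau) / 2 \<in> T" by (auto simp: T_def)
    have n1: "a - cnj a \<notin> \<Lambda>" and n2: "- a - cnj a \<notin> \<Lambda>"
      using n lattice_minus_iff[of "a + cnj a"] by auto
    have n3: "a - - a \<notin> \<Lambda>" using a2 by simp
    have nT: "t - a \<notin> \<Lambda>" "t - - a \<notin> \<Lambda>" "t - cnj a \<notin> \<Lambda>" if "t \<in> T" for t
      using ntors[OF that, of a] ntors[OF that, of "- a"] ntors[OF that, of "cnj a"] a2 ca2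
        lattice_minus_iff[of "2 * a"] by simp_all
    have "distinct L"
      unfolding L_def list.map distinct.simps list.set insert_iff empty_iff cls_eq
      using d12 d13 d23 n1 n2 n3 nT[OF T_mem(1)] nT[OF T_mem(2)] nT[OF T_mem(3)] by blast
    then have "card (set L) = 6" by (simp add: distinct_card L_def)
    moreover have "set L \<subseteq> Q" using crit_tors T T_mem a(1) crit' by (auto simp: L_def Q)
    ultimately show False using card_mono[OF fin, of "set L"] card by (simp add: Q_def)
  qed
  have hecke_s: "hecke c = 0" if "s \<in> {1, - 1 :: int}" "of_int s * z - c \<in> \<Lambda>" "a - z \<in> \<Lambda>" for s z c
  proof -
    have "hecke z = 0" using hecke_lattice[OF that(3), of z] a_off by simp
    then have "hecke (of_int s * z) = 0" using that(1) hecke_uminus[of z] by auto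
    then show ?thesis using hecke_lattice[OF that(2), of c] by simp
  qed
  have a2_shift: "2 * z \<notin> \<Lambda>" if "a - z \<in> \<Lambda>" for z
  proof
    assume "2 * z \<in> \<Lambda>"
    then have "2 * z + ((a - z) + (a - z)) \<in> \<Lambda>" using that by (intro lattice_add)
    then show False using a2 by simp
  qed
  from sym have "conj_symmetric tau a" by (simp add: conj_symmetric_iff)
  then show ?thesis
  proof (cases rule: conj_symmetric_cases)
    case (real x)
    obtain x' s where x': "0 < x'" "x' < 1 / 2" "s \<in> {1, - 1 :: int}" "of_int s * Complex x 0 - Complex x' 0 \<in> \<Lambda>"
      using real_representative[OF a2_shift[OF real]] by metis
    have h0: "hecke (Complex x' 0) = 0" by (rule hecke_s[OF x'(3,4) real])
    have "Re (hecke (Complex (1 / 2) 0)) < Re (hecke (Complex x' 0))"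
    proof (rule DERIV_neg_imp_decreasing[OF x'(2)])
      fix t assume t: "x' \<le> t" "t \<le> 1 / 2"
      have "0 < Re (wp (Complex (1 / 2) 0))" using Re_wp_half_pos[OF assms(1)] by (simp only: Complex_half_0)
      also have "\<dots> \<le> Re (wp (Complex t 0))"
      proof (cases "t = 1 / 2")
        case False
        then show ?thesis using wp_real_strict_antimono[of t "1 / 2"] t x'(1) by simp
      qed (simp only: order.refl)
      finally show "\<exists>d. ((\<lambda>t. Re (hecke (Complex t 0))) has_real_derivative d) (at t) \<and> d < 0"
        using hecke_real_DERIV[of t] not_lattice_Re[of t] t x' by auto
    qed
    then show ?thesis using h0 hecke_half by (simp add: Complex_half_0)
  next
    case (imaginary y)
    obtain y' s where y': "0 < y'" "y' < b" "s \<in> {1, - 1 :: int}" "of_int s * Complex 0 y - Complex 0 y' \<in> \<Lambda>"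
      using imaginary_representative[OF a2_shift[OF imaginary]] by metis
    have h0: "hecke (Complex 0 y') = 0" by (rule hecke_s[OF y'(3,4) imaginary])
    have "(vfun 0 has_real_derivative 2 * pi / b - Re (wp (Complex 0 t))) (at t)" if "y' \<le> t" "t \<le> b" for t
      by (rule vfun_DERIV, rule not_lattice_imaginary) (use that y'(1) in simp_all)
    \<comment> \<open>Rolle's theorem between the critical point and the half period
      \<open>\<i> * b\<close>, both zeros of \<open>vfun 0\<close>.\<close>
    from MVT2[OF y'(2) this] obtain \<xi> where \<xi>: "y' < \<xi>" "\<xi> < b"
      "vfun 0 b - vfun 0 y' = (b - y') * (2 * pi / b - Re (wp (Complex 0 \<xi>)))" by blast
    have "vfun 0 y' = 0" using h0 by (simp add: vfun_def)
    then have "2 * pi / b - Re (wp (Complex 0 \<xi>)) = 0" using \<xi>(3) vfun_b y'(2) by simp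
    moreover have "Re (wp (Complex 0 \<xi>)) < Re (wp (Complex 0 b))"
      using wp_imaginary_strict_mono[of \<xi> b] \<xi> y' by simp
    ultimately show ?thesis by (simp add: wp_imaginary_b)
  qed
qed

context long_rhombic_torus
begin

text \<open>The bound \<open>2 * pi / b\<close> from \<open>wp_real_large\<close> is positive;
  evenness and the period 1 extend positivity from the half segment.\<close>

lemma Re_wp_real_pos:
  assumes "\<bar>x\<bar> < 1" "x \<noteq> 0"
  shows "Re (wp (Complex x 0)) > 0"
proof -
  have pos: "Re (wp (Complex t 0)) > 0" if "0 < t" "t \<le> 1 / 2" for t
    using wp_real_large[OF that] b_pos by (smt (verit) divide_pos_pos pi_gt_zero mult_pos_pos)
  have flip: "wp (Complex (- t) 0) = wp (Complex t 0)" for t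
  proof -
    have "Complex (- t) 0 = - Complex t 0" by (simp add: complex_eq_iff)
    then show ?thesis by (simp only: wp_uminus)
  qed
  have pos': "Re (wp (Complex t 0)) > 0" if "0 < t" "t < 1" for t
  proof (cases "t \<le> 1 / 2")
    case False
    have "Complex t 0 = Complex (- (1 - t)) 0 + 1" by (simp add: complex_eq_iff)
    then have "wp (Complex t 0) = wp (Complex (1 - t) 0)" by (simp only: wp_plus_1 flip)
    then show ?thesis using pos[of "1 - t"] that False by simp
  qed (use that pos in auto)
  show ?thesis using pos'[of x] pos'[of "- x"] flip[of x] assms by (cases "x > 0") auto
qed

lemma not_lattice_real: "\<bar>x\<bar> < 1 \<Longrightarrow> x \<noteq> 0 \<Longrightarrow> Complex x 0 \<notin> \<Lambda>"
  unfolding lattice_Complex using b_pos by auto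

section \<open>The pair equation on the two axes\<close>

definition pair_fun :: "real \<Rightarrow> complex \<Rightarrow> complex" where
  "pair_fun p z = hecke (z - Complex p 0) + hecke (z + Complex p 0)"

lemma pair_fun_lattice: "w \<in> \<Lambda> \<Longrightarrow> pair_fun p (z + w) = pair_fun p z"
  using hecke_lattice[of w "z - Complex p 0"] hecke_lattice[of w "z + Complex p 0"]
  by (simp add: pair_fun_def algebra_simps)

lemma pair_fun_uminus: "pair_fun p (- z) = - pair_fun p z"
proof -
  have "- z - Complex p 0 = - (z + Complex p 0)" "- z + Complex p 0 = - (z - Complex p 0)" by simp_all
  then show ?thesis unfolding pair_fun_def by (simp only: hecke_uminus) simp
qed

text \<open>Both summands have derivative \<open>- Re wp < 0\<close>, so the sum decreases strictly
  on each side of the pole at \<open>p\<close>. It vanishes at the half periods \<open>0\<close> and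
  \<open>1/2\<close>, the outer ends of these two pieces, and hence not in between.\<close>

lemma pair_fun_real_nonzero:
  assumes p: "0 < p" "p < 1 / 2" and x: "0 < x" "x < 1 / 2" "x \<noteq> p"
  shows "pair_fun p (Complex x 0) \<noteq> 0"
proof -
  define q where "q = (\<lambda>t. Re (hecke (Complex t 0)))"
  define f where "f = (\<lambda>t. q (t - p) + q (t + p))"
  have f_eq: "f t = Re (pair_fun p (Complex t 0))" for t
    by (simp add: f_def q_def pair_fun_def complex_diff complex_add)
  have D: "\<exists>d. (f has_real_derivative d) (at t) \<and> d < 0" if "\<bar>t - p\<bar> < 1" "t - p \<noteq> 0" "\<bar>t + p\<bar> < 1" "t + p \<noteq> 0" for t
  proof -
    have q: "((\<lambda>t. q (t + c)) has_real_derivative - Re (wp (Complex (t + c) 0))) (at t)"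
      if "\<bar>t + c\<bar> < 1" "t + c \<noteq> 0" for c
      unfolding DERIV_shift[symmetric] unfolding q_def
      by (rule hecke_real_DERIV) (use that not_lattice_real in auto)
    have "((\<lambda>t. q (t + - p)) has_real_derivative - Re (wp (Complex (t - p) 0))) (at t)"
      "((\<lambda>t. q (t + p)) has_real_derivative - Re (wp (Complex (t + p) 0))) (at t)"
      using q[of "- p"] q[of p] that by simp_all
    from DERIV_add[OF this] have "(f has_real_derivative - Re (wp (Complex (t - p) 0)) + - Re (wp (Complex (t + p) 0))) (at t)"
      by (simp add: f_def)
    moreover have "- Re (wp (Complex (t - p) 0)) + - Re (wp (Complex (t + p) 0)) < 0"
      using Re_wp_real_pos[of "t - p"] Re_wp_real_pos[of "t + p"] that by simp
    ultimately show ?thesis by blast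
  qed
  have "f x \<noteq> 0"
  proof (cases "x < p")
    case True
    have "f x < f 0"
      by (rule DERIV_neg_imp_decreasing[OF x(1)]) (use p True in \<open>auto intro!: D\<close>)
    moreover have "f 0 = 0"
      using pair_fun_uminus[of p "Complex 0 0"] by (simp add: f_eq complex_minus eq_neg_iff_add_eq_0 complex_eq_iff)
    ultimately show ?thesis by simp
  next
    case False
    have "f (1 / 2) < f x"
      by (rule DERIV_neg_imp_decreasing[OF x(2)]) (use p False x in \<open>auto intro!: D\<close>)
    moreover have "f (1 / 2) = 0"
    proof -
      have "Complex (1 / 2) 0 = - Complex (1 / 2) 0 + 1" by (simp add: complex_eq_iff)
      then have "pair_fun p (Complex (1 / 2) 0) = - pair_fun p (Complex (1 / 2) 0)"
        by (metis pair_fun_lattice[OF lattice_1] pair_fun_uminus)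
      then show ?thesis by (simp add: f_eq complex_eq_iff)
    qed
    ultimately show ?thesis by simp
  qed
  then show ?thesis by (auto simp: f_eq)
qed

text \<open>The points \<open>\<i> * y - p\<close> and \<open>\<i> * y + p\<close> are mirror images
  in the imaginary axis, so the real parts of \<open>hecke\<close> cancel and one real equation is
  left.\<close>

lemma pair_fun_imaginary: "pair_fun p (Complex 0 y) = of_real (2 * vfun p y) * \<i>"
proof -
  have "Complex 0 y - Complex p 0 = - cnj (Complex p y)" "Complex 0 y + Complex p 0 = Complex p y"
    by (simp_all add: complex_eq_iff)
  then have "pair_fun p (Complex 0 y) = - cnj (hecke (Complex p y)) + hecke (Complex p y)"
    unfolding pair_fun_def by (simp only: hecke_neg_cnj)
  then show ?thesis by (simp add: complex_eq_iff vfun_def)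
qed

lemma critical_point_pair_fun:
  assumes "0 < p" "p < 1 / 2"
  shows "critical_point (green_pair tau (of_real p)) z \<longleftrightarrow>
    z - of_real p \<notin> \<Lambda> \<and> z + of_real p \<notin> \<Lambda> \<and> pair_fun p z = 0"
proof -
  have "2 * complex_of_real p = Complex (2 * p) 0" by (simp add: complex_eq_iff)
  then have "2 * complex_of_real p \<notin> \<Lambda>" using not_lattice_Re[of "2 * p"] assms by simp
  from critical_point_green_pair[OF this, of z] show ?thesis
    by (simp add: pair_fun_def complex_of_real_def)
qed

text \<open>Symmetric points can be moved to an axis by the lattice and a sign; the real axis
  carries no solution and the imaginary one only the zero of \<open>vfun p\<close>. The equivalence
  holds existence and uniqueness of the pair at once.\<close>

lemma symmetric_critical_point_iff:
  assumes p: "0 < p" "p < 1 / 2"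
  shows "nontrivial_critical_point tau (of_real p) z \<and> conj_symmetric tau z \<longleftrightarrow>
    z - Complex 0 (crit_y p) \<in> \<Lambda> \<or> z + Complex 0 (crit_y p) \<in> \<Lambda>"
proof -
  define a where "a = Complex 0 (crit_y p)"
  have cy: "0 < crit_y p" "crit_y p < b" "vfun p (crit_y p) = 0" using crit_y[of p] p by auto
  have P: "complex_of_real p = Complex p 0" by (simp add: complex_of_real_def)
  have a_props: "a - of_real p \<notin> \<Lambda>" "a + of_real p \<notin> \<Lambda>" "2 * a \<notin> \<Lambda>" "pair_fun p a = 0" "a + cnj a \<in> \<Lambda>"
  proof -
    show "a - of_real p \<notin> \<Lambda>" "a + of_real p \<notin> \<Lambda>"
      using cy not_lattice_Im[of "crit_y p" "- p"] not_lattice_Im[of "crit_y p" p]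
      by (simp_all add: a_def P complex_diff complex_add)
    show "pair_fun p a = 0" using cy(3) by (simp add: a_def pair_fun_imaginary)
    have "a + cnj a = 0" by (simp add: a_def complex_eq_iff)
    then show "a + cnj a \<in> \<Lambda>" by simp
    show "2 * a \<notin> \<Lambda>"
    proof
      assume "2 * a \<in> \<Lambda>"
      then obtain m n :: int where mn: "0 = of_int m + of_int n / (2::real)" "2 * crit_y p = of_int n * b"
        unfolding lattice_coords by (auto simp: a_def)
      have "n = - 2 * m" using mn(1) by simp
      then have "crit_y p = of_int (- m) * b" using mn(2) by simp
      then have "0 < of_int (- m) * b" "of_int (- m) * b < 1 * b" using cy by auto
      then have "0 < real_of_int (- m)" "real_of_int (- m) < 1"
        using b_pos zero_less_mult_pos2 mult_less_cancel_right_pos[OF b_pos] by blast+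
      then have "0 < - m" "- m < 1" by (simp_all only: of_int_0_less_iff of_int_less_1_iff)
      then show False by simp
    qed
  qed
  \<comment> \<open>Collects the conditions other than reflection symmetry; being stable under
    lattice shifts and sign, they pass to representatives.\<close>
  define good where "good = (\<lambda>z. z - of_real p \<notin> \<Lambda> \<and> z + of_real p \<notin> \<Lambda> \<and> pair_fun p z = 0 \<and> 2 * z \<notin> \<Lambda>)"
  have lhs: "nontrivial_critical_point tau (of_real p) z \<and> conj_symmetric tau z \<longleftrightarrow> good z \<and> conj_symmetric tau z" for z
    unfolding nontrivial_critical_point_def critical_point_pair_fun[OF p] two_torsion_iff good_def by blast
  have good_shift: "good (z + w) \<longleftrightarrow> good z" if "w \<in> \<Lambda>" for z w
  proof -
    have "z + w - of_real p = (z - of_real p) + w" "z + w + of_real p = (z + of_real p) + w" "2 * (z + w) = 2 * z + (w + w)"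
      by simp_all
    then show ?thesis
      unfolding good_def by (simp only: lattice_shift[OF that] lattice_shift[OF lattice_add[OF that that]] pair_fun_lattice[OF that])
  qed
  have good_minus: "good (- z) \<longleftrightarrow> good z" for z
  proof -
    have "- z - of_real p = - (z + of_real p)" "- z + of_real p = - (z - of_real p)" "2 * - z = - (2 * z)" by simp_all
    then show ?thesis
      unfolding good_def by (simp only: lattice_minus_iff pair_fun_uminus neg_equal_0_iff_equal) blast
  qed
  have good_a: "good a" using a_props by (simp add: good_def)
  have sym_shift: "conj_symmetric tau z" if "z - c \<in> \<Lambda>" "c + cnj c = 0" for z c
  proof -
    have "(z - c) + cnj (z - c) \<in> \<Lambda>" using that(1) by (intro lattice_add lattice_cnj)
    moreover have "(z - c) + cnj (z - c) = z + cnj z - (c + cnj c)" by simp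
    ultimately have "z + cnj z \<in> \<Lambda>" by (simp only: that(2) diff_zero)
    then show ?thesis by (simp add: conj_symmetric_iff)
  qed
  show ?thesis
    unfolding lhs a_def[symmetric]
  proof
    assume z: "good z \<and> conj_symmetric tau z"
    then have sym: "conj_symmetric tau z" by simp
    have good_s: "good c" if "s \<in> {1, - 1 :: int}" "of_int s * u - c \<in> \<Lambda>" "z - u \<in> \<Lambda>" for s u c
    proof -
      have "good u" using good_shift[OF that(3), of u] z by simp
      then have "good (of_int s * u)" using that(1) good_minus[of u] by auto
      then show ?thesis using good_shift[OF that(2), of c] by simp
    qed
    have nt: "2 * u \<notin> \<Lambda>" if "z - u \<in> \<Lambda>" for u
      using good_shift[OF that, of u] z by (simp add: good_def)
    from sym show "z - a \<in> \<Lambda> \<or> z + a \<in> \<Lambda>"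
    proof (cases rule: conj_symmetric_cases)
      case (real x)
      obtain x' s where x': "0 < x'" "x' < 1 / 2" "s \<in> {1, - 1 :: int}" "of_int s * Complex x 0 - Complex x' 0 \<in> \<Lambda>"
        using real_representative[OF nt[OF real]] by metis
      have g: "good (Complex x' 0)" by (rule good_s[OF x'(3,4) real])
      have "x' \<noteq> p" using g by (auto simp: good_def P)
      then show ?thesis using g pair_fun_real_nonzero[OF p x'(1,2)] by (simp add: good_def)
    next
      case (imaginary y)
      obtain y' s where y': "0 < y'" "y' < b" "s \<in> {1, - 1 :: int}" "of_int s * Complex 0 y - Complex 0 y' \<in> \<Lambda>"
        using imaginary_representative[OF nt[OF imaginary]] by metis
      have "good (Complex 0 y')" by (rule good_s[OF y'(3,4) imaginary])
      then have "vfun p y' = 0" by (simp add: good_def pair_fun_imaginary)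
      then have "Complex 0 y' = a" using crit_y_unique[of p y'] y' p by (simp add: a_def)
      then have s: "of_int s * Complex 0 y - a \<in> \<Lambda>" using y' by simp
      from y'(3) show ?thesis
      proof (elim insertE emptyE)
        assume "s = 1"
        then have "Complex 0 y - a \<in> \<Lambda>" using s by simp
        from lattice_add[OF imaginary this] show ?thesis by simp
      next
        assume "s = - 1"
        then have "- Complex 0 y - a \<in> \<Lambda>" using s by simp
        from lattice_diff[OF imaginary this] show ?thesis by simp
      qed
    qed
  next
    assume "z - a \<in> \<Lambda> \<or> z + a \<in> \<Lambda>"
    then show "good z \<and> conj_symmetric tau z"
    proof
      assume "z - a \<in> \<Lambda>"
      then show ?thesis using good_shift[of "z - a" a] good_a sym_shift[of z a] by (simp add: a_def complex_eq_iff)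
    next
      assume "z + a \<in> \<Lambda>"
      then show ?thesis
        using good_shift[of "z + a" "- a"] good_minus[of a] good_a sym_shift[of z "- a"] by (simp add: a_def complex_eq_iff)
    qed
  qed
qed

text \<open>At the symmetric pair the two \<open>wp\<close> values are complex conjugates, so the
  determinant factors; its second factor is positive by the slope bound in \<open>crit_y\<close>,
  which leaves \<open>Re wp = 0\<close>.\<close>

lemma degenerate_symmetric_critical_point:
  assumes p: "0 < p" "p < 1 / 2"
    and a: "nontrivial_critical_point tau (of_real p) a" "conj_symmetric tau a"
      "degenerate (green_pair tau (of_real p)) a"
  shows "p \<in> degenerate_set"
proof -
  define c where "c = crit_pt p"
  have c: "c = Complex p (crit_y p)" by (simp add: c_def crit_pt_def)
  have P: "complex_of_real p = Complex p 0" by (simp add: complex_of_real_def)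
  have off: "a - of_real p \<notin> \<Lambda>" "a + of_real p \<notin> \<Lambda>"
    using a(1) critical_point_pair_fun[OF p] by (auto simp: nontrivial_critical_point_def)
  have "a - Complex 0 (crit_y p) \<in> \<Lambda> \<or> a + Complex 0 (crit_y p) \<in> \<Lambda>"
    using symmetric_critical_point_iff[OF p] a by blast
  then have "wp (a - of_real p) + wp (a + of_real p) = of_real (2 * Re (wp c))"
  proof
    assume w: "a - Complex 0 (crit_y p) \<in> \<Lambda>"
    have "a - of_real p = - cnj c + (a - Complex 0 (crit_y p))" "a + of_real p = c + (a - Complex 0 (crit_y p))"
      by (simp_all add: c P complex_eq_iff)
    then have "wp (a - of_real p) = cnj (wp c)" "wp (a + of_real p) = wp c"
      by (simp_all only: wp_lattice[OF w] wp_neg_cnj)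
    then show ?thesis by (simp add: complex_eq_iff)
  next
    assume w: "a + Complex 0 (crit_y p) \<in> \<Lambda>"
    have "a - of_real p = - c + (a + Complex 0 (crit_y p))" "a + of_real p = cnj c + (a + Complex 0 (crit_y p))"
      by (simp_all add: c P complex_eq_iff)
    then have "wp (a - of_real p) = wp c" "wp (a + of_real p) = cnj (wp c)"
      by (simp_all only: wp_lattice[OF w] wp_uminus cnj_wp)
    then show ?thesis by (simp add: complex_eq_iff)
  qed
  from det_hessian_green_pair[OF off this] a(3)
  have "Re (wp c) / (2 * pi) * (1 / b - Re (wp c) / (2 * pi)) = 0"
    by (simp add: degenerate_def)
  moreover have "Re (wp c) / (2 * pi) < 1 / b"
  proof -
    have "Re (wp c) < 2 * pi / b" using crit_y(4)[of p] p by (simp add: c)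
    then show ?thesis using b_pos by (simp add: field_simps)
  qed
  ultimately have "Re (wp c) = 0" by simp
  then show ?thesis using p by (simp add: degenerate_set_def c_def)
qed

end

theorem corollary1p8:
  fixes b0 b1 b :: real and \<tau> :: complex
  assumes "lin_wang_constants b0 b1"
    and "b > b1"
    and "\<tau> = Complex (1 / 2) b"
  shows "(\<forall>p::real. p \<in> {0<..<1 / 2} \<longrightarrow>
            (\<exists>a. \<forall>z. (nontrivial_critical_point \<tau> (of_real p) z \<and> conj_symmetric \<tau> z) \<longleftrightarrow>
                     ((z, a) \<in> torus_rel \<tau> \<or> (z, - a) \<in> torus_rel \<tau>)))
       \<and> finite {p::real. p \<in> {0<..<1 / 2} \<and>
            (\<exists>a. nontrivial_critical_point \<tau> (of_real p) a \<and> conj_symmetric \<tau> a \<and>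
                 degenerate (green_pair \<tau> (of_real p)) a)}"
proof -
  have b1: "1 / 2 < b1" using assms(1) by (simp add: lin_wang_constants_def)
  then interpret R: rhombic_torus b using assms(2) by unfold_locales simp
  have \<tau>: "\<tau> = R.tau" using assms(3) by (simp add: R.tau_def)
  have "card (green_critical_points (Complex (1 / 2) b)) = 5"
    using assms(1,2) b1 unfolding lin_wang_constants_def by auto
  then have "Re (R.wp (1 / 2)) > 2 * pi / b"
    using R.critical_points_card_imp_long assms(2) b1 by (simp add: R.tau_def)
  then interpret L: long_rhombic_torus b by unfold_locales
  show ?thesis
    unfolding \<tau>
  proof (intro conjI allI impI)
    fix p :: real assume "p \<in> {0<..<1 / 2}"
    \<comment> \<open>The witness lies on the imaginary axis, at the height of the critical curve
      over \<open>p\<close>.\<close>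
    then have "\<forall>z. (nontrivial_critical_point R.tau (of_real p) z \<and> conj_symmetric R.tau z) \<longleftrightarrow>
        ((z, Complex 0 (L.crit_y p)) \<in> torus_rel R.tau \<or> (z, - Complex 0 (L.crit_y p)) \<in> torus_rel R.tau)"
      using L.symmetric_critical_point_iff[of p] by (auto simp: R.torus_rel_iff)
    then show "\<exists>a. \<forall>z. (nontrivial_critical_point R.tau (of_real p) z \<and> conj_symmetric R.tau z) \<longleftrightarrow>
        ((z, a) \<in> torus_rel R.tau \<or> (z, - a) \<in> torus_rel R.tau)" by blast
  next
    show "finite {p::real. p \<in> {0<..<1 / 2} \<and>
            (\<exists>a. nontrivial_critical_point R.tau (of_real p) a \<and> conj_symmetric R.tau a \<and>
                 degenerate (green_pair R.tau (of_real p)) a)}"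
      by (rule finite_subset[OF _ L.finite_degenerate_set])
         (auto intro: L.degenerate_symmetric_critical_point)
  qed
qed

end
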